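(* Let $d\geq 1$ and let $X$ be a $d$-dimensional cell complex that is acyclic in positive codimension (APC). Then: (1) $$\pi_d(X) = \frac{\tau_d(X)\,\tau_{d-1}(X)}{|\tilde H_{d-2}(X;\mathbb{Z})|^2}.$$ (2) Let $L=L^{\rm ud}_{X,d-1}$, let $U$ be the set of $(d-1)$-cells of a cellular spanning $(d-1)$-tree of $X$, let $X_U=U\cup X_{(d-2)}$ (i.e. that spanning tree), and let $L_U$ denote the reduced Laplacian obtained from $L$ by deleting the rows and columns corresponding to $U$. Then $$\tau_d(X) = \frac{|\tilde H_{d-2}(X;\mathbb{Z})|^2}{|\tilde H_{d-2}(X_U;\mathbb{Z})|^2}\, \det L_U.$$
   Context: A cell complex is a finite CW complex. $X_i$ denotes the set of $i$-dimensional cells of $X$ and $X_{(i)}=X_0\cup\cdots\cup X_i$ its $i$-skeleton ($X_{(-1)}=\emptyset$). $C_i(X)$ is the free $\mathbb{Z}$-module with basis $X_i$; $\partial_{X,i}\colon C_i(X)\to C_{i-1}(X)$ is the cellular boundary map, viewed as an integer matrix with rows indexed by $X_{i-1}$ and columns indexed by $X_i$; $\partial^*_{X,i}\colon C_{i-1}(X)\to C_i(X)$ is the coboundary map, i.e. its transpose. $\tilde H_i$ denotes reduced cellular homology (so $\tilde H_{-1}$ of a nonempty complex is $0$), and $\tilde\beta_i(X)$ is the rank of $\tilde H_i(X;\mathbb{Z})$. $X$ is acyclic in positive codimension (APC) if $\tilde\beta_j(X)=0$ for all $j<\dim X$. A cellular spanning $k$-tree ($k$-CST) of $X$, for $0\le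 k\leq \dim X$, is a $k$-dimensional subcomplex $Y\subseteq X$ (a subcomplex of $X_{(k)}$; the degenerate case in which $Y$ has no $k$-cells is allowed) with $Y_{(k-1)}=X_{(k-1)}$ such that $\tilde H_k(Y;\mathbb{Z})=0$, $|\tilde H_{k-1}(Y;\mathbb{Z})|<\infty$, and $|Y_k|=|X_k|-\tilde\beta_k(X_{(k)})+\tilde\beta_{k-1}(X_{(k)})$. (A $0$-CST is just a vertex.) The set of all $k$-CSTs of $X$ is $\mathcal{T}_k(X)$. The up-down Laplacian is $L^{\rm ud}_{X,i}=\partial_{X,i+1}\partial^*_{X,i+1}$, a symmetric matrix with rows and columns indexed by $X_i$; $s^{\rm ud}_i(X)$ is its multiset of eigenvalues. Define $$\tau_k(X)=\sum_{Y\in\mathcal{T}_k(X)}|\tilde H_{k-1}(Y;\mathbb{Z})|^2\ (0\le k\le d),\qquad \pi_k(X)=\prod_{0\neq\lambda\in s^{\rm ud}_{k-1}(X)}\lambda\ (1\le k\le d),$$ the product being taken with multiplicity. Empty products and determinants of empty matrices are $1$. *)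

theory Defs
  imports
    "HOL-Homology.Homology"
    "HOL-Algebra.Free_Abelian_Groups"
    "Jordan_Normal_Form.Char_Poly"
begin

subsection \<open>Finite CW complexes\<close>

definition ndisk :: "nat \<Rightarrow> (nat \<Rightarrow> real) topology" where
  "ndisk n = subtopology (Euclidean_space n) {x. (\<Sum>i<n. x i ^ 2) \<le> 1}"

definition ndisk_interior :: "nat \<Rightarrow> (nat \<Rightarrow> real) set" where
  "ndisk_interior n = {x \<in> topspace (ndisk n). (\<Sum>i<n. x i ^ 2) < 1}"

text \<open>For \<open>n = 0\<close> the disk is a point and the bounding sphere is empty.\<close>

definition ndisk_sphere :: "nat \<Rightarrow> (nat \<Rightarrow> real) set" where
  "ndisk_sphere n = {x \<in> topspace (ndisk n). (\<Sum>i<n. x i ^ 2) = 1}"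

text \<open>The type \<open>'c\<close> holds names of cells; \<open>cw_char X \<sigma>\<close> is the characteristic map of the cell
  named \<open>\<sigma>\<close>, and thereby also fixes its orientation.\<close>

record ('a, 'c) cw_complex =
  cw_space :: "'a topology"
  cw_cells :: "'c set"
  cw_celldim :: "'c \<Rightarrow> nat"
  cw_char :: "'c \<Rightarrow> (nat \<Rightarrow> real) \<Rightarrow> 'a"

definition open_cell :: "('a, 'c) cw_complex \<Rightarrow> 'c \<Rightarrow> 'a set" where
  "open_cell X \<sigma> = cw_char X \<sigma> ` ndisk_interior (cw_celldim X \<sigma>)"

definition closed_cell :: "('a, 'c) cw_complex \<Rightarrow> 'c \<Rightarrow> 'a set" where
  "closed_cell X \<sigma> = cw_char X \<sigma> ` topspace (ndisk (cw_celldim X \<sigma>))"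

text \<open>As there are only finitely many cells, closure finiteness and the weak topology are
  automatic.\<close>

definition finite_cw_complex :: "('a, 'c) cw_complex \<Rightarrow> bool" where
  "finite_cw_complex X \<longleftrightarrow>
     Hausdorff_space (cw_space X) \<and>
     finite (cw_cells X) \<and>
     (\<forall>\<sigma>\<in>cw_cells X. continuous_map (ndisk (cw_celldim X \<sigma>)) (cw_space X) (cw_char X \<sigma>)) \<and>
     (\<forall>\<sigma>\<in>cw_cells X. embedding_map
        (subtopology (ndisk (cw_celldim X \<sigma>)) (ndisk_interior (cw_celldim X \<sigma>)))
        (cw_space X) (cw_char X \<sigma>)) \<and>
     topspace (cw_space X) = (\<Union>\<sigma>\<in>cw_cells X. open_cell X \<sigma>) \<and>
     disjoint_family_on (open_cell X) (cw_cells X) \<and>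
     (\<forall>\<sigma>\<in>cw_cells X. cw_char X \<sigma> ` ndisk_sphere (cw_celldim X \<sigma>)
        \<subseteq> (\<Union>\<tau>\<in>{\<tau> \<in> cw_cells X. cw_celldim X \<tau> < cw_celldim X \<sigma>}. open_cell X \<tau>))"

text \<open>The empty complex has dimension \<open>-1\<close>.\<close>

definition cw_dim :: "('a, 'c) cw_complex \<Rightarrow> int" where
  "cw_dim X = Max (insert (-1) ((\<lambda>\<sigma>. int (cw_celldim X \<sigma>)) ` cw_cells X))"

definition cells_of_dim :: "('a, 'c) cw_complex \<Rightarrow> int \<Rightarrow> 'c set" where
  "cells_of_dim X i = {\<sigma> \<in> cw_cells X. int (cw_celldim X \<sigma>) = i}"

definition cells_upto :: "('a, 'c) cw_complex \<Rightarrow> int \<Rightarrow> 'c set" where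
  "cells_upto X i = {\<sigma> \<in> cw_cells X. int (cw_celldim X \<sigma>) \<le> i}"

text \<open>Subcomplexes are given by their sets of cells; \<open>cw_restrict X S\<close> is the corresponding
  CW complex in its own right.\<close>

definition subcomplex :: "('a, 'c) cw_complex \<Rightarrow> 'c set \<Rightarrow> bool" where
  "subcomplex X S \<longleftrightarrow>
     S \<subseteq> cw_cells X \<and> (\<forall>\<sigma>\<in>S. closed_cell X \<sigma> \<subseteq> (\<Union>\<tau>\<in>S. open_cell X \<tau>))"

definition cw_restrict :: "('a, 'c) cw_complex \<Rightarrow> 'c set \<Rightarrow> ('a, 'c) cw_complex" where
  "cw_restrict X S =
     X\<lparr>cw_space := subtopology (cw_space X) (\<Union>\<sigma>\<in>S. open_cell X \<sigma>), cw_cells := S\<rparr>"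

definition skeleton :: "('a, 'c) cw_complex \<Rightarrow> int \<Rightarrow> ('a, 'c) cw_complex" where
  "skeleton X i = cw_restrict X (cells_upto X i)"

subsection \<open>The cellular boundary map\<close>

definition skel_space :: "('a, 'c) cw_complex \<Rightarrow> int \<Rightarrow> 'a topology" where
  "skel_space X i = cw_space (skeleton X i)"

text \<open>The group \<open>H\<^sub>i(X\<^sub>(\<^sub>i\<^sub>), X\<^sub>(\<^sub>i\<^sub>-\<^sub>1\<^sub>))\<close> of singular homology, free abelian on the classes of the
  \<open>i\<close>-cells (\<open>cell_class\<close> below).\<close>

definition cellular_group :: "int \<Rightarrow> ('a, 'c) cw_complex \<Rightarrow> 'a chain set monoid" where
  "cellular_group i X =
     relative_homology_group i (skel_space X i) (topspace (skel_space X (i - 1)))"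

text \<open>A generator of the infinite cyclic group \<open>H\<^sub>n(D\<^sup>n, S\<^sup>n\<^sup>-\<^sup>1)\<close>, chosen once for each \<open>n\<close>.\<close>

definition disk_class :: "nat \<Rightarrow> (nat \<Rightarrow> real) chain set" where
  "disk_class n = (let G = relative_homology_group (int n) (ndisk n) (ndisk_sphere n) in
     SOME g. g \<in> carrier G \<and> subgroup_generated G {g} = G)"

definition cell_class :: "('a, 'c) cw_complex \<Rightarrow> 'c \<Rightarrow> 'a chain set" where
  "cell_class X \<sigma> = (let n = cw_celldim X \<sigma> in
     hom_induced (int n) (ndisk n) (ndisk_sphere n)
       (skel_space X (int n)) (topspace (skel_space X (int n - 1)))
       (cw_char X \<sigma>) (disk_class n))"

text \<open>The connecting homomorphism \<open>H\<^sub>i(X\<^sub>(\<^sub>i\<^sub>), X\<^sub>(\<^sub>i\<^sub>-\<^sub>1\<^sub>)) \<rightarrow> H\<^sub>i\<^sub>-\<^sub>1(X\<^sub>(\<^sub>i\<^sub>-\<^sub>1\<^sub>))\<close> followed by the map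
  to \<open>H\<^sub>i\<^sub>-\<^sub>1(X\<^sub>(\<^sub>i\<^sub>-\<^sub>1\<^sub>), X\<^sub>(\<^sub>i\<^sub>-\<^sub>2\<^sub>))\<close>.\<close>

definition cellular_boundary :: "int \<Rightarrow> ('a, 'c) cw_complex \<Rightarrow> 'a chain set \<Rightarrow> 'a chain set" where
  "cellular_boundary i X c =
     hom_induced (i - 1)
       (subtopology (skel_space X i) (topspace (skel_space X (i - 1)))) {}
       (skel_space X (i - 1)) (topspace (skel_space X (i - 2))) id
       (hom_boundary i (skel_space X i) (topspace (skel_space X (i - 1))) c)"

text \<open>\<open>incidence X \<rho> \<sigma>\<close> is the entry in row \<open>\<rho>\<close> and column \<open>\<sigma>\<close> of the boundary matrix, for
  \<open>\<sigma>\<close> of dimension at least 1: the coefficient of \<open>\<rho>\<close> in the expansion of the boundary of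
  \<open>\<sigma>\<close> in the basis of cell classes (the group operation is written multiplicatively).\<close>

definition incidence :: "('a, 'c) cw_complex \<Rightarrow> 'c \<Rightarrow> 'c \<Rightarrow> int" where
  "incidence X \<rho> \<sigma> = (let i = int (cw_celldim X \<sigma>); H = cellular_group (i - 1) X in
     (THE m :: 'c \<Rightarrow> int. (\<forall>\<tau>. \<tau> \<notin> cells_of_dim X (i - 1) \<longrightarrow> m \<tau> = 0) \<and>
        cellular_boundary i X (cell_class X \<sigma>) =
          finprod H (\<lambda>\<tau>. cell_class X \<tau> [^]\<^bsub>H\<^esub> m \<tau>) (cells_of_dim X (i - 1))) \<rho>)"

subsection \<open>Reduced cellular homology\<close>

text \<open>The augmented cellular chain complex: \<open>None\<close> stands for the empty cell, which spans the
  chain group in degree \<open>-1\<close>, and the augmentation sends every vertex to it.\<close>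

definition augmented_cells :: "('a, 'c) cw_complex \<Rightarrow> int \<Rightarrow> 'c option set" where
  "augmented_cells X i = Some ` cells_of_dim X i \<union> (if i = -1 then {None} else {})"

fun augmented_cell_boundary :: "('a, 'c) cw_complex \<Rightarrow> 'c option \<Rightarrow> ('c option \<Rightarrow>\<^sub>0 int)" where
  "augmented_cell_boundary X None = 0"
| "augmented_cell_boundary X (Some \<sigma>) =
     (if cw_celldim X \<sigma> = 0 then frag_of None
      else \<Sum>\<rho>\<in>cells_of_dim X (int (cw_celldim X \<sigma>) - 1).
             frag_cmul (incidence X \<rho> \<sigma>) (frag_of (Some \<rho>)))"

definition red_chains :: "int \<Rightarrow> ('a, 'c) cw_complex \<Rightarrow> ('c option \<Rightarrow>\<^sub>0 int) monoid" where
  "red_chains i X = free_Abelian_group (augmented_cells X i)"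

definition red_boundary ::
    "('a, 'c) cw_complex \<Rightarrow> ('c option \<Rightarrow>\<^sub>0 int) \<Rightarrow> ('c option \<Rightarrow>\<^sub>0 int)" where
  "red_boundary X = frag_extend (augmented_cell_boundary X)"

definition red_homology ::
    "int \<Rightarrow> ('a, 'c) cw_complex \<Rightarrow> ('c option \<Rightarrow>\<^sub>0 int) set monoid" where
  "red_homology i X =
     subgroup_generated (red_chains i X)
       (kernel (red_chains i X) (red_chains (i - 1) X) (red_boundary X))
     Mod (red_boundary X ` carrier (red_chains (i + 1) X))"

text \<open>The rank of a (multiplicatively written) abelian group; it is only used for finitely
  generated groups, where the supremum is a maximum.\<close>

definition int_independent :: "('g, 'm) monoid_scheme \<Rightarrow> 'g set \<Rightarrow> bool" where
  "int_independent G S \<longleftrightarrow> finite S \<and> S \<subseteq> carrier G \<and>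
     (\<forall>a :: 'g \<Rightarrow> int. finprod G (\<lambda>x. x [^]\<^bsub>G\<^esub> a x) S = \<one>\<^bsub>G\<^esub> \<longrightarrow> (\<forall>x\<in>S. a x = 0))"

definition abelian_rank :: "('g, 'm) monoid_scheme \<Rightarrow> nat" where
  "abelian_rank G = Sup (card ` {S. int_independent G S})"

definition red_betti :: "int \<Rightarrow> ('a, 'c) cw_complex \<Rightarrow> nat" where
  "red_betti i X = abelian_rank (red_homology i X)"

definition APC :: "('a, 'c) cw_complex \<Rightarrow> bool" where
  "APC X \<longleftrightarrow> (\<forall>j < cw_dim X. red_betti j X = 0)"

subsection \<open>Cellular spanning trees\<close>

definition spanning_trees :: "int \<Rightarrow> ('a, 'c) cw_complex \<Rightarrow> 'c set set" where
  "spanning_trees k X = {T. subcomplex X T \<and> T \<subseteq> cells_upto X k \<and>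
     cells_upto (cw_restrict X T) (k - 1) = cells_upto X (k - 1) \<and>
     trivial_group (red_homology k (cw_restrict X T)) \<and>
     finite (carrier (red_homology (k - 1) (cw_restrict X T))) \<and>
     int (card (cells_of_dim (cw_restrict X T) k)) =
       int (card (cells_of_dim X k))
         - int (red_betti k (skeleton X k)) + int (red_betti (k - 1) (skeleton X k))}"

definition tree_number :: "int \<Rightarrow> ('a, 'c) cw_complex \<Rightarrow> nat" where
  "tree_number k X =
     (\<Sum>T\<in>spanning_trees k X. (Coset.order (red_homology (k - 1) (cw_restrict X T)))\<^sup>2)"

subsection \<open>Laplacians\<close>

definition laplacian_ud :: "int \<Rightarrow> ('a, 'c) cw_complex \<Rightarrow> 'c \<Rightarrow> 'c \<Rightarrow> int" where
  "laplacian_ud i X \<rho> \<tau> = (\<Sum>\<sigma>\<in>cells_of_dim X (i + 1). incidence X \<rho> \<sigma> * incidence X \<tau> \<sigma>)"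

text \<open>A square matrix with rows and columns indexed by a finite set \<open>A\<close>, as a matrix of the
  library. The same arbitrary enumeration of \<open>A\<close> is used for rows and columns, so determinant
  and characteristic polynomial do not depend on it.\<close>

definition indexed_mat :: "'c set \<Rightarrow> ('c \<Rightarrow> 'c \<Rightarrow> 'e) \<Rightarrow> 'e mat" where
  "indexed_mat A M = (let xs = (SOME xs. distinct xs \<and> set xs = A) in
     Matrix.mat (length xs) (length xs) (\<lambda>(i, j). M (xs ! i) (xs ! j)))"

text \<open>Eigenvalues are counted with algebraic multiplicity.\<close>

definition ud_spectrum :: "int \<Rightarrow> ('a, 'c) cw_complex \<Rightarrow> complex multiset" where
  "ud_spectrum i X =
     proots (char_poly
       (indexed_mat (cells_of_dim X i) (\<lambda>\<rho> \<tau>. complex_of_int (laplacian_ud i X \<rho> \<tau>))))"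

definition pdet_ud :: "int \<Rightarrow> ('a, 'c) cw_complex \<Rightarrow> complex" where
  "pdet_ud k X = prod_mset {#l \<in># ud_spectrum (k - 1) X. l \<noteq> 0#}"

text \<open>The determinant of the up-down Laplacian in dimension \<open>i\<close> with the rows and columns
  indexed by \<open>U\<close> deleted.\<close>

definition det_reduced_laplacian :: "int \<Rightarrow> ('a, 'c) cw_complex \<Rightarrow> 'c set \<Rightarrow> int" where
  "det_reduced_laplacian i X U =
     Determinant.det (indexed_mat (cells_of_dim X i - U) (laplacian_ud i X))"

end

theory Submission
  imports Defs
begin

text \<open>
  Write \<open>A\<close> for the boundary matrix in degree \<open>d\<close>, \<open>B\<close> for the (augmented) boundary matrix one
  degree below, \<open>Z\<close> for the lattice of \<open>(d - 1)\<close>-cycles, that is, the kernel of \<open>B\<close>, and \<open>r\<close> for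
  the rank of \<open>Z\<close>. Since the Betti numbers below \<open>d\<close> vanish, \<open>A\<close> has rank \<open>r\<close>, too, and the
  spanning \<open>d\<close>-trees are the \<open>r\<close>-sets \<open>S\<close> of linearly independent columns of \<open>A\<close>. In the same
  way the spanning \<open>(d - 1)\<close>-trees are the sets \<open>U\<close> of independent columns of \<open>B\<close> whose complement
  \<open>W\<close> has size \<open>r\<close>. All homology groups in question are quotients of lattices of equal rank,
  and their orders are indices.

  The main step compares an \<open>r \<times> r\<close> minor of \<open>A\<close>, with rows in \<open>W\<close> and columns in \<open>S\<close>, with these
  indices (\<open>minor_index\<close>). Its absolute value is the index in \<open>\<int>\<^sup>W\<close> of the lattice that is spanned
  by its columns (\<open>index_lattice\<close>). If \<open>U\<close> is a tree then deleting the coordinates in \<open>U\<close> is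
  injective on \<open>Z\<close>, and the index splits into the index of the boundaries of \<open>S\<close> in \<open>Z\<close>, which
  is the order of the homology of the tree \<open>S\<close> in degree \<open>d - 1\<close>, and the index of the image of \<open>Z\<close> in
  \<open>\<int>\<^sup>W\<close>. Mapping by \<open>B\<close> instead of deleting coordinates identifies the latter with the index of
  \<open>B(\<int>\<^sup>U)\<close> in the image of \<open>B\<close>, which is \<open>|H(X\<^sub>U)| / |H(X)|\<close> in degree \<open>d - 2\<close>. If \<open>S\<close> or \<open>U\<close> is
  not a tree, the minor is zero.

  The formula for the reduced Laplacian is now the Cauchy--Binet formula for the rows of \<open>A\<close> in
  \<open>W\<close> (\<open>Cauchy_Binet_gram\<close>, \<open>det_reduced\<close>). The product of the nonzero eigenvalues is, up to
  sign, the lowest nonvanishing coefficient of the characteristic polynomial of \<open>A A\<^sup>T\<close>, hence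
  the sum of its principal \<open>r\<close>-minors (\<open>prod_nonzero_eigenvalues\<close>). Such a minor is the determinant of
  a reduced Laplacian if the complement \<open>U\<close> of its rows is a tree, and zero otherwise. So summing
  the previous formula over all \<open>U\<close> gives the other claim (\<open>minor_sum_eq\<close>).

  What topology contributes is that the integer matrices read off from singular homology do form
  a complex. For this the classes of the \<open>n\<close>-cells have to be a basis of the homology of the
  \<open>n\<close>-skeleton relative to the skeleton below (\<open>cell_classes_basis\<close>). A characteristic map induces
  an isomorphism from the homology of the disk relative to its boundary (\<open>iso_characteristic_map\<close>);
  the basis property follows from it by adding one cell at a time. Then the squares of the
  boundary maps vanish by exactness, and passing to a subcomplex that contains the lower skeleton
  leaves the matrix entries unchanged by naturality (\<open>incidence_restrict\<close>).
\<close>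

section \<open>Attaching a single cell\<close>

lemma topspace_ndisk:
  "topspace (ndisk n) = {x. (\<forall>i\<ge>n. x i = 0) \<and> (\<Sum>i<n. x i ^ 2) \<le> 1}"
  by (auto simp: ndisk_def topspace_Euclidean_space)

lemma ndisk_eq_top_of_set: "ndisk n = top_of_set (topspace (ndisk n))"
proof -
  have "ndisk n = subtopology (powertop_real UNIV) ({x. \<forall>i\<ge>n. x i = 0} \<inter> {x. (\<Sum>i<n. x i ^ 2) \<le> 1})"
    by (simp add: ndisk_def Euclidean_space_def subtopology_subtopology)
  also have "\<dots> = top_of_set (topspace (ndisk n))"
    by (simp add: topspace_ndisk euclidean_product_topology Collect_conj_eq)
  finally show ?thesis .
qed

lemma continuous_on_sum_squares:
  "continuous_on S (\<lambda>x::nat \<Rightarrow> real. \<Sum>i<n. x i ^ 2)"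
  by (intro continuous_intros continuous_on_product_coordinates[THEN continuous_on_subset]) auto

lemma compact_space_ndisk: "compact_space (ndisk n)"
proof -
  let ?B = "PiE UNIV (\<lambda>i. if i < n then {-1..1} else {0::real})"
  have "compactin (powertop_real UNIV) ?B"
    by (subst compactin_PiE) auto
  then have B: "compact ?B"
    by (simp add: euclidean_product_topology)
  have "closed {x. (\<Sum>i<n. x i ^ 2) \<le> (1::real)}"
    using continuous_on_sum_squares[of UNIV n] by (intro closed_Collect_le) auto
  then have "compact (?B \<inter> {x. (\<Sum>i<n. x i ^ 2) \<le> 1})"
    using B by blast
  moreover have "?B \<inter> {x. (\<Sum>i<n. x i ^ 2) \<le> 1} = topspace (ndisk n)"
  proof -
    have "x i \<in> {-1..1}" if "(\<Sum>i<n. x i ^ 2) \<le> 1" "i < n" for x :: "nat \<Rightarrow> real" and i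
    proof -
      have "x i ^ 2 \<le> (\<Sum>i<n. x i ^ 2)" using that by (intro member_le_sum) auto
      with that have "x i ^ 2 \<le> 1" by linarith
      then show ?thesis by (simp add: abs_square_le_1 abs_le_iff)
    qed
    then show ?thesis
      unfolding topspace_ndisk by (fastforce simp: PiE_iff extensional_def not_less split: if_splits)
  qed
  ultimately have "compact (topspace (ndisk n))" by simp
  then show ?thesis
    by (metis compact_space_subtopology compactin_euclidean_iff ndisk_eq_top_of_set)
qed

lemma Hausdorff_space_ndisk: "Hausdorff_space (ndisk n)"
  by (metis Hausdorff_space_euclidean Hausdorff_space_subtopology ndisk_eq_top_of_set)

lemma ndisk_cases: "topspace (ndisk n) = ndisk_interior n \<union> ndisk_sphere n"
  and ndisk_disjoint: "ndisk_interior n \<inter> ndisk_sphere n = {}"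
  by (auto simp: ndisk_interior_def ndisk_sphere_def topspace_ndisk)

text \<open>Radial expansion of the disk: at time 1 everything outside the ball of radius one half has
  been pushed to the bounding sphere. The maximum keeps the factor continuous at the centre.\<close>

definition radial_push :: "nat \<Rightarrow> real \<Rightarrow> (nat \<Rightarrow> real) \<Rightarrow> nat \<Rightarrow> real" where
  "radial_push n t x = (\<lambda>i. (1 - t + t / max (1/2) (sqrt (\<Sum>i<n. x i ^ 2))) * x i)"

definition outer_disk :: "nat \<Rightarrow> (nat \<Rightarrow> real) set" where
  "outer_disk n = {x \<in> topspace (ndisk n). 1/4 \<le> (\<Sum>i<n. x i ^ 2)}"

lemma sum_squares_radial_push:
  "(\<Sum>i<n. radial_push n t x i ^ 2)
    = ((1 - t + t / max (1/2) (sqrt (\<Sum>i<n. x i ^ 2))) * sqrt (\<Sum>i<n. x i ^ 2)) ^ 2"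
proof -
  have "(\<Sum>i<n. radial_push n t x i ^ 2)
    = (1 - t + t / max (1/2) (sqrt (\<Sum>i<n. x i ^ 2)))^2 * (\<Sum>i<n. x i ^ 2)"
    by (simp add: radial_push_def power_mult_distrib sum_distrib_left)
  then show ?thesis by (simp add: power_mult_distrib sum_nonneg)
qed

lemma radial_push_0: "radial_push n 0 x = x"
  by (simp add: radial_push_def)

lemma radial_push_sphere: "x \<in> ndisk_sphere n \<Longrightarrow> radial_push n t x = x"
  by (simp add: radial_push_def ndisk_sphere_def)

lemma radial_push_in_disk:
  assumes "x \<in> topspace (ndisk n)" "t \<in> {0..1}"
  shows "radial_push n t x \<in> topspace (ndisk n)"
proof -
  define q where "q = sqrt (\<Sum>i<n. x i ^ 2)"
  have q: "0 \<le> q" "q \<le> 1" using assms by (auto simp: q_def topspace_ndisk sum_nonneg)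
  have "q / max (1/2) q \<le> 1" "0 \<le> q / max (1/2) q" using q by (auto simp: divide_simps max_def)
  then have "(1 - t) * q + t * (q / max (1/2) q) \<le> (1 - t) * 1 + t * 1"
    using assms q by (intro add_mono mult_left_mono) auto
  moreover have "0 \<le> (1 - t) * q + t * (q / max (1/2) q)"
    using assms q by (intro add_nonneg_nonneg mult_nonneg_nonneg) auto
  ultimately have "((1 - t + t / max (1/2) q) * q) ^ 2 \<le> 1"
    by (subst abs_square_le_1) (simp add: algebra_simps abs_le_iff)
  with assms show ?thesis
    unfolding topspace_ndisk by (simp add: sum_squares_radial_push q_def[symmetric]) (simp add: radial_push_def)
qed

lemma radial_push_outer:
  assumes "x \<in> outer_disk n" "t \<in> {0..1}"
  shows "radial_push n t x \<in> outer_disk n" and "radial_push n 1 x \<in> ndisk_sphere n"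
proof -
  define q where "q = sqrt (\<Sum>i<n. x i ^ 2)"
  have q4: "sqrt (1/4) \<le> q" unfolding q_def using assms(1) by (intro real_sqrt_le_mono) (simp add: outer_disk_def)
  have "sqrt (1/4) = (1/2::real)" by (simp add: real_sqrt_divide)
  with q4 have q: "1/2 \<le> q" by simp
  have "q \<le> 1" using assms by (auto simp: q_def topspace_ndisk outer_disk_def sum_nonneg)
  have x: "x \<in> topspace (ndisk n)" using assms by (simp add: outer_disk_def)
  have "(1 - t) * (1/2) \<le> (1 - t) * q"
    using q assms(2) by (intro mult_left_mono) auto
  then have "1/2 \<le> (1 - t) * q + t"
    using assms(2) by (simp add: field_simps)
  also have "\<dots> = (1 - t + t / max (1/2) q) * q"
    using q by (simp add: max_def field_simps)
  finally have "(1/2)^2 \<le> ((1 - t + t / max (1/2) q) * q) ^ 2"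
    by (intro power_mono) auto
  then have "1/4 \<le> (\<Sum>i<n. radial_push n t x i ^ 2)"
    unfolding sum_squares_radial_push by (simp add: q_def power2_eq_square)
  then show "radial_push n t x \<in> outer_disk n"
    using radial_push_in_disk[OF x assms(2)] by (simp add: outer_disk_def)
  show "radial_push n 1 x \<in> ndisk_sphere n"
    using radial_push_in_disk[OF x, of 1] q 
    by (simp add: ndisk_sphere_def sum_squares_radial_push q_def[symmetric] max_def)
qed

lemma continuous_map_radial_push:
  "continuous_map (prod_topology (top_of_set {0..1}) (ndisk n)) (ndisk n) (\<lambda>(t, x). radial_push n t x)"
proof -
  let ?D = "topspace (ndisk n)"
  have c1: "continuous_on ({0..1} \<times> ?D) (\<lambda>p::real \<times> (nat \<Rightarrow> real). snd p i)" for i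
    by (rule continuous_on_product_then_coordinatewise) (intro continuous_intros)
  have c2: "continuous_on ({0..1} \<times> ?D) (\<lambda>p::real \<times> (nat \<Rightarrow> real). \<Sum>i<n. snd p i ^ 2)"
    by (intro continuous_intros c1)
  have "continuous_on ({0..1} \<times> ?D) (\<lambda>p::real \<times> (nat \<Rightarrow> real). \<lambda>i. radial_push n (fst p) (snd p) i)"
    unfolding radial_push_def
    by (intro continuous_on_coordinatewise_then_product continuous_intros c1 c2) auto
  then have "continuous_on ({0..1} \<times> ?D) (\<lambda>(t, x). radial_push n t x)"
    by (simp add: case_prod_unfold)
  then have "continuous_map (top_of_set ({0..1} \<times> ?D)) (top_of_set ?D) (\<lambda>(t, x). radial_push n t x)"
    using radial_push_in_disk by (auto simp: continuous_map_in_subtopology)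
  moreover have "top_of_set ({0..1::real} \<times> ?D) = prod_topology (top_of_set {0..1}) (ndisk n)"
    by (subst ndisk_eq_top_of_set) (simp add: subtopology_Times)
  ultimately show ?thesis using ndisk_eq_top_of_set[of n] by metis
qed

lemma iso_of_comp_iso:
  assumes "g \<circ> f \<in> iso G K"
  shows "f \<in> iso G H \<Longrightarrow> g \<in> hom H K \<Longrightarrow> g \<in> iso H K"
    and "g \<in> iso H K \<Longrightarrow> f \<in> hom G H \<Longrightarrow> f \<in> iso G H"
proof -
  have gf: "bij_betw (g \<circ> f) (carrier G) (carrier K)" using assms by (simp add: iso_def)
  show "g \<in> iso H K" if "f \<in> iso G H" "g \<in> hom H K"
    using that gf bij_betw_comp_iff[of f "carrier G" "carrier H" g "carrier K"] by (simp add: iso_def)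
  show "f \<in> iso G H" if g: "g \<in> iso H K" and f: "f \<in> hom G H"
  proof -
    have "f ` carrier G \<subseteq> carrier H" using f by (auto simp: hom_def)
    then show ?thesis
      using g f gf bij_betw_comp_iff2[of g "carrier H" "carrier K" f "carrier G"] by (simp add: iso_def)
  qed
qed

text \<open>A Hausdorff space \<open>X\<close> that arises from a closed subset \<open>Y\<close> by attaching one \<open>n\<close>-cell. The disk
  itself, attached to its boundary sphere, is an instance; comparing it with \<open>X\<close> is how the
  homology of \<open>X\<close> relative to \<open>Y\<close> is computed.\<close>

locale cell_attachment =
  fixes X :: "'a topology" and Y :: "'a set" and n :: nat and \<phi> :: "(nat \<Rightarrow> real) \<Rightarrow> 'a"
  assumes Hausdorff: "Hausdorff_space X"
    and closed_base: "closedin X Y"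
    and continuous_char: "continuous_map (ndisk n) X \<phi>"
    and embedding_char: "embedding_map (subtopology (ndisk n) (ndisk_interior n)) X \<phi>"
    and sphere_to_base: "\<phi> ` ndisk_sphere n \<subseteq> Y"
    and interior_onto: "\<phi> ` ndisk_interior n = topspace X - Y"
begin

lemma inj_interior: "inj_on \<phi> (ndisk_interior n)"
proof -
  have "topspace (subtopology (ndisk n) (ndisk_interior n)) = ndisk_interior n"
    by (auto simp: ndisk_interior_def)
  then show ?thesis
    using embedding_char homeomorphic_imp_injective_map unfolding embedding_map_def by fastforce
qed

text \<open>The expansion of the disk, transported to \<open>X\<close> and constant on \<open>Y\<close>.\<close>

definition push :: "real \<Rightarrow> 'a \<Rightarrow> 'a" where
  "push t y = (if y \<in> Y then y else \<phi> (radial_push n t (inv_into (ndisk_interior n) \<phi> y)))"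

definition collar :: "'a set" where
  "collar = Y \<union> \<phi> ` outer_disk n"

lemma push_char: "x \<in> topspace (ndisk n) \<Longrightarrow> push t (\<phi> x) = \<phi> (radial_push n t x)"
  using inj_interior sphere_to_base interior_onto
  by (cases "x \<in> ndisk_sphere n")
     (auto simp: push_def radial_push_sphere ndisk_cases inv_into_f_f dest!: imageI[of x _ \<phi>])

lemma push_base: "y \<in> Y \<Longrightarrow> push t y = y"
  by (simp add: push_def)

lemma topspace_cases: "topspace X = Y \<union> \<phi> ` topspace (ndisk n)"
  using closedin_subset[OF closed_base] sphere_to_base interior_onto
  by (auto simp: ndisk_cases)

lemma continuous_map_push:
  "continuous_map (prod_topology (top_of_set {0..1}) X) X (\<lambda>(t, y). push t y)"
proof -
  let ?I = "top_of_set {0..1::real}"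
  let ?P = "prod_topology ?I X"
  let ?K = "\<phi> ` topspace (ndisk n)"
  let ?\<psi> = "\<lambda>(t::real, x). (t, \<phi> x)"
  have K: "closedin X ?K"
    using compactin_imp_closedin[OF Hausdorff] image_compactin[OF _ continuous_char] compact_space_ndisk
    by (simp add: compact_space_def)
  have cI: "closedin ?P ({0..1} \<times> Y)" "closedin ?P ({0..1} \<times> ?K)"
    using closed_base K by (auto simp: closedin_prod_Times_iff)
  \<comment> \<open>A continuous surjection from a compact space to a Hausdorff space is a quotient map;
    this is what allows continuity to be checked upstairs on the disk.\<close>
  have \<psi>: "quotient_map (prod_topology ?I (ndisk n)) (prod_topology ?I (subtopology X ?K)) ?\<psi>"
  proof (rule continuous_imp_quotient_map)
    show "continuous_map (prod_topology ?I (ndisk n)) (prod_topology ?I (subtopology X ?K)) ?\<psi>"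
    proof -
      have "continuous_map (ndisk n) (subtopology X ?K) \<phi>"
        using continuous_char by (auto simp: continuous_map_in_subtopology)
      from continuous_map_prod_top[of ?I "ndisk n" ?I "subtopology X ?K" id \<phi>] this
      show ?thesis by simp
    qed
    show "compact_space (prod_topology ?I (ndisk n))"
      by (simp add: compact_space_prod_topology compact_space_ndisk compact_space_subtopology)
    show "Hausdorff_space (prod_topology ?I (subtopology X ?K))"
      by (simp add: Hausdorff_space_prod_topology Hausdorff_space_subtopology Hausdorff)
    show "?\<psi> ` topspace (prod_topology ?I (ndisk n)) = topspace (prod_topology ?I (subtopology X ?K))"
      using closedin_subset[OF K] by (force simp: image_iff)
  qed
  have "continuous_map (prod_topology ?I (ndisk n)) X ((\<lambda>(t, y). push t y) \<circ> ?\<psi>)"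
  proof (rule continuous_map_eq)
    show "continuous_map (prod_topology ?I (ndisk n)) X (\<phi> \<circ> (\<lambda>(t, x). radial_push n t x))"
      using continuous_map_radial_push continuous_char continuous_map_compose by blast
  qed (auto simp: push_char)
  then have "continuous_map (prod_topology ?I (subtopology X ?K)) X (\<lambda>(t, y). push t y)"
    by (rule continuous_compose_quotient_map[OF \<psi>])
  moreover have "prod_topology ?I (subtopology X ?K) = subtopology ?P ({0..1} \<times> ?K)"
    using subtopology_Times[of ?I X "{0..1}" ?K] by (simp add: subtopology_subtopology)
  ultimately have contK: "continuous_map (subtopology ?P ({0..1} \<times> ?K)) X (\<lambda>(t, y). push t y)"
    by simp
  have contY: "continuous_map (subtopology ?P ({0..1} \<times> Y)) X (\<lambda>(t, y). push t y)"
  proof (rule continuous_map_eq)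
    show "continuous_map (subtopology ?P ({0..1} \<times> Y)) X snd"
      by (simp add: continuous_map_from_subtopology continuous_map_snd)
  qed (auto simp: push_base)
  show ?thesis
  proof (rule pasting_lemma_closed[where I = "{True, False}" 
        and T = "\<lambda>b. if b then {0..1} \<times> Y else {0..1} \<times> ?K" and f = "\<lambda>b (t, y). push t y"])
    show "\<exists>j. j \<in> {True, False} \<and> x \<in> (if j then {0..1} \<times> Y else {0..1} \<times> ?K) \<and>
             (case x of (t, y) \<Rightarrow> push t y) = (case x of (t, y) \<Rightarrow> push t y)"
      if "x \<in> topspace ?P" for x
      using that topspace_cases by (auto intro: exI[of _ True] exI[of _ False])
  qed (use cI contK contY in auto)
qed

lemma homotopic_push:
  assumes "\<And>t. t \<in> {0..1} \<Longrightarrow> P (push t)"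
  assumes PQ: "\<And>f g. (\<And>x. x \<in> topspace X \<Longrightarrow> f x = g x) \<Longrightarrow> P f = P g"
  shows "homotopic_with P X X (push 1) id"
proof -
  have p0: "push 0 y = y" if "y \<in> topspace X" for y
  proof (cases "y \<in> Y")
    case False
    with that topspace_cases obtain x where "x \<in> topspace (ndisk n)" "y = \<phi> x" by blast
    then show ?thesis using push_char radial_push_0 by simp
  qed (simp add: push_base)
  have "homotopic_with P X X (push 0) (push 1)"
    unfolding homotopic_with_def
    by (rule exI[of _ "\<lambda>(t, y). push t y"]) (use continuous_map_push assms(1) in simp)
  moreover have "homotopic_with P X X (push 0) id"
  proof (rule homotopic_with_equal)
    show "continuous_map X X (push 0)"
      by (rule continuous_map_eq[OF continuous_map_id]) (simp add: p0)
    show "P (push 0)" using assms(1) by simp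
    then show "P id" using PQ[of "push 0" id] p0 by simp
  qed (simp add: p0)
  ultimately show ?thesis
    by (meson homotopic_with_sym homotopic_with_trans)
qed

lemma outer_disk_subset: "outer_disk n \<subseteq> topspace (ndisk n)"
  by (auto simp: outer_disk_def)

lemma push_collar:
  assumes "y \<in> collar"
  shows "t \<in> {0..1} \<Longrightarrow> push t y \<in> collar" and "push 1 y \<in> Y"
proof -
  have "(t \<in> {0..1} \<longrightarrow> push t y \<in> collar) \<and> push 1 y \<in> Y"
  proof (cases "y \<in> Y")
    case True
    then show ?thesis by (simp add: push_base collar_def)
  next
    case False
    then obtain x where x: "x \<in> outer_disk n" "y = \<phi> x" using assms by (auto simp: collar_def)
    then have "push s y = \<phi> (radial_push n s x)" for s
      using push_char outer_disk_subset by blast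
    then show ?thesis
      using x radial_push_outer(1)[of x n t] radial_push_outer(2)[of x n 1] sphere_to_base
      by (auto simp: collar_def)
  qed
  then show "t \<in> {0..1} \<Longrightarrow> push t y \<in> collar" and "push 1 y \<in> Y" by auto
qed

text \<open>The expansion moves neither \<open>Y\<close> nor the collar out of itself and ends with the collar inside
  \<open>Y\<close>; so its final stage is a homotopy inverse of the identity as a map of pairs.\<close>

lemma iso_enlarge_base_to_collar:
  "hom_induced p X Y X collar id
     \<in> iso (relative_homology_group p X Y) (relative_homology_group p X collar)"
proof -
  have Yc: "Y \<subseteq> collar" by (auto simp: collar_def)
  have YX: "Y \<subseteq> topspace X" and cX: "collar \<subseteq> topspace X"
    using topspace_cases outer_disk_subset by (auto simp: collar_def)
  have c1: "continuous_map X X (push 1)"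
    using homotopic_with_imp_continuous_maps[OF homotopic_push[of "\<lambda>_. True"]] by auto
  have hY: "homotopic_with (\<lambda>h. h \<in> Y \<rightarrow> Y) X X (push 1) id"
    by (rule homotopic_push) (use YX in \<open>auto simp: push_base Pi_iff subset_iff\<close>)
  have hc: "homotopic_with (\<lambda>h. h \<in> collar \<rightarrow> collar) X X (push 1) id"
    by (rule homotopic_push) (use cX in \<open>auto simp: push_collar Pi_iff subset_iff\<close>)
  have "group_isomorphisms (relative_homology_group p X Y) (relative_homology_group p X collar)
          (hom_induced p X Y X collar id) (hom_induced p X collar X Y (push 1))"
    by (rule homotopy_equivalence_relative_homology_group_isomorphisms)
       (use Yc c1 hY hc push_collar(2) in auto)
  then show ?thesis by (rule group_isomorphisms_imp_iso)
qed

text \<open>Excision of \<open>Y\<close>: a neighbourhood of \<open>Y\<close> lies in the collar because the closed ball of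
  radius one half has a compact, hence closed, image.\<close>

lemma iso_excise_base:
  "hom_induced p (subtopology X (topspace X - Y)) (collar - Y) X collar id
     \<in> iso (relative_homology_group p (subtopology X (topspace X - Y)) (collar - Y))
           (relative_homology_group p X collar)"
proof -
  let ?H = "{x \<in> topspace (ndisk n). (\<Sum>i<n. x i ^ 2) \<le> 1/4}"
  have "closedin (ndisk n) ?H"
  proof -
    have "continuous_map (ndisk n) euclideanreal (\<lambda>x. \<Sum>i<n. x i ^ 2)"
      using continuous_on_sum_squares by (subst ndisk_eq_top_of_set) (simp add: continuous_map_iff_continuous)
    then have "closedin (ndisk n) {x \<in> topspace (ndisk n). (\<Sum>i<n. x i ^ 2) \<in> {..1/4}}"
      by (rule closedin_continuous_map_preimage) simp
    then show ?thesis by simp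
  qed
  then have "compactin (ndisk n) ?H" by (simp add: closedin_compact_space compact_space_ndisk)
  then have clo: "closedin X (\<phi> ` ?H)"
    using compactin_imp_closedin[OF Hausdorff] image_compactin[OF _ continuous_char] by blast
  have "Y \<subseteq> topspace X - \<phi> ` ?H"
  proof -
    have "?H \<subseteq> ndisk_interior n" by (auto simp: ndisk_interior_def)
    then show ?thesis using interior_onto closedin_subset[OF closed_base] by blast
  qed
  moreover have "topspace X - \<phi> ` ?H \<subseteq> collar"
  proof
    fix y assume y: "y \<in> topspace X - \<phi> ` ?H"
    show "y \<in> collar"
    proof (cases "y \<in> Y")
      case False
      then obtain x where x: "x \<in> topspace (ndisk n)" "y = \<phi> x" using y topspace_cases by blast
      then have "x \<notin> ?H" using y by blast
      then show ?thesis using x by (auto simp: collar_def outer_disk_def)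
    qed (simp add: collar_def)
  qed
  ultimately have "X closure_of Y \<subseteq> X interior_of collar"
    using interior_of_maximal[of "topspace X - \<phi> ` ?H" collar X] openin_diff[OF openin_topspace clo]
      closure_of_closedin[OF closed_base] by auto
  moreover have "collar \<subseteq> topspace X"
    using topspace_cases outer_disk_subset by (auto simp: collar_def)
  ultimately show ?thesis
    using homology_excision_axiom[of X Y collar "topspace X" p] by simp
qed

end

lemma cell_attachment_ndisk: "cell_attachment (ndisk n) (ndisk_sphere n) n id"
proof
  show "closedin (ndisk n) (ndisk_sphere n)"
  proof -
    have "continuous_map (ndisk n) euclideanreal (\<lambda>x. \<Sum>i<n. x i ^ 2)"
      using continuous_on_sum_squares by (subst ndisk_eq_top_of_set) (simp add: continuous_map_iff_continuous)
    then have "closedin (ndisk n) {x \<in> topspace (ndisk n). (\<Sum>i<n. x i ^ 2) \<in> {1}}"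
      by (rule closedin_continuous_map_preimage) simp
    then show ?thesis by (simp add: ndisk_sphere_def)
  qed
  show "embedding_map (subtopology (ndisk n) (ndisk_interior n)) (ndisk n) id"
    by (auto simp: embedding_map_def ndisk_interior_def Int_def cong: conj_cong)
qed (use ndisk_cases ndisk_disjoint in \<open>auto simp: Hausdorff_space_ndisk\<close>)

context cell_attachment
begin

text \<open>On both sides, for the disk and for \<open>X\<close>, enlarging the base to a collar and then excising the
  base are isomorphisms. After the excision the characteristic map is a homeomorphism of pairs.\<close>

theorem iso_characteristic_map:
  "hom_induced p (ndisk n) (ndisk_sphere n) X Y \<phi>
     \<in> iso (relative_homology_group p (ndisk n) (ndisk_sphere n)) (relative_homology_group p X Y)"
proof -
  interpret D: cell_attachment "ndisk n" "ndisk_sphere n" n id by (rule cell_attachment_ndisk)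
  let ?D = "ndisk n" and ?S = "ndisk_sphere n" and ?N = D.collar
  let ?Do = "subtopology ?D (topspace ?D - ?S)" and ?Xo = "subtopology X (topspace X - Y)"
  have int: "topspace ?D - ?S = ndisk_interior n" using ndisk_cases ndisk_disjoint by blast
  have SO: "?S \<subseteq> outer_disk n" by (auto simp: outer_disk_def ndisk_sphere_def)
  then have N: "?N = outer_disk n" by (auto simp: D.collar_def)
  have SD: "?S \<subseteq> ?N" using SO N by simp
  have coll: "\<phi> ` ?N \<subseteq> collar" by (auto simp: N collar_def)
  have Xo: "?Xo = subtopology X (\<phi> ` topspace ?Do)"
  proof -
    have "topspace ?Do = ndisk_interior n" using int by (auto simp: ndisk_interior_def)
    then show ?thesis by (simp add: interior_onto)
  qed
  have colldiff: "\<phi> ` (?N - ?S) = collar - Y"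
  proof -
    have "\<phi> ` (?N - ?S) \<subseteq> topspace X - Y"
      using interior_onto int outer_disk_subset unfolding N by blast
    moreover have "collar - Y \<subseteq> \<phi> ` (?N - ?S)"
      using sphere_to_base unfolding collar_def N by blast
    ultimately show ?thesis using coll by blast
  qed
  have homeo: "homeomorphic_map ?Do ?Xo \<phi>"
    using embedding_char by (simp add: embedding_map_def int Xo)
  have 1: "hom_induced p ?Do (?N - ?S) ?Xo (collar - Y) \<phi>
      \<in> iso (relative_homology_group p ?Do (?N - ?S)) (relative_homology_group p ?Xo (collar - Y))"
    by (rule homeomorphic_map_relative_homology_iso[OF homeo]) (use colldiff N in \<open>auto simp: outer_disk_def\<close>)
  let ?a = "hom_induced p ?Do (?N - ?S) ?D ?N id"
  let ?b = "hom_induced p ?Xo (collar - Y) X collar id"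
  let ?c = "hom_induced p ?D ?S ?D ?N id"
  let ?d = "hom_induced p X Y X collar id"
  let ?m = "hom_induced p ?D ?N X collar \<phi>"
  have cXo: "continuous_map ?Do ?Xo \<phi>" using homeo homeomorphic_imp_continuous_map by blast
  have e1: "?m \<circ> ?a = ?b \<circ> hom_induced p ?Do (?N - ?S) ?Xo (collar - Y) \<phi>"
    using coll colldiff continuous_char cXo
    by (simp add: hom_induced_compose[symmetric] Pi_iff image_subset_iff continuous_map_from_subtopology)
       (subst hom_induced_compose[symmetric]; auto)+
  have isom: "?m \<in> iso (relative_homology_group p ?D ?N) (relative_homology_group p X collar)"
  proof -
    have "?m \<circ> ?a \<in> iso (relative_homology_group p ?Do (?N - ?S)) (relative_homology_group p X collar)"
      unfolding e1 using 1 iso_excise_base iso_set_trans by blast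
    then show ?thesis
      by (rule iso_of_comp_iso(1)) (use D.iso_excise_base[of p] hom_induced_hom in auto)
  qed
  have e2: "?d \<circ> hom_induced p ?D ?S X Y \<phi> = ?m \<circ> ?c"
    using continuous_char coll sphere_to_base SD
    by (subst (1 2) hom_induced_compose[symmetric]) (auto simp: collar_def)
  have "?d \<circ> hom_induced p ?D ?S X Y \<phi> \<in> iso (relative_homology_group p ?D ?S) (relative_homology_group p X collar)"
    unfolding e2 using isom D.iso_enlarge_base_to_collar iso_set_trans by blast
  then show ?thesis
    by (rule iso_of_comp_iso(2)) (use iso_enlarge_base_to_collar hom_induced_hom in auto)
qed

end

section \<open>The fundamental class of a disk\<close>

lemma contractible_space_ndisk: "contractible_space (ndisk n)"
proof -
  let ?D = "topspace (ndisk n)"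
  have "(\<lambda>i. t * x i) \<in> ?D" if "x \<in> ?D" "t \<in> {0..1}" for x t
  proof -
    have "(\<Sum>i<n. (t * x i)^2) = t^2 * (\<Sum>i<n. x i ^ 2)"
      by (simp add: power_mult_distrib sum_distrib_left)
    also have "\<dots> \<le> 1 * 1" using that
      by (intro mult_mono) (auto simp: topspace_ndisk abs_square_le_1 sum_nonneg)
    finally show ?thesis using that by (simp add: topspace_ndisk)
  qed
  moreover have "continuous_on ({0..1} \<times> ?D) (\<lambda>p::real \<times> (nat \<Rightarrow> real). \<lambda>i. (1 - fst p) * snd p i)"
  proof -
    have c: "continuous_on ({0..1} \<times> ?D) (\<lambda>p::real \<times> (nat \<Rightarrow> real). snd p i)" for i
      by (rule continuous_on_product_then_coordinatewise) (intro continuous_intros)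
    show ?thesis by (intro continuous_on_coordinatewise_then_product continuous_intros c)
  qed
  ultimately have "continuous_map (top_of_set ({0..1} \<times> ?D)) (top_of_set ?D) (\<lambda>(t, x) i. (1 - t) * x i)"
    by (auto simp: continuous_map_in_subtopology case_prod_unfold)
  then have "homotopic_with (\<lambda>x. True) (top_of_set ?D) (top_of_set ?D) id (\<lambda>x i. 0)"
    unfolding homotopic_with_def by (intro exI[of _ "\<lambda>(t, x) i. (1 - t) * x i"]) auto
  then show ?thesis
    unfolding contractible_space_def ndisk_eq_top_of_set[symmetric] by blast
qed

text \<open>The disk is contractible, so the connecting homomorphism is an isomorphism onto the reduced
  homology of the bounding sphere. In dimension 0 the sphere is empty and this argument is not
  available, but the disk is a point.\<close>

lemma disk_homology_integer:
  "relative_homology_group (int n) (ndisk n) (ndisk_sphere n) \<cong> integer_group"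
proof (cases n)
  case 0
  have "ndisk_sphere 0 = {}" by (auto simp: ndisk_sphere_def)
  moreover have "topspace (ndisk 0) = {\<lambda>i. 0}" by (auto simp: topspace_ndisk)
  ultimately show ?thesis using 0 homology_coefficients by simp
next
  case (Suc m)
  have sph: "subtopology (ndisk (Suc m)) (ndisk_sphere (Suc m)) = nsphere m"
  proof -
    have "{x. (\<Sum>i<Suc m. x i ^ 2) \<le> 1} \<inter> ndisk_sphere (Suc m)
        = topspace (Euclidean_space (Suc m)) \<inter> {x. (\<Sum>i\<le>m. x i ^ 2) = (1::real)}"
      by (auto simp: ndisk_sphere_def ndisk_def lessThan_Suc_atMost)
    then show ?thesis
      unfolding nsphere_def ndisk_def subtopology_subtopology 
      by (metis subtopology_restrict)
  qed
  have "topspace (nsphere m) \<noteq> {}"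
    using in_topspace_nsphere by blast
  then have ne: "topspace (ndisk (Suc m)) \<inter> ndisk_sphere (Suc m) \<noteq> {}"
    unfolding sph[symmetric] by simp
  have "relative_homology_group (int n) (ndisk n) (ndisk_sphere n) \<cong> reduced_homology_group (int m) (nsphere m)"
    using isomorphic_group_relative_homology_of_contractible[OF contractible_space_ndisk ne, of "int (Suc m)"]
    by (simp add: Suc sph)
  then show ?thesis using reduced_homology_group_nsphere(1) iso_trans by blast
qed

lemma disk_class:
  fixes n
  defines "G \<equiv> relative_homology_group (int n) (ndisk n) (ndisk_sphere n)"
  shows disk_class_in_carrier: "disk_class n \<in> carrier G"
    and disk_class_generates: "carrier G = range (\<lambda>m::int. disk_class n [^]\<^bsub>G\<^esub> m)"
    and disk_class_infinite_order: "disk_class n [^]\<^bsub>G\<^esub> (m::int) = \<one>\<^bsub>G\<^esub> \<Longrightarrow> m = 0"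
proof -
  interpret G: group G by (simp add: G_def)
  have "cyclic_group G"
    using isomorphic_group_cyclicity[of G integer_group] disk_homology_integer by (simp add: G_def)
  then have "\<exists>g. g \<in> carrier G \<and> subgroup_generated G {g} = G"
    by (auto simp: cyclic_group_def)
  from someI_ex[OF this] have g: "disk_class n \<in> carrier G" "subgroup_generated G {disk_class n} = G"
    by (simp_all add: disk_class_def G_def Let_def)
  show "disk_class n \<in> carrier G" by (fact g)
  show range: "carrier G = range (\<lambda>m::int. disk_class n [^]\<^bsub>G\<^esub> m)"
    using G.carrier_subgroup_generated_by_singleton[OF g(1)] g(2) by simp
  show "m = 0" if "disk_class n [^]\<^bsub>G\<^esub> m = \<one>\<^bsub>G\<^esub>"
  proof (rule ccontr)
    assume m: "m \<noteq> 0"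
    \<comment> \<open>If the generator had finite order, the group would consist of finitely many powers.\<close>
    have "infinite (carrier G)"
    proof -
      obtain h where "h \<in> iso G integer_group" using disk_homology_integer by (auto simp: G_def is_iso_def)
      then have "bij_betw h (carrier G) (UNIV :: int set)" by (simp add: iso_def)
      then show ?thesis using bij_betw_finite infinite_UNIV_int by blast
    qed
    moreover have "carrier G \<subseteq> (\<lambda>m::int. disk_class n [^]\<^bsub>G\<^esub> m) ` {0..<\<bar>m\<bar>}"
    proof
      fix x assume "x \<in> carrier G"
      then obtain k :: int where k: "x = disk_class n [^]\<^bsub>G\<^esub> k" using range by auto
      have am: "disk_class n [^]\<^bsub>G\<^esub> \<bar>m\<bar> = \<one>\<^bsub>G\<^esub>"
        using that g(1) by (cases "m \<ge> 0") (simp_all add: G.int_pow_neg)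
      have "x = disk_class n [^]\<^bsub>G\<^esub> (\<bar>m\<bar> * (k div \<bar>m\<bar>) + k mod \<bar>m\<bar>)" using k by simp
      also have "\<dots> = (disk_class n [^]\<^bsub>G\<^esub> \<bar>m\<bar>) [^]\<^bsub>G\<^esub> (k div \<bar>m\<bar>) \<otimes>\<^bsub>G\<^esub> disk_class n [^]\<^bsub>G\<^esub> (k mod \<bar>m\<bar>)"
        using g(1) by (simp add: G.int_pow_pow flip: G.int_pow_mult)
      also have "\<dots> = disk_class n [^]\<^bsub>G\<^esub> (k mod \<bar>m\<bar>)"
        using am g(1) by simp
      finally show "x \<in> (\<lambda>m::int. disk_class n [^]\<^bsub>G\<^esub> m) ` {0..<\<bar>m\<bar>}"
        using m by auto
    qed
    ultimately show False using finite_subset by blast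
  qed
qed

lemma hom_finprod_int_pow:
  assumes G: "comm_group G" and H: "comm_group H" and h: "h \<in> hom G H"
    and C: "finite C" and c: "c \<in> C \<rightarrow> carrier G"
  shows "h (finprod G (\<lambda>\<tau>. c \<tau> [^]\<^bsub>G\<^esub> (m \<tau> :: int)) C) = finprod H (\<lambda>\<tau>. h (c \<tau>) [^]\<^bsub>H\<^esub> m \<tau>) C"
proof -
  interpret G: comm_group G by fact
  interpret H: comm_group H by fact
  interpret h: group_hom G H h by unfold_locales fact
  show ?thesis using C c
  proof (induction C rule: finite_induct)
    case (insert x F)
    then have F: "(\<lambda>\<tau>. c \<tau> [^]\<^bsub>G\<^esub> m \<tau>) \<in> F \<rightarrow> carrier G" 
      "(\<lambda>\<tau>. h (c \<tau>) [^]\<^bsub>H\<^esub> m \<tau>) \<in> F \<rightarrow> carrier H" "c x \<in> carrier G"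
      by (auto simp: Pi_iff)
    then show ?case using insert by (simp add: h.hom_int_pow)
  qed simp
qed


section \<open>The cellular basis\<close>

definition cell_union :: "('a, 'c) cw_complex \<Rightarrow> 'c set \<Rightarrow> 'a set" where
  "cell_union X S = (\<Union>\<sigma>\<in>S. open_cell X \<sigma>)"

lemma skel_space_eq: "skel_space X i = subtopology (cw_space X) (cell_union X (cells_upto X i))"
  by (simp add: skel_space_def skeleton_def cw_restrict_def cell_union_def)

lemma cell_union_mono: "S \<subseteq> T \<Longrightarrow> cell_union X S \<subseteq> cell_union X T"
  by (auto simp: cell_union_def)

locale finite_cw =
  fixes X :: "('a, 'c) cw_complex"
  assumes finite_cw: "finite_cw_complex X"
begin

lemma Hausdorff_space_cw: "Hausdorff_space (cw_space X)"
  and finite_cells: "finite (cw_cells X)"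
  and continuous_map_cw_char:
    "\<sigma> \<in> cw_cells X \<Longrightarrow> continuous_map (ndisk (cw_celldim X \<sigma>)) (cw_space X) (cw_char X \<sigma>)"
  and embedding_map_cw_char:
    "\<sigma> \<in> cw_cells X \<Longrightarrow> embedding_map
        (subtopology (ndisk (cw_celldim X \<sigma>)) (ndisk_interior (cw_celldim X \<sigma>)))
        (cw_space X) (cw_char X \<sigma>)"
  and topspace_cw: "topspace (cw_space X) = cell_union X (cw_cells X)"
  and disjoint_open_cells: "disjoint_family_on (open_cell X) (cw_cells X)"
  and cw_char_sphere: "\<sigma> \<in> cw_cells X \<Longrightarrow> cw_char X \<sigma> ` ndisk_sphere (cw_celldim X \<sigma>)
        \<subseteq> cell_union X {\<tau> \<in> cw_cells X. cw_celldim X \<tau> < cw_celldim X \<sigma>}"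
  using finite_cw by (auto simp: finite_cw_complex_def cell_union_def)

lemma finite_cells_of_dim: "finite (cells_of_dim X i)"
  using finite_cells by (simp add: cells_of_dim_def)

lemma cells_upto_subset: "cells_upto X i \<subseteq> cw_cells X"
  and cells_of_dim_subset: "cells_of_dim X i \<subseteq> cw_cells X"
  by (auto simp: cells_upto_def cells_of_dim_def)

lemma cells_upto_Un: "cells_upto X i = cells_upto X (i - 1) \<union> cells_of_dim X i"
  by (auto simp: cells_upto_def cells_of_dim_def)

lemma cell_union_subset: "S \<subseteq> cw_cells X \<Longrightarrow> cell_union X S \<subseteq> topspace (cw_space X)"
  unfolding topspace_cw by (rule cell_union_mono)

lemma topspace_skel: "topspace (skel_space X i) = cell_union X (cells_upto X i)"
  unfolding skel_space_eq using cell_union_subset[OF cells_upto_subset] by auto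

lemma cell_union_Diff:
  assumes "S \<subseteq> cw_cells X" "T \<subseteq> cw_cells X"
  shows "cell_union X S - cell_union X T = cell_union X (S - T)"
proof
  show "cell_union X S - cell_union X T \<subseteq> cell_union X (S - T)" by (auto simp: cell_union_def)
  show "cell_union X (S - T) \<subseteq> cell_union X S - cell_union X T"
    using disjoint_open_cells assms by (fastforce simp: cell_union_def disjoint_family_on_def)
qed

lemma closed_cell_eq:
  "closed_cell X \<sigma> = open_cell X \<sigma> \<union> cw_char X \<sigma> ` ndisk_sphere (cw_celldim X \<sigma>)"
  by (auto simp: closed_cell_def open_cell_def ndisk_cases)

lemma closedin_closed_cell: "\<sigma> \<in> cw_cells X \<Longrightarrow> closedin (cw_space X) (closed_cell X \<sigma>)"
  unfolding closed_cell_def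
  using compactin_imp_closedin[OF Hausdorff_space_cw] image_compactin continuous_map_cw_char compact_space_ndisk
  by (metis compact_space_def)

lemma sphere_in_skeleton:
  assumes "\<sigma> \<in> cells_of_dim X i" "cells_upto X (i - 1) \<subseteq> S"
  shows "cw_char X \<sigma> ` ndisk_sphere (cw_celldim X \<sigma>) \<subseteq> cell_union X S"
proof -
  have "{\<tau> \<in> cw_cells X. cw_celldim X \<tau> < cw_celldim X \<sigma>} \<subseteq> cells_upto X (i - 1)"
    using assms by (auto simp: cells_upto_def cells_of_dim_def)
  then show ?thesis
    using cw_char_sphere[of \<sigma>] assms(1) cell_union_mono[OF order_trans[OF _ assms(2)], of _ X] cells_of_dim_subset
    by (meson order_trans subsetD)
qed

text \<open>Adding all boundaries turns the union of the open cells into a union of closed cells without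
  changing it, and closed cells are compact.\<close>

lemma closedin_cell_union:
  assumes "S \<subseteq> cells_upto X i" "cells_upto X (i - 1) \<subseteq> S"
  shows "closedin (cw_space X) (cell_union X S)"
proof -
  have S: "S \<subseteq> cw_cells X" using assms cells_upto_subset by blast
  have "cell_union X S = (\<Union>\<sigma>\<in>S. closed_cell X \<sigma>)"
  proof
    show "(\<Union>\<sigma>\<in>S. closed_cell X \<sigma>) \<subseteq> cell_union X S"
    proof
      fix x assume "x \<in> (\<Union>\<sigma>\<in>S. closed_cell X \<sigma>)"
      then obtain \<sigma> where \<sigma>: "\<sigma> \<in> S" "x \<in> closed_cell X \<sigma>" by blast
      have "\<sigma> \<in> cells_of_dim X (int (cw_celldim X \<sigma>))" using \<sigma> S by (auto simp: cells_of_dim_def)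
      moreover have "cells_upto X (int (cw_celldim X \<sigma>) - 1) \<subseteq> S"
        using assms \<sigma> by (fastforce simp: cells_upto_def)
      ultimately show "x \<in> cell_union X S"
        using \<sigma> sphere_in_skeleton[of \<sigma> "int (cw_celldim X \<sigma>)" S]
        unfolding closed_cell_eq cell_union_def by blast
    qed
  qed (auto simp: cell_union_def closed_cell_eq)
  moreover have "closedin (cw_space X) (\<Union>\<sigma>\<in>S. closed_cell X \<sigma>)"
    using S finite_cells closedin_closed_cell finite_subset by (intro closedin_Union) blast+
  ultimately show ?thesis by simp
qed

lemma cell_attachment_open_cell:
  assumes \<sigma>: "\<sigma> \<in> cells_of_dim X (int n)" "\<sigma> \<notin> S"
    and S: "S \<subseteq> cells_upto X (int n)" "cells_upto X (int n - 1) \<subseteq> S"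
  shows "cell_attachment (subtopology (cw_space X) (cell_union X (insert \<sigma> S)))
           (cell_union X S) n (cw_char X \<sigma>)"
proof
  have d: "cw_celldim X \<sigma> = n" and \<sigma>X: "\<sigma> \<in> cw_cells X" using \<sigma> by (auto simp: cells_of_dim_def)
  have SX: "S \<subseteq> cw_cells X" using S cells_upto_subset by blast
  let ?Z = "subtopology (cw_space X) (cell_union X (insert \<sigma> S))"
  have sub: "cell_union X (insert \<sigma> S) \<subseteq> topspace (cw_space X)"
    using SX \<sigma>X by (intro cell_union_subset) auto
  show "Hausdorff_space ?Z" using Hausdorff_space_cw by (rule Hausdorff_space_subtopology)
  show "closedin ?Z (cell_union X S)"
    using closedin_cell_union[OF S] cell_union_mono[of S "insert \<sigma> S" X] by (auto intro: closedin_subset_topspace)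
  have sph: "cw_char X \<sigma> ` ndisk_sphere n \<subseteq> cell_union X S"
    using sphere_in_skeleton[OF \<sigma>(1) S(2)] d by simp
  then show "cw_char X \<sigma> ` ndisk_sphere n \<subseteq> cell_union X S" .
  have img: "cw_char X \<sigma> ` topspace (ndisk n) \<subseteq> cell_union X (insert \<sigma> S)"
    using sph d unfolding ndisk_cases by (auto simp: cell_union_def open_cell_def)
  then show "continuous_map (ndisk n) ?Z (cw_char X \<sigma>)"
    using continuous_map_cw_char[OF \<sigma>X] d by (auto simp: continuous_map_in_subtopology)
  show "embedding_map (subtopology (ndisk n) (ndisk_interior n)) ?Z (cw_char X \<sigma>)"
    using embedding_map_cw_char[OF \<sigma>X] d img by (auto simp: embedding_map_in_subtopology)
  have "cell_union X (insert \<sigma> S) - cell_union X S = cell_union X (insert \<sigma> S - S)"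
    using SX \<sigma>X by (intro cell_union_Diff) auto
  also have "insert \<sigma> S - S = {\<sigma>}" using \<sigma> by blast
  finally show "cw_char X \<sigma> ` ndisk_interior n = topspace ?Z - cell_union X S"
    using sub d by (simp add: cell_union_def open_cell_def Int_absorb1)
qed

text \<open>All groups below belong to pairs that are unions of open cells of \<open>X\<close>; recording the two sets
  of cells keeps inclusions of such pairs simple. In all uses \<open>A\<close> contains the skeleton below
  dimension \<open>n\<close> and \<open>S\<close> lies in the skeleton of dimension \<open>n\<close>.\<close>

definition class_in :: "nat \<Rightarrow> 'c set \<Rightarrow> 'c set \<Rightarrow> 'c \<Rightarrow> 'a chain set" where
  "class_in n S A \<sigma> = hom_induced (int n) (ndisk n) (ndisk_sphere n)
       (subtopology (cw_space X) (cell_union X S)) (cell_union X A) (cw_char X \<sigma>) (disk_class n)"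

definition pair_group :: "nat \<Rightarrow> 'c set \<Rightarrow> 'c set \<Rightarrow> 'a chain set monoid" where
  "pair_group n S A = relative_homology_group (int n) (subtopology (cw_space X) (cell_union X S)) (cell_union X A)"

definition enlarge :: "nat \<Rightarrow> 'c set \<Rightarrow> 'c set \<Rightarrow> 'c set \<Rightarrow> 'c set \<Rightarrow> 'a chain set \<Rightarrow> 'a chain set" where
  "enlarge n S A S' A' = hom_induced (int n) (subtopology (cw_space X) (cell_union X S)) (cell_union X A)
     (subtopology (cw_space X) (cell_union X S')) (cell_union X A') id"

lemma comm_group_pair [simp]: "comm_group (pair_group n S A)" 
  and enlarge_hom: "enlarge n S A S' A' \<in> hom (pair_group n S A) (pair_group n S' A')"
  and class_in_carrier: "class_in n S A \<sigma> \<in> carrier (pair_group n S A)"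
  by (simp_all add: pair_group_def enlarge_def class_in_def hom_induced_hom hom_induced_carrier)

lemma char_into_cell_union:
  assumes "\<sigma> \<in> cells_of_dim X (int n)" "cells_upto X (int n - 1) \<subseteq> A" "A \<subseteq> S" "\<sigma> \<in> S"
  shows "continuous_map (ndisk n) (subtopology (cw_space X) (cell_union X S)) (cw_char X \<sigma>)"
    and "cw_char X \<sigma> ` ndisk_sphere n \<subseteq> cell_union X A"
proof -
  have d: "cw_celldim X \<sigma> = n" and \<sigma>X: "\<sigma> \<in> cw_cells X" using assms by (auto simp: cells_of_dim_def)
  show sph: "cw_char X \<sigma> ` ndisk_sphere n \<subseteq> cell_union X A"
    using sphere_in_skeleton[OF assms(1,2)] d by simp
  moreover have "cw_char X \<sigma> ` ndisk_interior n \<subseteq> cell_union X S"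
    using assms d by (auto simp: cell_union_def open_cell_def)
  ultimately show "continuous_map (ndisk n) (subtopology (cw_space X) (cell_union X S)) (cw_char X \<sigma>)"
    using continuous_map_cw_char[OF \<sigma>X] d cell_union_mono[OF assms(3), of X]
    by (force simp: continuous_map_in_subtopology ndisk_cases)
qed

lemma enlarge_class:
  assumes "\<sigma> \<in> cells_of_dim X (int n)" "cells_upto X (int n - 1) \<subseteq> A" "A \<subseteq> S" "\<sigma> \<in> S"
    "A \<subseteq> A'" "S \<subseteq> S'"
  shows "enlarge n S A S' A' (class_in n S A \<sigma>) = class_in n S' A' \<sigma>"
proof -
  have "continuous_map (subtopology (cw_space X) (cell_union X S)) (subtopology (cw_space X) (cell_union X S')) id"
    using cell_union_mono[OF assms(6), of X] by (auto simp: continuous_map_in_subtopology continuous_map_from_subtopology)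
  then show ?thesis
    using char_into_cell_union[OF assms(1-4)] cell_union_mono[OF assms(5), of X]
    unfolding enlarge_def class_in_def by (subst hom_induced_compose') auto
qed

text \<open>By \<open>iso_characteristic_map\<close> this group is a copy of the homology of the disk, with the class of
  \<open>\<sigma>\<close> corresponding to the chosen generator.\<close>

lemma pair_group_single_cell:
  assumes \<sigma>: "\<sigma> \<in> cells_of_dim X (int n)" "\<sigma> \<notin> S"
    and S: "S \<subseteq> cells_upto X (int n)" "cells_upto X (int n - 1) \<subseteq> S"
  defines "G \<equiv> pair_group n (insert \<sigma> S) S" and "c \<equiv> class_in n (insert \<sigma> S) S \<sigma>"
  shows "x \<in> carrier G \<Longrightarrow> \<exists>m::int. x = c [^]\<^bsub>G\<^esub> m" and "c [^]\<^bsub>G\<^esub> (m::int) = \<one>\<^bsub>G\<^esub> \<Longrightarrow> m = 0"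
proof -
  let ?D = "relative_homology_group (int n) (ndisk n) (ndisk_sphere n)"
  let ?h = "hom_induced (int n) (ndisk n) (ndisk_sphere n)
       (subtopology (cw_space X) (cell_union X (insert \<sigma> S))) (cell_union X S) (cw_char X \<sigma>)"
  interpret cell_attachment "subtopology (cw_space X) (cell_union X (insert \<sigma> S))" "cell_union X S" n "cw_char X \<sigma>"
    by (rule cell_attachment_open_cell[OF \<sigma> S])
  have h: "?h \<in> iso ?D G" using iso_characteristic_map[of "int n"] by (simp add: G_def pair_group_def)
  interpret h: group_hom ?D G ?h
    using h by (simp add: group_hom_def group_hom_axioms_def iso_def G_def pair_group_def)
  have pow: "?h (disk_class n [^]\<^bsub>?D\<^esub> m) = c [^]\<^bsub>G\<^esub> m" for m :: int
    using h.hom_int_pow disk_class_in_carrier by (simp add: c_def class_in_def)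
  show "\<exists>m::int. x = c [^]\<^bsub>G\<^esub> m" if "x \<in> carrier G"
  proof -
    from that h obtain y where "y \<in> carrier ?D" "x = ?h y" by (auto simp: iso_iff)
    then show ?thesis using disk_class_generates[of n] pow by auto
  qed
  show "m = 0" if "c [^]\<^bsub>G\<^esub> m = \<one>\<^bsub>G\<^esub>"
  proof (rule disk_class_infinite_order)
    have "?h (disk_class n [^]\<^bsub>?D\<^esub> m) = ?h \<one>\<^bsub>?D\<^esub>" using pow that h.hom_one by metis
    moreover have "inj_on ?h (carrier ?D)" using h by (simp add: iso_iff)
    ultimately show "disk_class n [^]\<^bsub>?D\<^esub> m = \<one>\<^bsub>?D\<^esub>"
      using disk_class_in_carrier[of n] h.G.int_pow_closed h.G.one_closed by (metis inj_onD)
  qed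
qed

lemma trivial_pair_group_self: "trivial_group (pair_group n A A)"
proof -
  let ?Z = "subtopology (cw_space X) (cell_union X A)"
  have "relative_homology_group (int n) ?Z (cell_union X A) = relative_homology_group (int n) ?Z (topspace ?Z)"
    using relative_homology_group_restrict[of "int n" ?Z "cell_union X A"]
      relative_homology_group_restrict[of "int n" ?Z "topspace ?Z \<inter> cell_union X A"] by (simp add: Int_assoc)
  then show ?thesis
    unfolding pair_group_def using trivial_relative_homology_group_topspace by metis
qed

text \<open>Adding one cell at a time: by exactness for the triple, an element that vanishes modulo
  the smaller space comes from it.\<close>

lemma classes_generate:
  assumes "finite C" "C \<subseteq> cells_of_dim X (int n)"
  defines "A \<equiv> cells_upto X (int n - 1)"
  assumes "x \<in> carrier (pair_group n (A \<union> C) A)"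
  shows "\<exists>m::'c \<Rightarrow> int. x = finprod (pair_group n (A \<union> C) A)
            (\<lambda>\<tau>. class_in n (A \<union> C) A \<tau> [^]\<^bsub>pair_group n (A \<union> C) A\<^esub> m \<tau>) C"
  using assms(1,2,4)
proof (induction C arbitrary: x rule: finite_induct)
  case empty
  interpret comm_group "pair_group n A A" by simp
  have "x = \<one>\<^bsub>pair_group n A A\<^esub>"
    using empty trivial_pair_group_self[of n A] by (auto simp: trivial_group_def)
  then show ?case by simp
next
  case (insert \<sigma> C)
  define S where "S = A \<union> C"
  define S' where "S' = A \<union> insert \<sigma> C"
  define G where "G = pair_group n S' A"
  define H where "H = pair_group n S A"
  define Q where "Q = pair_group n S' S"
  define c where "c = class_in n S' A"
  let ?j = "enlarge n S' A S' S" and ?i = "enlarge n S A S' A"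
  interpret G: comm_group G by (simp add: G_def)
  interpret Q: comm_group Q by (simp add: Q_def)
  have jhom: "?j \<in> hom G Q" by (simp add: G_def Q_def enlarge_hom)
  interpret j: group_hom G Q ?j
    by unfold_locales (fact jhom)
  have \<sigma>: "\<sigma> \<in> cells_of_dim X (int n)" "\<sigma> \<notin> S" 
    using insert by (auto simp: A_def S_def cells_upto_def cells_of_dim_def)
  have S: "S \<subseteq> cells_upto X (int n)" "cells_upto X (int n - 1) \<subseteq> S"
    using insert by (auto simp: A_def S_def cells_upto_def cells_of_dim_def)
  have ins: "insert \<sigma> S = S'" by (auto simp: S_def S'_def)
  have xG: "x \<in> carrier G" using insert.prems by (simp add: G_def S'_def)
  then have "?j x \<in> carrier Q" by simp
  then obtain m where m: "?j x = class_in n S' S \<sigma> [^]\<^bsub>Q\<^esub> (m::int)"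
    using pair_group_single_cell(1)[OF \<sigma> S, of "?j x"] unfolding ins Q_def by blast
  define y where "y = x \<otimes>\<^bsub>G\<^esub> c \<sigma> [^]\<^bsub>G\<^esub> (- m)"
  have c: "c \<tau> \<in> carrier G" for \<tau> by (simp add: c_def G_def class_in_carrier)
  have j\<sigma>: "?j (c \<sigma>) = class_in n S' S \<sigma>"
    unfolding c_def using \<sigma> ins by (intro enlarge_class) (auto simp: A_def S_def S'_def)
  have cQ: "class_in n S' S \<sigma> \<in> carrier Q" by (simp add: Q_def class_in_carrier)
  have "?j y = ?j x \<otimes>\<^bsub>Q\<^esub> ?j (c \<sigma>) [^]\<^bsub>Q\<^esub> (- m)"
    unfolding y_def using xG c by (simp add: j.hom_int_pow)
  also have "\<dots> = \<one>\<^bsub>Q\<^esub>" using cQ by (simp add: m j\<sigma> Q.int_pow_neg)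
  finally have jy: "?j y = \<one>\<^bsub>Q\<^esub>" .
  have yG: "y \<in> carrier G" using xG c by (simp add: y_def)
  have "kernel G Q ?j = ?i ` carrier H"
  proof -
    have AS: "cell_union X A \<subseteq> cell_union X S" by (rule cell_union_mono) (auto simp: S_def)
    have "cell_union X S \<subseteq> cell_union X S'" by (rule cell_union_mono) (auto simp: S_def S'_def)
    then have "subtopology (subtopology (cw_space X) (cell_union X S')) (cell_union X S)
        = subtopology (cw_space X) (cell_union X S)"
      by (simp add: subtopology_subtopology Int_absorb1)
    then show ?thesis
      using homology_exactness_triple_3[OF AS, of "int n" "subtopology (cw_space X) (cell_union X S')"]
      by (simp add: pair_group_def enlarge_def G_def H_def Q_def)
  qed
  with jy yG have "y \<in> ?i ` carrier H" by (auto simp: kernel_def)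
  then obtain z where z: "z \<in> carrier H" "y = ?i z" by blast
  obtain k :: "'c \<Rightarrow> int" where k: "z = finprod H (\<lambda>\<tau>. class_in n S A \<tau> [^]\<^bsub>H\<^esub> k \<tau>) C"
    using insert.IH[of z] insert.prems z(1) unfolding H_def S_def by blast
  have "y = finprod G (\<lambda>\<tau>. ?i (class_in n S A \<tau>) [^]\<^bsub>G\<^esub> k \<tau>) C"
    unfolding z k by (rule hom_finprod_int_pow) (auto simp: enlarge_hom class_in_carrier insert.hyps G_def H_def)
  also have "\<dots> = finprod G (\<lambda>\<tau>. c \<tau> [^]\<^bsub>G\<^esub> (k(\<sigma> := m)) \<tau>) C"
  proof (rule G.finprod_cong')
    fix \<tau> assume \<tau>: "\<tau> \<in> C"
    have "?i (class_in n S A \<tau>) = c \<tau>"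
      unfolding c_def using \<tau> insert.prems by (intro enlarge_class) (auto simp: A_def S_def S'_def)
    moreover have "\<tau> \<noteq> \<sigma>" using \<tau> insert.hyps by blast
    ultimately show "?i (class_in n S A \<tau>) [^]\<^bsub>G\<^esub> k \<tau> = c \<tau> [^]\<^bsub>G\<^esub> (k(\<sigma> := m)) \<tau>" by simp
  qed (use c in auto)
  finally have y: "y = \<dots>" .
  have "x = c \<sigma> [^]\<^bsub>G\<^esub> m \<otimes>\<^bsub>G\<^esub> y"
  proof -
    have "c \<sigma> [^]\<^bsub>G\<^esub> m \<otimes>\<^bsub>G\<^esub> y = x \<otimes>\<^bsub>G\<^esub> (c \<sigma> [^]\<^bsub>G\<^esub> m \<otimes>\<^bsub>G\<^esub> c \<sigma> [^]\<^bsub>G\<^esub> (- m))"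
      unfolding y_def using c xG by (simp add: G.m_lcomm)
    then show ?thesis using c xG by (simp add: G.int_pow_neg)
  qed
  also have "\<dots> = finprod G (\<lambda>\<tau>. c \<tau> [^]\<^bsub>G\<^esub> (k(\<sigma> := m)) \<tau>) (insert \<sigma> C)"
    unfolding y using insert.hyps c by (subst G.finprod_insert) auto
  finally show ?case unfolding G_def c_def S'_def by blast
qed

text \<open>Independence: collapsing everything except the open cell \<open>\<sigma>\<close> kills all other classes.\<close>

lemma classes_independent:
  fixes m :: "'c \<Rightarrow> int"
  defines "A \<equiv> \<lambda>n. cells_upto X (int n - 1)" and "C \<equiv> \<lambda>n. cells_of_dim X (int n)"
  defines "G \<equiv> \<lambda>n. pair_group n (A n \<union> C n) (A n)"
  assumes 0: "finprod (G n) (\<lambda>\<tau>. class_in n (A n \<union> C n) (A n) \<tau> [^]\<^bsub>G n\<^esub> m \<tau>) (C n) = \<one>\<^bsub>G n\<^esub>"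
    and \<sigma>: "\<sigma> \<in> C n"
  shows "m \<sigma> = 0"
proof -
  define S where "S = A n \<union> C n" 
  define B where "B = S - {\<sigma>}"
  define Q where "Q = pair_group n S B"
  define c where "c = class_in n S B"
  let ?j = "enlarge n S (A n) S B"
  have ins: "insert \<sigma> B = S" using \<sigma> by (auto simp: S_def B_def)
  have AB: "A n \<subseteq> B" using \<sigma> by (auto simp: A_def C_def S_def B_def cells_upto_def cells_of_dim_def)
  interpret G: comm_group "G n" by (simp add: G_def)
  interpret Q: comm_group Q by (simp add: Q_def)
  have Cn: "finite (C n)" by (simp add: C_def finite_cells_of_dim)
  have j: "?j \<in> hom (G n) Q" by (simp add: G_def Q_def S_def enlarge_hom)
  have c: "c \<tau> \<in> carrier Q" for \<tau> by (simp add: c_def Q_def class_in_carrier)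
  have jc: "?j (class_in n S (A n) \<tau>) = c \<tau>" if "\<tau> \<in> C n" for \<tau>
    unfolding c_def using that AB by (intro enlarge_class) (auto simp: A_def C_def S_def B_def)
  have jone: "c \<tau> = \<one>\<^bsub>Q\<^esub>" if "\<tau> \<in> C n" "\<tau> \<noteq> \<sigma>" for \<tau>
  proof -
    have "c \<tau> = enlarge n B B S B (class_in n B B \<tau>)"
      unfolding c_def using that AB by (intro enlarge_class[symmetric]) (auto simp: A_def C_def S_def B_def)
    also have "class_in n B B \<tau> = \<one>\<^bsub>pair_group n B B\<^esub>"
      using class_in_carrier[of n B B \<tau>] trivial_pair_group_self[of n B] by (auto simp: trivial_group_def)
    also have "enlarge n B B S B \<dots> = \<one>\<^bsub>Q\<^esub>"
      unfolding Q_def using enlarge_hom[of n B B S B] by (rule hom_one) (simp_all add: comm_group.axioms(2))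
    finally show ?thesis .
  qed
  have "\<one>\<^bsub>Q\<^esub> = ?j (finprod (G n) (\<lambda>\<tau>. class_in n S (A n) \<tau> [^]\<^bsub>G n\<^esub> m \<tau>) (C n))"
    unfolding S_def 0 using j G.is_group Q.is_group by (simp add: hom_one S_def)
  also have "\<dots> = finprod Q (\<lambda>\<tau>. ?j (class_in n S (A n) \<tau>) [^]\<^bsub>Q\<^esub> m \<tau>) (C n)"
    by (rule hom_finprod_int_pow) (use j Cn in \<open>auto simp: G_def S_def Q_def class_in_carrier\<close>)
  also have "\<dots> = finprod Q (\<lambda>\<tau>. if \<sigma> = \<tau> then c \<sigma> [^]\<^bsub>Q\<^esub> m \<sigma> else \<one>\<^bsub>Q\<^esub>) (C n)"
    by (rule Q.finprod_cong') (auto simp: jc jone c)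
  also have "\<dots> = c \<sigma> [^]\<^bsub>Q\<^esub> m \<sigma>"
    using Q.finprod_singleton[OF \<sigma> Cn, of "\<lambda>\<tau>. c \<sigma> [^]\<^bsub>Q\<^esub> m \<sigma>"] c by simp
  finally have "c \<sigma> [^]\<^bsub>Q\<^esub> m \<sigma> = \<one>\<^bsub>Q\<^esub>" ..
  moreover have "\<sigma> \<notin> B" "B \<subseteq> cells_upto X (int n)"
    by (auto simp: B_def S_def A_def C_def cells_upto_def cells_of_dim_def)
  ultimately show ?thesis
    using pair_group_single_cell(2)[of \<sigma> n B "m \<sigma>"] \<sigma> AB unfolding ins
    by (simp add: Q_def c_def A_def C_def)
qed

lemma cellular_group_eq:
  "cellular_group (int n) X = pair_group n (cells_upto X (int n - 1) \<union> cells_of_dim X (int n)) (cells_upto X (int n - 1))"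
  by (simp add: cellular_group_def pair_group_def skel_space_eq[of X "int n"] topspace_skel cells_upto_Un[of "int n"])

lemma cell_class_eq:
  assumes "\<sigma> \<in> cells_of_dim X (int n)"
  shows "cell_class X \<sigma> = class_in n (cells_upto X (int n - 1) \<union> cells_of_dim X (int n)) (cells_upto X (int n - 1)) \<sigma>"
  using assms by (auto simp: cell_class_def class_in_def Let_def cells_of_dim_def skel_space_eq[of X "int n"] topspace_skel 
     cells_upto_Un[of "int n"])

theorem cell_classes_basis:
  defines "H \<equiv> \<lambda>n. cellular_group (int n) X"
  shows "x \<in> carrier (H n) \<Longrightarrow> \<exists>!m::'c \<Rightarrow> int. (\<forall>\<tau>. \<tau> \<notin> cells_of_dim X (int n) \<longrightarrow> m \<tau> = 0) \<and>
      x = finprod (H n) (\<lambda>\<tau>. cell_class X \<tau> [^]\<^bsub>H n\<^esub> m \<tau>) (cells_of_dim X (int n))"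
    and "finprod (H n) (\<lambda>\<tau>. cell_class X \<tau> [^]\<^bsub>H n\<^esub> (m \<tau>::int)) (cells_of_dim X (int n)) = \<one>\<^bsub>H n\<^esub>
       \<Longrightarrow> \<sigma> \<in> cells_of_dim X (int n) \<Longrightarrow> m \<sigma> = 0"
proof -
  let ?C = "cells_of_dim X (int n)"
  interpret H: comm_group "H n" by (simp add: H_def cellular_group_eq)
  have c: "cell_class X \<tau> \<in> carrier (H n)" if "\<tau> \<in> ?C" for \<tau>
    using that by (simp add: H_def cell_class_eq cellular_group_eq class_in_carrier)
  let ?f = "\<lambda>m::'c \<Rightarrow> int. finprod (H n) (\<lambda>\<tau>. cell_class X \<tau> [^]\<^bsub>H n\<^esub> m \<tau>) ?C"
  have eq: "?f m = finprod (H n) (\<lambda>\<tau>. class_in n (cells_upto X (int n - 1) \<union> ?C) (cells_upto X (int n - 1)) \<tau> [^]\<^bsub>H n\<^esub> m \<tau>) ?C" for m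
    by (rule H.finprod_cong') (use c in \<open>auto simp: cell_class_eq\<close>)
  show indep: "m \<sigma> = 0" if "?f m = \<one>\<^bsub>H n\<^esub>" "\<sigma> \<in> ?C" for m \<sigma>
    using classes_independent[of n m \<sigma>] that unfolding eq by (simp add: H_def cellular_group_eq)
  show "\<exists>!m::'c \<Rightarrow> int. (\<forall>\<tau>. \<tau> \<notin> ?C \<longrightarrow> m \<tau> = 0) \<and> x = ?f m" if x: "x \<in> carrier (H n)"
  proof -
    obtain m where m: "x = ?f m"
      using classes_generate[OF finite_cells_of_dim order_refl, of x n] x unfolding eq by (auto simp: H_def cellular_group_eq)
    show ?thesis
    proof (rule ex1I[of _ "\<lambda>\<tau>. if \<tau> \<in> ?C then m \<tau> else 0"])
      show "(\<forall>\<tau>. \<tau> \<notin> ?C \<longrightarrow> (if \<tau> \<in> ?C then m \<tau> else 0) = 0) \<and> x = ?f (\<lambda>\<tau>. if \<tau> \<in> ?C then m \<tau> else 0)"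
      proof (intro conjI allI impI)
        show "x = ?f (\<lambda>\<tau>. if \<tau> \<in> ?C then m \<tau> else 0)"
          unfolding m by (rule H.finprod_cong') (auto simp: c)
      qed simp
      fix k assume k: "(\<forall>\<tau>. \<tau> \<notin> ?C \<longrightarrow> k \<tau> = 0) \<and> x = ?f k"
      have "?f k = ?f (\<lambda>\<tau>. k \<tau> - m \<tau>) \<otimes>\<^bsub>H n\<^esub> ?f m"
      proof -
        have "?f (\<lambda>\<tau>. k \<tau> - m \<tau>) \<otimes>\<^bsub>H n\<^esub> ?f m = finprod (H n) (\<lambda>\<tau>. cell_class X \<tau> [^]\<^bsub>H n\<^esub> (k \<tau> - m \<tau>) \<otimes>\<^bsub>H n\<^esub> cell_class X \<tau> [^]\<^bsub>H n\<^esub> m \<tau>) ?C"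
          by (rule H.finprod_multf[symmetric]) (use c in auto)
        also have "\<dots> = ?f k"
          by (rule H.finprod_cong') (use c in \<open>auto simp flip: H.int_pow_mult\<close>)
        finally show ?thesis by simp
      qed
      moreover have "?f (\<lambda>\<tau>. k \<tau> - m \<tau>) \<in> carrier (H n)" "?f m \<in> carrier (H n)"
        using c by (auto intro!: H.finprod_closed)
      ultimately have "?f (\<lambda>\<tau>. k \<tau> - m \<tau>) = \<one>\<^bsub>H n\<^esub>"
        using k m H.r_cancel_one[of "?f m" "?f (\<lambda>\<tau>. k \<tau> - m \<tau>)"] by auto
      then have "k \<tau> = m \<tau>" if "\<tau> \<in> ?C" for \<tau> using indep[of "\<lambda>\<tau>. k \<tau> - m \<tau>" \<tau>] that by simp
      then show "k = (\<lambda>\<tau>. if \<tau> \<in> ?C then m \<tau> else 0)" using k by auto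
    qed
  qed
qed


section \<open>The boundary matrix\<close>

lemma subtopology_skel: "j \<le> i \<Longrightarrow> subtopology (skel_space X i) (topspace (skel_space X j)) = skel_space X j"
proof -
  assume "j \<le> i"
  then have "cells_upto X j \<subseteq> cells_upto X i" by (auto simp: cells_upto_def)
  then show ?thesis
    unfolding topspace_skel unfolding skel_space_eq
    by (simp add: subtopology_subtopology Int_absorb1 cell_union_mono)
qed

lemma cellular_boundary_eq:
  "cellular_boundary i X c = hom_induced (i - 1) (skel_space X (i - 1)) {}
       (skel_space X (i - 1)) (topspace (skel_space X (i - 2))) id
       (hom_boundary i (skel_space X i) (topspace (skel_space X (i - 1))) c)"
  by (simp add: cellular_boundary_def subtopology_skel)

lemma comm_group_cellular [simp]: "comm_group (cellular_group i X)"
  by (simp add: cellular_group_def)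

lemma cellular_boundary_hom:
  "cellular_boundary i X \<in> hom (cellular_group i X) (cellular_group (i - 1) X)"
proof -
  have "(\<lambda>c. cellular_boundary i X c) = hom_induced (i - 1) (skel_space X (i - 1)) {}
       (skel_space X (i - 1)) (topspace (skel_space X (i - 2))) id \<circ>
       hom_boundary i (skel_space X i) (topspace (skel_space X (i - 1)))"
    by (auto simp: cellular_boundary_eq)
  moreover have "hom_boundary i (skel_space X i) (topspace (skel_space X (i - 1)))
      \<in> hom (cellular_group i X) (homology_group (i - 1) (skel_space X (i - 1)))"
    using hom_boundary_hom[of i "skel_space X i" "topspace (skel_space X (i - 1))"]
    by (simp add: cellular_group_def subtopology_skel)
  moreover have "hom_induced (i - 1) (skel_space X (i - 1)) {} (skel_space X (i - 1)) (topspace (skel_space X (i - 2))) id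
      \<in> hom (homology_group (i - 1) (skel_space X (i - 1))) (cellular_group (i - 1) X)"
    using hom_induced_hom[of "i - 1"] by (simp add: cellular_group_def)
  ultimately show ?thesis using hom_compose by metis
qed

lemma cell_class_carrier:
  "\<sigma> \<in> cells_of_dim X i \<Longrightarrow> cell_class X \<sigma> \<in> carrier (cellular_group i X)"
  by (auto simp: cell_class_def cellular_group_def Let_def cells_of_dim_def hom_induced_carrier)

text \<open>The incidence numbers are defined by a definite description; that it denotes is the basis
  property of the cell classes one dimension below.\<close>

lemma incidence_expansion:
  assumes \<sigma>: "\<sigma> \<in> cells_of_dim X (int (Suc n))"
  defines "H \<equiv> cellular_group (int n) X"
  shows "cellular_boundary (int (Suc n)) X (cell_class X \<sigma>)
    = finprod H (\<lambda>\<tau>. cell_class X \<tau> [^]\<^bsub>H\<^esub> incidence X \<tau> \<sigma>) (cells_of_dim X (int n))"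
proof -
  have d: "cw_celldim X \<sigma> = Suc n" using \<sigma> by (simp add: cells_of_dim_def)
  let ?P = "\<lambda>m::'c \<Rightarrow> int. (\<forall>\<tau>. \<tau> \<notin> cells_of_dim X (int n) \<longrightarrow> m \<tau> = 0) \<and>
      cellular_boundary (int (Suc n)) X (cell_class X \<sigma>)
      = finprod H (\<lambda>\<tau>. cell_class X \<tau> [^]\<^bsub>H\<^esub> m \<tau>) (cells_of_dim X (int n))"
  have "cellular_boundary (int (Suc n)) X (cell_class X \<sigma>) \<in> carrier H"
    using hom_in_carrier[OF cellular_boundary_hom cell_class_carrier[OF \<sigma>]] by (simp add: H_def)
  then have "\<exists>!m. ?P m" unfolding H_def by (rule cell_classes_basis(1))
  from theI'[OF this] have P: "?P (THE m. ?P m)" .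
  have "(\<lambda>\<tau>. incidence X \<tau> \<sigma>) = (THE m. ?P m)"
    by (simp add: incidence_def d H_def Let_def)
  from P[folded this] show ?thesis by blast
qed

text \<open>The composition contains two consecutive maps of the long exact sequence of the pair formed by
  the \<open>(i - 1)\<close>- and the \<open>(i - 2)\<close>-skeleton.\<close>

lemma cellular_boundary_boundary:
  assumes "c \<in> carrier (cellular_group i X)"
  shows "cellular_boundary (i - 1) X (cellular_boundary i X c) = \<one>\<^bsub>cellular_group (i - 2) X\<^esub>"
proof -
  let ?K = "skel_space X (i - 1)" and ?A = "topspace (skel_space X (i - 2))"
  define \<delta> where "\<delta> = hom_boundary i (skel_space X i) (topspace ?K) c"
  have \<delta>: "\<delta> \<in> carrier (homology_group (i - 1) ?K)"
    using hom_boundary_carrier[of i "skel_space X i" "topspace ?K" c] by (simp add: \<delta>_def subtopology_skel)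
  have "hom_induced (i - 1) ?K {} ?K ?A id \<delta> \<in> kernel (relative_homology_group (i - 1) ?K ?A)
      (homology_group (i - 1 - 1) (subtopology ?K ?A)) (hom_boundary (i - 1) ?K ?A)"
    using homology_exactness_axiom_1[of "i - 1" ?K ?A] \<delta> by auto
  then have "hom_boundary (i - 1) ?K ?A (cellular_boundary i X c) = \<one>\<^bsub>homology_group (i - 2) (skel_space X (i - 2))\<^esub>"
    by (simp add: cellular_boundary_eq kernel_def subtopology_skel flip: \<delta>_def)
  then have "cellular_boundary (i - 1) X (cellular_boundary i X c)
     = hom_induced (i - 2) (skel_space X (i - 2)) {} (skel_space X (i - 2)) (topspace (skel_space X (i - 3))) id
        \<one>\<^bsub>homology_group (i - 2) (skel_space X (i - 2))\<^esub>"
    by (simp add: cellular_boundary_eq[of "i - 1"])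
  also have "\<dots> = \<one>\<^bsub>cellular_group (i - 2) X\<^esub>"
    unfolding cellular_group_def using hom_one[OF hom_induced_hom] by (simp del: one_relative_homology_group)
  finally show ?thesis .
qed

lemma finprod_int_pow_sum:
  assumes "comm_group G" "g \<in> carrier G" "finite C"
  shows "finprod G (\<lambda>\<tau>. g [^]\<^bsub>G\<^esub> (m \<tau> :: int)) C = g [^]\<^bsub>G\<^esub> (\<Sum>\<tau>\<in>C. m \<tau>)"
proof -
  interpret comm_group G by fact
  show ?thesis using assms(3)
    by (induction rule: finite_induct) (use assms(2) in \<open>auto simp: int_pow_mult\<close>)
qed

text \<open>Expanding the vanishing double boundary in the basis of cell classes, every coefficient must be
  zero.\<close>

theorem incidence_incidence:
  assumes \<sigma>: "\<sigma> \<in> cells_of_dim X (int (Suc (Suc n)))" and \<rho>: "\<rho> \<in> cells_of_dim X (int n)"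
  shows "(\<Sum>\<tau>\<in>cells_of_dim X (int (Suc n)). incidence X \<rho> \<tau> * incidence X \<tau> \<sigma>) = 0"
proof -
  define H where "H = cellular_group (int n) X"
  let ?C = "cells_of_dim X (int n)" and ?C' = "cells_of_dim X (int (Suc n))"
  let ?c = "cell_class X"
  let ?bd = "cellular_boundary (int (Suc n)) X"
  interpret H: comm_group H by (simp add: H_def)
  have c: "?c \<tau> \<in> carrier H" if "\<tau> \<in> ?C" for \<tau> using that by (simp add: H_def cell_class_carrier)
  have h: "?bd \<in> hom (cellular_group (int (Suc n)) X) H" 
    using cellular_boundary_hom[of "int (Suc n)"] by (simp add: H_def)
  have fin: "finite ?C" "finite ?C'" by (simp_all add: finite_cells_of_dim)
  have "\<one>\<^bsub>H\<^esub> = ?bd (cellular_boundary (int (Suc (Suc n))) X (?c \<sigma>))"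
    using cellular_boundary_boundary[OF cell_class_carrier[OF \<sigma>]] by (simp add: H_def)
  also have "\<dots> = finprod H (\<lambda>\<tau>. ?bd (?c \<tau>) [^]\<^bsub>H\<^esub> incidence X \<tau> \<sigma>) ?C'"
    unfolding incidence_expansion[OF \<sigma>]
    by (rule hom_finprod_int_pow) (use h fin cell_class_carrier H.comm_group_axioms in auto)
  also have "\<dots> = finprod H (\<lambda>\<tau>. finprod H (\<lambda>\<rho>. ?c \<rho> [^]\<^bsub>H\<^esub> (incidence X \<rho> \<tau> * incidence X \<tau> \<sigma>)) ?C) ?C'"
  proof (rule H.finprod_cong')
    fix \<tau> assume "\<tau> \<in> ?C'"
    then have "?bd (?c \<tau>) = finprod H (\<lambda>\<rho>. ?c \<rho> [^]\<^bsub>H\<^esub> incidence X \<rho> \<tau>) ?C"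
      using incidence_expansion[of \<tau> n] by (simp add: H_def)
    moreover have "(\<lambda>x. x [^]\<^bsub>H\<^esub> k) \<in> hom H H" for k :: int
      by (auto simp: hom_def H.int_pow_distrib)
    ultimately have "?bd (?c \<tau>) [^]\<^bsub>H\<^esub> incidence X \<tau> \<sigma>
        = finprod H (\<lambda>\<rho>. (?c \<rho> [^]\<^bsub>H\<^esub> incidence X \<tau> \<sigma>) [^]\<^bsub>H\<^esub> incidence X \<rho> \<tau>) ?C"
      using hom_finprod_int_pow[of H H "\<lambda>x. x [^]\<^bsub>H\<^esub> incidence X \<tau> \<sigma>" ?C ?c "\<lambda>\<rho>. incidence X \<rho> \<tau>"] c fin
        H.comm_group_axioms by auto
    also have "\<dots> = finprod H (\<lambda>\<rho>. ?c \<rho> [^]\<^bsub>H\<^esub> (incidence X \<rho> \<tau> * incidence X \<tau> \<sigma>)) ?C"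
      by (rule H.finprod_cong') (use c in \<open>auto simp: H.int_pow_pow mult.commute\<close>)
    finally show "?bd (?c \<tau>) [^]\<^bsub>H\<^esub> incidence X \<tau> \<sigma> = \<dots>" .
  qed (use c in \<open>auto intro!: H.finprod_closed\<close>)
  also have "\<dots> = finprod H (\<lambda>\<rho>. ?c \<rho> [^]\<^bsub>H\<^esub> (\<Sum>\<tau>\<in>?C'. incidence X \<rho> \<tau> * incidence X \<tau> \<sigma>)) ?C"
    using fin(2)
  proof (induction rule: finite_induct)
    case (insert \<tau> F)
    have "finprod H (\<lambda>\<rho>. ?c \<rho> [^]\<^bsub>H\<^esub> (incidence X \<rho> \<tau> * incidence X \<tau> \<sigma>)) ?C \<otimes>\<^bsub>H\<^esub> 
       finprod H (\<lambda>\<rho>. ?c \<rho> [^]\<^bsub>H\<^esub> (\<Sum>\<tau>\<in>F. incidence X \<rho> \<tau> * incidence X \<tau> \<sigma>)) ?C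
       = finprod H (\<lambda>\<rho>. ?c \<rho> [^]\<^bsub>H\<^esub> (incidence X \<rho> \<tau> * incidence X \<tau> \<sigma>) \<otimes>\<^bsub>H\<^esub> 
            ?c \<rho> [^]\<^bsub>H\<^esub> (\<Sum>\<tau>\<in>F. incidence X \<rho> \<tau> * incidence X \<tau> \<sigma>)) ?C"
      by (rule H.finprod_multf[symmetric]) (use c in auto)
    also have "\<dots> = finprod H (\<lambda>\<rho>. ?c \<rho> [^]\<^bsub>H\<^esub> (\<Sum>\<tau>\<in>insert \<tau> F. incidence X \<rho> \<tau> * incidence X \<tau> \<sigma>)) ?C"
      by (rule H.finprod_cong') (use c insert.hyps in \<open>auto simp: H.int_pow_mult\<close>)
    finally show ?case
      using insert c by (subst H.finprod_insert) (auto intro!: H.finprod_closed)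
  qed simp
  finally show ?thesis
    using cell_classes_basis(2)[of n "\<lambda>\<rho>. \<Sum>\<tau>\<in>?C'. incidence X \<rho> \<tau> * incidence X \<tau> \<sigma>" \<rho>] \<rho>
    by (simp add: H_def)
qed

text \<open>Every vertex class has the same image in the homology of a point, and the boundary of an
  edge dies there because it already dies in the 1-skeleton.\<close>

theorem incidence_augmentation:
  assumes \<sigma>: "\<sigma> \<in> cells_of_dim X 1"
  shows "(\<Sum>\<tau>\<in>cells_of_dim X 0. incidence X \<tau> \<sigma>) = 0"
proof -
  let ?P = "discrete_topology {()}"
  let ?H = "homology_group 0 ?P" and ?C = "cells_of_dim X 0"
  let ?e = "hom_induced 0 (skel_space X 0) {} ?P {} (\<lambda>_. ())"
  let ?g = "hom_induced 0 (ndisk 0) {} ?P {} (\<lambda>_. ()) (disk_class 0)"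
  have cP: "continuous_map Z ?P (\<lambda>_. ())" for Z :: "'z topology" by simp
  interpret H: comm_group ?H by simp
  have top: "topspace (skel_space X (-1)) = {}"
    unfolding topspace_skel by (auto simp: cell_union_def cells_upto_def)
  have S0: "ndisk_sphere 0 = {}" by (simp add: ndisk_sphere_def)
  have G0: "cellular_group 0 X = homology_group 0 (skel_space X 0)"
    by (simp add: cellular_group_def top)
  let ?i = "hom_induced 0 (skel_space X 0) {} (skel_space X 1) {} id"
  let ?\<delta> = "hom_boundary 1 (skel_space X 1) (topspace (skel_space X 0)) (cell_class X \<sigma>)"
  have c\<sigma>: "cell_class X \<sigma> \<in> carrier (relative_homology_group 1 (skel_space X 1) (topspace (skel_space X 0)))"
    using cell_class_carrier[OF \<sigma>] by (simp add: cellular_group_def)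
  have incl: "continuous_map (skel_space X 0) (skel_space X 1) id"
    by (metis continuous_map_from_subtopology continuous_map_id subtopology_skel zero_le_one)
  have \<delta>: "?\<delta> \<in> carrier (homology_group 0 (skel_space X 0))"
    using hom_boundary_carrier[of 1 "skel_space X 1" "topspace (skel_space X 0)"] by (simp add: subtopology_skel)
  have "?\<delta> \<in> kernel (homology_group 0 (skel_space X 0)) (homology_group 0 (skel_space X 1)) ?i"
    using homology_exactness_axiom_2[of 1 "skel_space X 1" "topspace (skel_space X 0)"] c\<sigma>
    by (simp add: subtopology_skel)
  then have i1: "?i ?\<delta> = \<one>\<^bsub>homology_group 0 (skel_space X 1)\<^esub>" by (simp add: kernel_def)
  have "cellular_boundary 1 X (cell_class X \<sigma>) = ?\<delta>"
    using hom_induced_id[OF \<delta>] by (simp add: cellular_boundary_eq top)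
  moreover have "?e ?\<delta> = hom_induced 0 (skel_space X 1) {} ?P {} (\<lambda>_. ()) (?i ?\<delta>)"
    using incl by (subst hom_induced_compose') (auto simp: o_def)
  ultimately have e1: "?e (cellular_boundary 1 X (cell_class X \<sigma>)) = \<one>\<^bsub>?H\<^esub>"
    unfolding i1 using hom_one[OF hom_induced_hom] by (metis group_relative_homology_group)
  have ec: "?e (cell_class X \<tau>) = ?g" if "\<tau> \<in> ?C" for \<tau>
  proof -
    have d: "cw_celldim X \<tau> = 0" using that by (simp add: cells_of_dim_def)
    have "continuous_map (ndisk 0) (skel_space X 0) (cw_char X \<tau>)"
      using char_into_cell_union(1)[of \<tau> 0 "cells_upto X (-1)" "cells_upto X 0"] that
      by (auto simp: skel_space_eq cells_upto_def cells_of_dim_def)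
    then show ?thesis
      unfolding cell_class_def by (simp add: Let_def d S0 top) (subst hom_induced_compose', auto simp: o_def)
  qed
  have "\<one>\<^bsub>?H\<^esub> = ?e (finprod (cellular_group 0 X) (\<lambda>\<tau>. cell_class X \<tau> [^]\<^bsub>cellular_group 0 X\<^esub> incidence X \<tau> \<sigma>) ?C)"
    using incidence_expansion[of \<sigma> 0] \<sigma> e1 by simp
  also have "\<dots> = finprod ?H (\<lambda>\<tau>. ?e (cell_class X \<tau>) [^]\<^bsub>?H\<^esub> incidence X \<tau> \<sigma>) ?C"
    by (rule hom_finprod_int_pow)
       (use cell_class_carrier[of _ 0] finite_cells_of_dim hom_induced_hom G0 in auto)
  also have "\<dots> = finprod ?H (\<lambda>\<tau>. ?g [^]\<^bsub>?H\<^esub> incidence X \<tau> \<sigma>) ?C"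
    by (rule H.finprod_cong') (auto simp: ec hom_induced_carrier)
  also have "\<dots> = ?g [^]\<^bsub>?H\<^esub> (\<Sum>\<tau>\<in>?C. incidence X \<tau> \<sigma>)"
    by (rule finprod_int_pow_sum) (auto simp: hom_induced_carrier finite_cells_of_dim)
  finally have pow: "\<one>\<^bsub>?H\<^esub> = \<dots>" .
  let ?D = "homology_group 0 (ndisk 0)"
  let ?f = "hom_induced 0 (ndisk 0) {} ?P {} (\<lambda>_. ())"
  have "?f \<in> iso ?D ?H"
  proof -
    have "topspace (ndisk 0) = {\<lambda>i. 0}" by (auto simp: topspace_ndisk)
    then have "homeomorphic_maps (ndisk 0) ?P (\<lambda>_. ()) (\<lambda>_ i. 0)"
      by (auto simp: homeomorphic_maps_def)
    then show ?thesis using homeomorphic_map_homology_iso homeomorphic_map_maps by blast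
  qed
  then have inj: "inj_on ?f (carrier ?D)" by (simp add: iso_iff)
  interpret f: group_hom ?D ?H ?f
    by (simp add: group_hom_def group_hom_axioms_def hom_induced_hom)
  have dc: "disk_class 0 \<in> carrier ?D" using disk_class_in_carrier[of 0] by (simp add: S0)
  have "?f (disk_class 0 [^]\<^bsub>?D\<^esub> (\<Sum>\<tau>\<in>?C. incidence X \<tau> \<sigma>)) = ?f \<one>\<^bsub>?D\<^esub>"
    using pow f.hom_int_pow[OF dc] f.hom_one by simp
  then have "disk_class 0 [^]\<^bsub>?D\<^esub> (\<Sum>\<tau>\<in>?C. incidence X \<tau> \<sigma>) = \<one>\<^bsub>?D\<^esub>"
    using inj dc f.G.int_pow_closed f.G.one_closed by (metis inj_onD)
  then show ?thesis using disk_class_infinite_order[of 0] by (simp add: S0)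
qed

end

section \<open>Subcomplexes\<close>

lemma cw_restrict_simps [simp]:
  "cw_cells (cw_restrict X S) = S" "cw_celldim (cw_restrict X S) = cw_celldim X"
  "cw_char (cw_restrict X S) = cw_char X" "open_cell (cw_restrict X S) = open_cell X"
  "cell_union (cw_restrict X S) = cell_union X"
  "cw_space (cw_restrict X S) = subtopology (cw_space X) (cell_union X S)"
  by (auto simp: cw_restrict_def open_cell_def cell_union_def fun_eq_iff)

lemma cells_of_dim_restrict: "S \<subseteq> cw_cells X \<Longrightarrow> cells_of_dim (cw_restrict X S) i = cells_of_dim X i \<inter> S"
  and cells_upto_restrict: "S \<subseteq> cw_cells X \<Longrightarrow> cells_upto (cw_restrict X S) i = cells_upto X i \<inter> S"
  by (auto simp: cells_of_dim_def cells_upto_def)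

lemma skel_space_restrict:
  "S \<subseteq> cw_cells X \<Longrightarrow> skel_space (cw_restrict X S) i = subtopology (cw_space X) (cell_union X (cells_upto X i \<inter> S))"
  by (simp add: skel_space_eq cells_upto_restrict subtopology_subtopology Int_absorb1 cell_union_mono)

context finite_cw
begin

text \<open>Passing to a subcomplex that contains the skeleton below a cell does not change the boundary
  of that cell, by naturality of the connecting homomorphism.\<close>

lemma incidence_restrict:
  assumes S: "S \<subseteq> cw_cells X" "cells_upto X (int n) \<subseteq> S" and \<sigma>: "\<sigma> \<in> S" "cw_celldim X \<sigma> = Suc n"
  shows "incidence (cw_restrict X S) \<rho> \<sigma> = incidence X \<rho> \<sigma>"
proof -
  let ?Y = "cw_restrict X S"
  have low: "skel_space ?Y j = skel_space X j" if "j \<le> int n" for j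
  proof -
    have "cells_upto X j \<inter> S = cells_upto X j" using that S by (auto simp: cells_upto_def)
    then show ?thesis using skel_space_restrict[OF S(1)] skel_space_eq[of X j] by simp
  qed
  have cells: "cells_of_dim ?Y (int n) = cells_of_dim X (int n)"
    using S by (auto simp: cells_of_dim_restrict cells_of_dim_def cells_upto_def)
  have cls: "cell_class ?Y \<tau> = cell_class X \<tau>" if "\<tau> \<in> cells_of_dim X (int n)" for \<tau>
    using that by (auto simp: cell_class_def Let_def low cells_of_dim_def)
  have grp: "cellular_group (int n) ?Y = cellular_group (int n) X"
    by (simp add: cellular_group_def low)
  define k where "k = int (Suc n)"
  have k: "k - 1 = int n" "k - 2 = int n - 1" by (simp_all add: k_def)
  let ?A = "topspace (skel_space X (int n))"
  let ?h = "hom_induced k (skel_space ?Y k) ?A (skel_space X k) ?A id"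
  have cont: "continuous_map (skel_space ?Y k) (skel_space X k) id"
    unfolding skel_space_restrict[OF S(1)] skel_space_eq[of X k]
    using cell_union_mono[of "cells_upto X k \<inter> S" "cells_upto X k" X]
    by (auto simp: continuous_map_in_subtopology continuous_map_from_subtopology)
  have sub: "subtopology (skel_space ?Y k) ?A = skel_space X (int n)"
  proof -
    have "cells_upto X (int n) \<subseteq> cells_upto X k \<inter> S" using S by (auto simp: cells_upto_def k_def)
    then show ?thesis
      unfolding skel_space_restrict[OF S(1)] topspace_skel
      by (simp add: subtopology_subtopology skel_space_eq Int_absorb1 cell_union_mono)
  qed
  have subX: "subtopology (skel_space X k) ?A = skel_space X (int n)"
    by (simp add: subtopology_skel k_def)
  have \<sigma>X: "\<sigma> \<in> cells_of_dim X (int (Suc n))" using \<sigma> S by (auto simp: cells_of_dim_def)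
  have "cell_class X \<sigma> = ?h (cell_class ?Y \<sigma>)"
  proof -
    have "cells_upto X (int (Suc n) - 1) \<subseteq> cells_upto X (int n)" 
      "cells_upto X (int n) \<subseteq> cells_upto X k \<inter> S" "\<sigma> \<in> cells_upto X k \<inter> S"
      using S \<sigma> by (auto simp: cells_upto_def k_def)
    from char_into_cell_union[OF \<sigma>X this]
    have ch: "continuous_map (ndisk (Suc n)) (skel_space ?Y k) (cw_char X \<sigma>)"
      "cw_char X \<sigma> ` ndisk_sphere (Suc n) \<subseteq> ?A"
      unfolding skel_space_restrict[OF S(1)] topspace_skel .
    have "cell_class ?Y \<sigma> = hom_induced k (ndisk (Suc n)) (ndisk_sphere (Suc n)) (skel_space ?Y k) ?A
        (cw_char X \<sigma>) (disk_class (Suc n))"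
      by (simp only: cell_class_def Let_def cw_restrict_simps \<sigma>(2) k_def[symmetric] k low order_refl)
    moreover have "cell_class X \<sigma> = hom_induced k (ndisk (Suc n)) (ndisk_sphere (Suc n)) (skel_space X k) ?A
        (cw_char X \<sigma>) (disk_class (Suc n))"
      by (simp only: cell_class_def Let_def \<sigma>(2) k_def[symmetric] k)
    ultimately show ?thesis
      using ch cont by (simp only:) (subst hom_induced_compose', auto)
  qed
  then have "hom_boundary k (skel_space X k) ?A (cell_class X \<sigma>)
      = (hom_boundary k (skel_space X k) ?A \<circ> ?h) (cell_class ?Y \<sigma>)" by simp
  also have "\<dots> = hom_induced (int n) (skel_space X (int n)) {} (skel_space X (int n)) {} id
     (hom_boundary k (skel_space ?Y k) ?A (cell_class ?Y \<sigma>))"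
    by (subst naturality_hom_induced[OF cont]) (simp_all add: sub subX k)
  also have "\<dots> = hom_boundary k (skel_space ?Y k) ?A (cell_class ?Y \<sigma>)"
    using hom_boundary_carrier[of k "skel_space ?Y k" ?A] by (intro hom_induced_id) (simp add: sub k)
  finally have bd: "cellular_boundary k ?Y (cell_class ?Y \<sigma>) = cellular_boundary k X (cell_class X \<sigma>)"
    by (simp add: cellular_boundary_def k low sub subX)
  interpret H: comm_group "cellular_group (int n) X" by simp
  have "finprod (cellular_group (int n) X) (\<lambda>\<tau>. cell_class ?Y \<tau> [^]\<^bsub>cellular_group (int n) X\<^esub> m \<tau>) (cells_of_dim X (int n))
    = finprod (cellular_group (int n) X) (\<lambda>\<tau>. cell_class X \<tau> [^]\<^bsub>cellular_group (int n) X\<^esub> m \<tau>) (cells_of_dim X (int n))" 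
    for m :: "'c \<Rightarrow> int"
    by (rule H.finprod_cong') (auto simp: cls cell_class_carrier)
  then show ?thesis
    by (simp only: incidence_def Let_def cw_restrict_simps \<sigma>(2) k_def[symmetric] k cells grp bd)
qed

end

section \<open>Indices of subgroups\<close>

text \<open>Chain groups are additive groups of finitely supported functions, and the lattices in them are
  plain sets. Working with subsets of a type with addition avoids carriers and quotient
  structures; \<open>add_index\<close> is meaningful when \<open>finite_index\<close> holds and is 0 otherwise.\<close>

definition add_subgroup :: "'x::ab_group_add set \<Rightarrow> bool" where
  "add_subgroup H \<longleftrightarrow> 0 \<in> H \<and> (\<forall>x\<in>H. \<forall>y\<in>H. x - y \<in> H)"

definition add_coset :: "'x::ab_group_add set \<Rightarrow> 'x \<Rightarrow> 'x set" where
  "add_coset K x = (+) x ` K"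

definition add_index :: "'x::ab_group_add set \<Rightarrow> 'x set \<Rightarrow> nat" where
  "add_index H K = card (add_coset K ` H)"

definition finite_index :: "'x::ab_group_add set \<Rightarrow> 'x set \<Rightarrow> bool" where
  "finite_index H K \<longleftrightarrow> finite (add_coset K ` H)"

lemma add_subgroupD:
  assumes "add_subgroup H"
  shows "0 \<in> H" and "x \<in> H \<Longrightarrow> y \<in> H \<Longrightarrow> x - y \<in> H" and "x \<in> H \<Longrightarrow> - x \<in> H"
    and "x \<in> H \<Longrightarrow> y \<in> H \<Longrightarrow> x + y \<in> H"
proof -
  show z: "0 \<in> H" and d: "x \<in> H \<Longrightarrow> y \<in> H \<Longrightarrow> x - y \<in> H" for x y
    using assms by (auto simp: add_subgroup_def)
  show m: "x \<in> H \<Longrightarrow> - x \<in> H" for x using z d[of 0 x] by simp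
  show "x \<in> H \<Longrightarrow> y \<in> H \<Longrightarrow> x + y \<in> H" using d[of x "- y"] m[of y] by simp
qed

lemma mem_add_coset: "y \<in> add_coset K x \<longleftrightarrow> y - x \<in> K"
proof
  assume "y - x \<in> K"
  then show "y \<in> add_coset K x" unfolding add_coset_def by (rule rev_image_eqI) simp
qed (auto simp: add_coset_def)

lemma add_coset_eq_iff:
  assumes "add_subgroup K"
  shows "add_coset K x = add_coset K y \<longleftrightarrow> x - y \<in> K"
proof
  assume "add_coset K x = add_coset K y"
  moreover have "x \<in> add_coset K x" using add_subgroupD(1)[OF assms] by (simp add: mem_add_coset)
  ultimately show "x - y \<in> K" by (simp add: mem_add_coset)
next
  assume xy: "x - y \<in> K"
  have "z - x \<in> K \<longleftrightarrow> z - y \<in> K" for z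
    using add_subgroupD(2)[OF assms, of "z - y" "x - y"] add_subgroupD(4)[OF assms, of "z - x" "x - y"] xy by auto
  then show "add_coset K x = add_coset K y" by (auto simp: mem_add_coset)
qed

text \<open>The index only depends on which differences of elements lie in the subgroup.\<close>

lemma index_transfer:
  assumes "add_subgroup K" "add_subgroup K'"
    and onto: "\<And>y. y \<in> H' \<Longrightarrow> \<exists>x\<in>H. y - f x \<in> K'"
    and into: "\<And>x. x \<in> H \<Longrightarrow> f x \<in> H'"
    and iff: "\<And>x y. x \<in> H \<Longrightarrow> y \<in> H \<Longrightarrow> f x - f y \<in> K' \<longleftrightarrow> x - y \<in> K"
  shows "add_index H' K' = add_index H K" and "finite_index H' K' \<longleftrightarrow> finite_index H K"
proof -
  define F where "F = (\<lambda>C. add_coset K' (f (SOME x. x \<in> H \<and> C = add_coset K x)))"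
  have F: "F (add_coset K x) = add_coset K' (f x)" if "x \<in> H" for x
  proof -
    let ?y = "SOME y. y \<in> H \<and> add_coset K x = add_coset K y"
    have "?y \<in> H \<and> add_coset K x = add_coset K ?y" using that by (intro someI) auto
    then have y: "?y \<in> H" "x - ?y \<in> K" using add_coset_eq_iff[OF assms(1)] by auto
    then have "f x - f ?y \<in> K'" using iff that by blast
    then have "add_coset K' (f x) = add_coset K' (f ?y)" using add_coset_eq_iff[OF assms(2)] by blast
    then show ?thesis by (simp add: F_def)
  qed
  have "bij_betw F (add_coset K ` H) (add_coset K' ` H')"
    unfolding bij_betw_def
  proof
    show "inj_on F (add_coset K ` H)"
      using F iff add_coset_eq_iff[OF assms(1)] add_coset_eq_iff[OF assms(2)] by (auto simp: inj_on_def)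
    show "F ` add_coset K ` H = add_coset K' ` H'"
    proof
      show "F ` add_coset K ` H \<subseteq> add_coset K' ` H'" using F into by auto
      show "add_coset K' ` H' \<subseteq> F ` add_coset K ` H"
      proof
        fix C assume "C \<in> add_coset K' ` H'"
        then obtain y where y: "y \<in> H'" "C = add_coset K' y" by blast
        obtain x where "x \<in> H" "y - f x \<in> K'" using onto y by blast
        then have "C = F (add_coset K x)" using y F add_coset_eq_iff[OF assms(2)] by simp
        then show "C \<in> F ` add_coset K ` H" using \<open>x \<in> H\<close> by blast
      qed
    qed
  qed
  then show "add_index H' K' = add_index H K" "finite_index H' K' \<longleftrightarrow> finite_index H K"
    using bij_betw_same_card bij_betw_finite by (fastforce simp: add_index_def finite_index_def)+
qed

lemma index_image:
  assumes "add_subgroup K" "add_subgroup (f ` K)" "\<And>x y. f (x - y) = f x - f y"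
    and "\<And>x. x \<in> H \<Longrightarrow> f x \<in> f ` K \<Longrightarrow> x \<in> K" and "add_subgroup H" and "K \<subseteq> H"
  shows "add_index (f ` H) (f ` K) = add_index H K" and "finite_index (f ` H) (f ` K) \<longleftrightarrow> finite_index H K"
proof -
  have iff: "f x - f y \<in> f ` K \<longleftrightarrow> x - y \<in> K" if "x \<in> H" "y \<in> H" for x y
    using assms(3)[of x y, symmetric] assms(4)[of "x - y"] add_subgroupD(2)[OF assms(5) that] by auto
  have onto: "\<exists>x\<in>H. y - f x \<in> f ` K" if "y \<in> f ` H" for y
    using that add_subgroupD(1)[OF assms(2)] by force
  show "add_index (f ` H) (f ` K) = add_index H K" "finite_index (f ` H) (f ` K) \<longleftrightarrow> finite_index H K"
    by (rule index_transfer[OF assms(1,2) onto _ iff]; blast)+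
qed

text \<open>This is the second isomorphism theorem: the first hypothesis on \<open>G\<close> says that \<open>G\<close> lies in the
  sum of \<open>H\<close> and \<open>K\<close>.\<close>

lemma index_Int:
  assumes "add_subgroup H" "add_subgroup K" "\<And>x. x \<in> G \<Longrightarrow> \<exists>h\<in>H. x - h \<in> K" "H \<subseteq> G"
  shows "add_index G K = add_index H (H \<inter> K)" and "finite_index G K \<longleftrightarrow> finite_index H (H \<inter> K)"
proof -
  have HK: "add_subgroup (H \<inter> K)" using assms(1,2) by (auto simp: add_subgroup_def)
  have iff: "x - y \<in> K \<longleftrightarrow> x - y \<in> H \<inter> K" if "x \<in> H" "y \<in> H" for x y
    using that add_subgroupD(2)[OF assms(1)] by blast
  show "add_index G K = add_index H (H \<inter> K)" "finite_index G K \<longleftrightarrow> finite_index H (H \<inter> K)"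
    by (rule index_transfer[OF HK assms(2), where f = "\<lambda>x. x"]; use assms iff in blast)+
qed

text \<open>Choosing a representative \<open>r C\<close> in each coset \<open>C\<close> of \<open>H\<close>, the cosets of \<open>K\<close> in \<open>G\<close> are the
  translates by some \<open>r C\<close> of the cosets of \<open>K\<close> in \<open>H\<close>. Since this is a bijection, finiteness is
  inherited in both directions.\<close>

lemma index_tower:
  assumes "add_subgroup H" "add_subgroup K" "add_subgroup G" "K \<subseteq> H" "H \<subseteq> G"
  shows "add_index G K = add_index G H * add_index H K"
    and "finite_index G K \<longleftrightarrow> finite_index G H \<and> finite_index H K"
proof -
  define r where "r = (\<lambda>C. SOME x. x \<in> G \<and> C = add_coset H x)"
  have r: "r (add_coset H x) \<in> G" "x - r (add_coset H x) \<in> H" if "x \<in> G" for x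
  proof -
    have "r (add_coset H x) \<in> G \<and> add_coset H x = add_coset H (r (add_coset H x))"
      unfolding r_def by (rule someI[where x = x]) (use that in auto)
    then show "r (add_coset H x) \<in> G" "x - r (add_coset H x) \<in> H"
      using add_coset_eq_iff[OF assms(1)] by auto
  qed
  let ?F = "\<lambda>(C, D). (+) (r C) ` D"
  have F: "?F (add_coset H x, add_coset K y) = add_coset K (r (add_coset H x) + y)" for x y
    by (auto simp: add_coset_def image_image add.assoc)
  have "bij_betw ?F (add_coset H ` G \<times> add_coset K ` H) (add_coset K ` G)"
    unfolding bij_betw_def
  proof
    show "inj_on ?F (add_coset H ` G \<times> add_coset K ` H)"
    proof (rule inj_onI)
      fix p q assume "p \<in> add_coset H ` G \<times> add_coset K ` H" "q \<in> add_coset H ` G \<times> add_coset K ` H"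
        and eq: "?F p = ?F q"
      then obtain x y x' y' where pq: "p = (add_coset H x, add_coset K y)" "q = (add_coset H x', add_coset K y')"
        and m: "x \<in> G" "x' \<in> G" "y \<in> H" "y' \<in> H" by auto
      let ?r = "r (add_coset H x)" and ?r' = "r (add_coset H x')"
      have k: "(?r + y) - (?r' + y') \<in> K"
        using eq unfolding pq F by (simp add: add_coset_eq_iff[OF assms(2)])
      have "x - x' = (x - ?r) - (x' - ?r') + (((?r + y) - (?r' + y')) - (y - y'))" by simp
      also have "\<dots> \<in> H"
        by (rule add_subgroupD(4)[OF assms(1)]; rule add_subgroupD(2)[OF assms(1)])
           (use r(2)[OF m(1)] r(2)[OF m(2)] add_subgroupD(2)[OF assms(1) m(3,4)] subsetD[OF assms(4) k] in blast)+
      finally have hx: "add_coset H x = add_coset H x'" using add_coset_eq_iff[OF assms(1)] by blast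
      from hx k have "y - y' \<in> K" by simp
      then have "add_coset K y = add_coset K y'" using add_coset_eq_iff[OF assms(2)] by blast
      then show "p = q" using hx by (simp add: pq)
    qed
    show "?F ` (add_coset H ` G \<times> add_coset K ` H) = add_coset K ` G"
    proof
      show "?F ` (add_coset H ` G \<times> add_coset K ` H) \<subseteq> add_coset K ` G"
      proof
        fix C assume "C \<in> ?F ` (add_coset H ` G \<times> add_coset K ` H)"
        then obtain x y where "x \<in> G" "y \<in> H" "C = add_coset K (r (add_coset H x) + y)" using F by auto
        then show "C \<in> add_coset K ` G" using r assms(5) add_subgroupD(4)[OF assms(3)] by blast
      qed
      show "add_coset K ` G \<subseteq> ?F ` (add_coset H ` G \<times> add_coset K ` H)"
      proof
        fix C assume "C \<in> add_coset K ` G"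
        then obtain x where x: "x \<in> G" "C = add_coset K x" by blast
        then have "C = ?F (add_coset H x, add_coset K (x - r (add_coset H x)))" unfolding F by simp
        then show "C \<in> ?F ` (add_coset H ` G \<times> add_coset K ` H)" using x r by blast
      qed
    qed
  qed
  then have "card (add_coset K ` G) = card (add_coset H ` G \<times> add_coset K ` H)"
    "finite (add_coset K ` G) \<longleftrightarrow> finite (add_coset H ` G \<times> add_coset K ` H)"
    using bij_betw_same_card bij_betw_finite by metis+
  moreover have "G \<noteq> {}" "H \<noteq> {}" using add_subgroupD(1) assms by blast+
  ultimately show "add_index G K = add_index G H * add_index H K"
    "finite_index G K \<longleftrightarrow> finite_index G H \<and> finite_index H K"
    by (auto simp: add_index_def finite_index_def card_cartesian_product finite_cartesian_product_iff)
qed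

lemma index_self: "add_subgroup H \<Longrightarrow> add_index H H = 1" "add_subgroup H \<Longrightarrow> finite_index H H"
proof -
  assume H: "add_subgroup H"
  have "add_coset H ` H = {add_coset H 0}"
    using add_coset_eq_iff[OF H, of _ 0] add_subgroupD(1)[OF H] by auto
  then show "add_index H H = 1" "finite_index H H" by (simp_all add: add_index_def finite_index_def)
qed

lemma add_index_pos: "finite_index H K \<Longrightarrow> H \<noteq> {} \<Longrightarrow> add_index H K > 0"
  by (auto simp: add_index_def finite_index_def card_gt_0_iff)

lemma add_subgroup_image:
  "add_subgroup H \<Longrightarrow> (\<And>x y. f (x - y) = f x - f y) \<Longrightarrow> add_subgroup (f ` H)"
proof -
  assume H: "add_subgroup H" and f: "\<And>x y. f (x - y) = f x - f y"
  have "f 0 = 0" using f[of 0 0] by simp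
  then have "0 \<in> f ` H" using add_subgroupD(1)[OF H] by (metis imageI)
  moreover have "f x - f y \<in> f ` H" if "x \<in> H" "y \<in> H" for x y
    using add_subgroupD(2)[OF H that] f[of x y] by (metis imageI)
  ultimately show ?thesis by (auto simp: add_subgroup_def)
qed

lemma index_int_multiples:
  assumes "g \<noteq> 0"
  shows "add_index UNIV (range ((*) g)) = nat \<bar>g\<bar>" and "finite_index UNIV (range ((*) (g::int)))"
proof -
  let ?K = "range ((*) g)"
  have K: "add_subgroup ?K"
    unfolding add_subgroup_def by (auto simp: image_iff simp flip: right_diff_distrib)
  have iff: "add_coset ?K x = add_coset ?K y \<longleftrightarrow> x mod \<bar>g\<bar> = y mod \<bar>g\<bar>" for x y
  proof -
    have "x - y \<in> ?K \<longleftrightarrow> g dvd x - y" by (auto simp: dvd_def)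
    then show ?thesis by (simp add: add_coset_eq_iff[OF K] mod_eq_dvd_iff)
  qed
  have "add_coset ?K ` UNIV = add_coset ?K ` {0..<\<bar>g\<bar>}"
  proof
    show "add_coset ?K ` UNIV \<subseteq> add_coset ?K ` {0..<\<bar>g\<bar>}"
    proof
      fix C assume "C \<in> add_coset ?K ` UNIV"
      then obtain x where "C = add_coset ?K x" by blast
      then have "C = add_coset ?K (x mod \<bar>g\<bar>)" using iff[of x "x mod \<bar>g\<bar>"] by simp
      moreover have "x mod \<bar>g\<bar> \<in> {0..<\<bar>g\<bar>}" using assms by simp
      ultimately show "C \<in> add_coset ?K ` {0..<\<bar>g\<bar>}" by blast
    qed
  qed auto
  moreover have "inj_on (add_coset ?K) {0..<\<bar>g\<bar>}"
    by (rule inj_onI) (simp add: iff)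
  ultimately show "add_index UNIV ?K = nat \<bar>g\<bar>" "finite_index UNIV ?K"
    by (simp_all add: add_index_def finite_index_def card_image)
qed

section \<open>Determinants indexed by finite sets\<close>

text \<open>The Leibniz formula over the permutations of an index set. No enumeration is chosen, which is
  convenient for minors, whose index sets vary.\<close>

definition set_det :: "'i set \<Rightarrow> ('i \<Rightarrow> 'i \<Rightarrow> 'e::comm_ring_1) \<Rightarrow> 'e" where
  "set_det W M = (\<Sum>p | p permutes W. of_int (sign p) * (\<Prod>i\<in>W. M i (p i)))"

lemma set_det_cong: "(\<And>i j. i \<in> W \<Longrightarrow> j \<in> W \<Longrightarrow> M i j = N i j) \<Longrightarrow> set_det W M = set_det W N"
  unfolding set_det_def by (intro sum.cong refl arg_cong2[of _ _ _ _ "(*)"] prod.cong) (auto simp: permutes_in_image)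

lemma set_det_empty [simp]: "set_det {} M = 1"
  by (simp add: set_det_def)

lemma set_det_reindex:
  assumes f: "bij_betw f V W" and "finite V"
  shows "set_det V (\<lambda>i j. M (f i) (f j)) = set_det W M"
proof -
  have inj: "inj_on f V" and fV: "f ` V = W" using f by (auto simp: bij_betw_def)
  have bij: "bij_betw (map_permutation V f) {p. p permutes V} {p. p permutes W}"
  proof (rule bij_betw_byWitness[where f' = "map_permutation W (inv_into V f)"])
    show "\<forall>p\<in>{p. p permutes V}. map_permutation W (inv_into V f) (map_permutation V f p) = p"
      using f by (auto intro!: map_permutation_compose_inv inv_into_f_f simp: inj)
    have f': "bij_betw (inv_into V f) W V" using f by (rule bij_betw_inv_into)
    show "\<forall>p\<in>{p. p permutes W}. map_permutation V f (map_permutation W (inv_into V f) p) = p"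
    proof
      fix p assume "p \<in> {p. p permutes W}"
      then show "map_permutation V f (map_permutation W (inv_into V f) p) = p"
        using fV by (intro map_permutation_compose_inv[OF f']) (auto intro: f_inv_into_f)
    qed
    show "map_permutation V f ` {p. p permutes V} \<subseteq> {p. p permutes W}"
      using map_permutation_permutes[OF f] by auto
    show "map_permutation W (inv_into V f) ` {p. p permutes W} \<subseteq> {p. p permutes V}"
      using map_permutation_permutes[OF f'] by auto
  qed
  have "set_det W M = (\<Sum>p | p permutes V. of_int (sign (map_permutation V f p)) * (\<Prod>i\<in>W. M i (map_permutation V f p i)))"
    unfolding set_det_def by (rule sum.reindex_bij_betw[OF bij, symmetric])
  also have "\<dots> = set_det V (\<lambda>i j. M (f i) (f j))"
    unfolding set_det_def
  proof (rule sum.cong)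
    fix p assume "p \<in> {p. p permutes V}"
    then have p: "p permutes V" by simp
    have "(\<Prod>i\<in>W. M i (map_permutation V f p i)) = (\<Prod>i\<in>V. M (f i) (map_permutation V f p (f i)))"
      by (rule prod.reindex_bij_betw[OF f, symmetric])
    also have "\<dots> = (\<Prod>i\<in>V. M (f i) (f (p i)))"
      by (rule prod.cong) (auto simp: map_permutation_apply inj)
    finally show "of_int (sign (map_permutation V f p)) * (\<Prod>i\<in>W. M i (map_permutation V f p i))
        = of_int (sign p) * (\<Prod>i\<in>V. M (f i) (f (p i)))"
      using sign_map_permutation[OF inj p] assms(2) by simp
  qed simp
  finally show ?thesis ..
qed

lemma det_mat_eq_set_det:
  "Determinant.det (Matrix.mat n n (\<lambda>(i, j). M i j)) = set_det {0..<n} M"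
proof -
  have "Determinant.det (Matrix.mat n n (\<lambda>(i, j). M i j))
     = (\<Sum>p | p permutes {0..<n}. signof p * (\<Prod>i = 0..<n. M i (p i)))"
    by (subst det_def'[of _ n]) (auto intro!: sum.cong prod.cong simp: permutes_in_image)
  then show ?thesis by (simp add: set_det_def)
qed

lemma det_indexed_mat:
  assumes "finite A"
  shows "Determinant.det (indexed_mat A M) = set_det A M"
proof -
  define xs where "xs = (SOME xs. distinct xs \<and> set xs = A)"
  have "distinct xs \<and> set xs = A" 
    unfolding xs_def by (rule someI_ex) (use finite_distinct_list[OF assms] in blast)
  then have "bij_betw ((!) xs) {0..<length xs} A" by (auto intro: bij_betw_nth)
  then show ?thesis
    using set_det_reindex[of "(!) xs" "{0..<length xs}" A M]
    by (simp add: indexed_mat_def Let_def det_mat_eq_set_det flip: xs_def)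
qed

lemma set_det_transpose:
  assumes "finite W"
  shows "set_det W (\<lambda>i j. M j i) = set_det W M"
proof -
  have "set_det W (\<lambda>i j. M j i) = (\<Sum>p | p permutes W. of_int (sign (inv_into UNIV p)) * (\<Prod>i\<in>W. M (inv_into UNIV p i) i))"
    unfolding set_det_def by (rule sum_permutations_inverse)
  also have "\<dots> = set_det W M"
    unfolding set_det_def
  proof (rule sum.cong)
    fix p assume "p \<in> {p. p permutes W}"
    then have p: "p permutes W" by simp
    have "(\<Prod>i\<in>W. M (inv_into UNIV p i) i) = (\<Prod>i\<in>W. M (inv_into UNIV p (p i)) (p i))"
      by (rule prod.permute[OF p, unfolded o_def])
    also have "\<dots> = (\<Prod>i\<in>W. M i (p i))" using p by (simp add: permutes_inverses)
    finally show "of_int (sign (inv_into UNIV p)) * (\<Prod>i\<in>W. M (inv_into UNIV p i) i) = of_int (sign p) * (\<Prod>i\<in>W. M i (p i))"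
      using p assms by (simp add: sign_inverse permutation_permutes) (metis permutation_permutes sign_inverse)
  qed simp
  finally show ?thesis .
qed

lemma set_det_permute_rows:
  assumes "finite W" and q: "q permutes W"
  shows "set_det W (\<lambda>i. M (q i)) = of_int (sign q) * set_det W M"
proof -
  have qi: "inv_into UNIV q permutes W" using q by (rule permutes_inv)
  have sg: "of_int (sign p) = (of_int (sign q) * of_int (sign (p \<circ> inv_into UNIV q)) :: 'b)" if "p permutes W" for p
  proof -
    have "sign (p \<circ> inv_into UNIV q) = sign p * sign q"
      using that q assms(1) by (metis permutation_permutes permutes_inv sign_compose sign_inverse)
    then show ?thesis by (simp add: mult.commute mult.left_commute flip: of_int_mult)
  qed
  have "set_det W (\<lambda>i. M (q i)) = (\<Sum>p | p permutes W. of_int (sign q) * (of_int (sign (p \<circ> inv_into UNIV q)) * (\<Prod>i\<in>W. M i ((p \<circ> inv_into UNIV q) i))))"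
    unfolding set_det_def
  proof (rule sum.cong)
    fix p assume "p \<in> {p. p permutes W}"
    then have p: "p permutes W" by simp
    have "(\<Prod>i\<in>W. M i ((p \<circ> inv_into UNIV q) i)) = (\<Prod>i\<in>W. M (q i) ((p \<circ> inv_into UNIV q) (q i)))"
      by (rule prod.permute[OF q, unfolded o_def]) 
    then have "(\<Prod>i\<in>W. M i ((p \<circ> inv_into UNIV q) i)) = (\<Prod>i\<in>W. M (q i) (p i))"
      using q by (simp add: permutes_inverses)
    then show "of_int (sign p) * (\<Prod>i\<in>W. M (q i) (p i))
       = of_int (sign q) * (of_int (sign (p \<circ> inv_into UNIV q)) * (\<Prod>i\<in>W. M i ((p \<circ> inv_into UNIV q) i)))"
      using sg[OF p] by (simp add: mult.assoc)
  qed simp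
  also have "\<dots> = (\<Sum>p | p permutes W. of_int (sign q) * (of_int (sign p) * (\<Prod>i\<in>W. M i (p i))))"
    by (rule sum_permutations_compose_right[OF qi, symmetric])
  finally show ?thesis by (simp add: set_det_def sum_distrib_left)
qed

lemma set_det_equal_rows:
  fixes M :: "'i \<Rightarrow> 'i \<Rightarrow> int"
  assumes "finite W" "a \<in> W" "b \<in> W" "a \<noteq> b" "M a = M b"
  shows "set_det W M = 0"
proof -
  have "set_det W (\<lambda>i. M (Transposition.transpose a b i)) = of_int (sign (Transposition.transpose a b)) * set_det W M"
    by (rule set_det_permute_rows) (use assms in \<open>auto intro: permutes_swap_id\<close>)
  moreover have "(\<lambda>i. M (Transposition.transpose a b i)) = M"
    using assms(5) by (auto simp: Transposition.transpose_def)
  ultimately show ?thesis using assms(4) by (simp add: sign_swap_id)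
qed

lemma set_det_row_expand:
  assumes "finite W" "a \<in> W"
  shows "set_det W M = (\<Sum>p | p permutes W. M a (p a) * (of_int (sign p) * (\<Prod>i\<in>W - {a}. M i (p i))))"
  unfolding set_det_def by (intro sum.cong refl) (simp add: prod.remove[OF assms] algebra_simps)

lemma set_det_row_op:
  fixes M :: "'i \<Rightarrow> 'i \<Rightarrow> int"
  assumes W: "finite W" "a \<in> W" "b \<in> W" "a \<noteq> b"
  shows "set_det W (M(a := \<lambda>j. M a j + c * M b j)) = set_det W M"
proof -
  have rest: "(\<Prod>i\<in>W - {a}. (M(a := v)) i (p i)) = (\<Prod>i\<in>W - {a}. M i (p i))" for v p
    by (rule prod.cong) auto
  have "set_det W (M(a := \<lambda>j. M a j + c * M b j)) = set_det W M + c * set_det W (M(a := M b))"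
    unfolding set_det_row_expand[OF W(1,2)] rest
    by (simp add: algebra_simps sum.distrib sum_distrib_left)
  also have "set_det W (M(a := M b)) = 0"
    using W by (intro set_det_equal_rows[of W a b]) auto
  finally show ?thesis by (simp only: mult_zero_right add_0_right)
qed

lemma set_det_zero_column:
  assumes "finite W" "w \<in> W" "\<And>i. i \<in> W \<Longrightarrow> M i w = 0"
  shows "set_det W M = 0"
  unfolding set_det_def
proof (rule sum.neutral, intro ballI)
  fix p assume "p \<in> {p. p permutes W}"
  then have p: "p permutes W" by simp
  then obtain i where "i \<in> W" "p i = w" using assms(2) by (metis permutes_def permutes_in_image)
  then have "(\<Prod>i\<in>W. M i (p i)) = 0" using assms by (metis prod_zero)
  then show "of_int (sign p) * (\<Prod>i\<in>W. M i (p i)) = 0" by simp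
qed

text \<open>Every permutation of \<open>insert w W\<close> that moves \<open>w\<close> picks some entry of column \<open>w\<close> in a row of \<open>W\<close>.\<close>

lemma set_det_corner:
  assumes W: "finite W" "w \<notin> W" and 0: "\<And>i. i \<in> W \<Longrightarrow> M i w = 0"
  shows "set_det (insert w W) M = M w w * set_det W M"
proof -
  have "set_det (insert w W) M = (\<Sum>p | p permutes W. of_int (sign p) * (\<Prod>i\<in>insert w W. M i (p i)))"
    unfolding set_det_def
  proof (rule sum.mono_neutral_right)
    show "finite {p. p permutes insert w W}" using W by (simp add: finite_permutations)
    show "{p. p permutes W} \<subseteq> {p. p permutes insert w W}" by (auto intro: permutes_subset)
    show "\<forall>p\<in>{p. p permutes insert w W} - {p. p permutes W}. of_int (sign p) * (\<Prod>i\<in>insert w W. M i (p i)) = 0"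
    proof
      fix p assume p: "p \<in> {p. p permutes insert w W} - {p. p permutes W}"
      then have pw: "p permutes insert w W" by simp
      have "p w \<noteq> w"
      proof
        assume "p w = w"
        then have "p permutes W" using pw permutes_superset[of p "insert w W" W] by auto
        then show False using p by blast
      qed
      obtain i where i: "i \<in> insert w W" "p i = w"
        using pw by (metis insertI1 permutes_def permutes_in_image)
      with \<open>p w \<noteq> w\<close> have "i \<in> W" by blast
      then have "M i (p i) = 0" using i 0 by simp
      then have "(\<Prod>i\<in>insert w W. M i (p i)) = 0" using i W by (intro prod_zero) auto
      then show "of_int (sign p) * (\<Prod>i\<in>insert w W. M i (p i)) = 0" by simp
    qed
  qed
  also have "\<dots> = M w w * set_det W M"
    unfolding set_det_def sum_distrib_left
    by (rule sum.cong) (use W in \<open>auto simp: permutes_not_in algebra_simps\<close>)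
  finally show ?thesis .
qed

text \<open>Multiplying out the product of each term of the Leibniz formula selects the set \<open>W\<close> of rows in
  which the entry of \<open>M\<close> is taken; only permutations that fix all other rows contribute.\<close>

lemma set_det_add_diagonal:
  assumes "finite N"
  shows "set_det N (\<lambda>i j. (if i = j then x else 0) + M i j) = (\<Sum>W\<in>Pow N. x ^ card (N - W) * set_det W M)"
proof -
  have "set_det N (\<lambda>i j. (if i = j then x else 0) + M i j)
     = (\<Sum>p | p permutes N. of_int (sign p) * (\<Sum>W\<in>Pow N. (\<Prod>i\<in>W. M i (p i)) * (\<Prod>i\<in>N - W. if i = p i then x else 0)))"
    unfolding set_det_def using prod_add[OF assms, of "\<lambda>i. M i (_ i)"] 
    by (intro sum.cong refl arg_cong2[of _ _ _ _ "(*)"]) (simp add: add.commute prod_add[OF assms])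
  also have "\<dots> = (\<Sum>W\<in>Pow N. \<Sum>p | p permutes N. of_int (sign p) * ((\<Prod>i\<in>W. M i (p i)) * (\<Prod>i\<in>N - W. if i = p i then x else 0)))"
    unfolding sum_distrib_left by (rule sum.swap)
  also have "\<dots> = (\<Sum>W\<in>Pow N. x ^ card (N - W) * set_det W M)"
  proof (rule sum.cong)
    fix W assume "W \<in> Pow N"
    then have W: "W \<subseteq> N" by simp
    have "(\<Sum>p | p permutes N. of_int (sign p) * ((\<Prod>i\<in>W. M i (p i)) * (\<Prod>i\<in>N - W. if i = p i then x else 0)))
      = (\<Sum>p | p permutes W. of_int (sign p) * ((\<Prod>i\<in>W. M i (p i)) * (\<Prod>i\<in>N - W. if i = p i then x else 0)))"
    proof (rule sum.mono_neutral_right)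
      show "finite {p. p permutes N}" using assms by (simp add: finite_permutations)
      show "{p. p permutes W} \<subseteq> {p. p permutes N}" using W by (auto intro: permutes_subset)
      show "\<forall>p\<in>{p. p permutes N} - {p. p permutes W}.
          of_int (sign p) * ((\<Prod>i\<in>W. M i (p i)) * (\<Prod>i\<in>N - W. if i = p i then x else 0)) = 0"
      proof
        fix p assume p: "p \<in> {p. p permutes N} - {p. p permutes W}"
        obtain i where i: "i \<in> N - W" "p i \<noteq> i"
        proof (rule ccontr)
          note that
          assume "\<not> thesis"
          then have "p permutes W" using p permutes_superset[of p N W] that by blast
          then show False using p by blast
        qed
        then have "(\<Prod>i\<in>N - W. if i = p i then x else 0) = 0"
          using assms i by (intro prod_zero bexI[of _ i]) auto
        then show "of_int (sign p) * ((\<Prod>i\<in>W. M i (p i)) * (\<Prod>i\<in>N - W. if i = p i then x else 0)) = 0" by simp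
      qed
    qed
    also have "\<dots> = x ^ card (N - W) * set_det W M"
      unfolding set_det_def sum_distrib_left
      by (rule sum.cong) (auto simp: permutes_not_in algebra_simps)
    finally show "(\<Sum>p | p permutes N. of_int (sign p) * ((\<Prod>i\<in>W. M i (p i)) * (\<Prod>i\<in>N - W. if i = p i then x else 0)))
       = x ^ card (N - W) * set_det W M" .
  qed simp
  finally show ?thesis .
qed


text \<open>The determinant is multilinear in the rows, and every row of the product is a combination of
  rows of \<open>B\<close>.\<close>

lemma set_det_sum_product:
  assumes "finite W" "finite Y"
  shows "set_det W (\<lambda>i j. \<Sum>y\<in>Y. A i y * B y j)
     = (\<Sum>f\<in>PiE W (\<lambda>_. Y). (\<Prod>i\<in>W. A i (f i)) * set_det W (\<lambda>i j. B (f i) j))"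
proof -
  have "set_det W (\<lambda>i j. \<Sum>y\<in>Y. A i y * B y j)
     = (\<Sum>p | p permutes W. of_int (sign p) * (\<Sum>f\<in>PiE W (\<lambda>_. Y). \<Prod>i\<in>W. A i (f i) * B (f i) (p i)))"
    unfolding set_det_def using assms by (simp add: prod_sum_PiE)
  also have "\<dots> = (\<Sum>f\<in>PiE W (\<lambda>_. Y). \<Sum>p | p permutes W. of_int (sign p) * (\<Prod>i\<in>W. A i (f i) * B (f i) (p i)))"
    unfolding sum_distrib_left by (rule sum.swap)
  also have "\<dots> = (\<Sum>f\<in>PiE W (\<lambda>_. Y). (\<Prod>i\<in>W. A i (f i)) * set_det W (\<lambda>i j. B (f i) j))"
    unfolding set_det_def by (simp add: prod.distrib sum_distrib_left algebra_simps)
  finally show ?thesis .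
qed

text \<open>In the expansion of \<open>set_det_sum_product\<close> a selection \<open>f\<close> that repeats a column gives a
  determinant with two equal rows. The injective selections with image \<open>S\<close> differ from the
  reference bijection \<open>e S\<close> by a permutation, and adding them up restores the other factor. The
  bijections make the minors square; the square of a minor does not depend on their choice.\<close>

theorem Cauchy_Binet_gram:
  fixes A :: "'i \<Rightarrow> 'j \<Rightarrow> int"
  assumes W: "finite W" and Y: "finite Y"
    and e: "\<And>S. S \<subseteq> Y \<Longrightarrow> card S = card W \<Longrightarrow> bij_betw (e S) W S"
  shows "set_det W (\<lambda>i j. \<Sum>y\<in>Y. A i y * A j y)
    = (\<Sum>S | S \<subseteq> Y \<and> card S = card W. (set_det W (\<lambda>i j. A j (e S i)))\<^sup>2)"
proof -
  let ?g = "\<lambda>f. (\<Prod>i\<in>W. A i (f i)) * set_det W (\<lambda>i j. A j (f i))"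
  let ?F = "{f \<in> PiE W (\<lambda>_. Y). inj_on f W}" and ?SS = "{S. S \<subseteq> Y \<and> card S = card W}"
  have "set_det W (\<lambda>i j. \<Sum>y\<in>Y. A i y * A j y) = (\<Sum>f\<in>PiE W (\<lambda>_. Y). ?g f)"
    by (rule set_det_sum_product[OF W Y])
  also have "\<dots> = (\<Sum>f\<in>?F. ?g f)"
  proof (rule sum.mono_neutral_right)
    show "\<forall>f\<in>PiE W (\<lambda>_. Y) - ?F. ?g f = 0"
    proof
      fix f assume "f \<in> PiE W (\<lambda>_. Y) - ?F"
      then obtain a b where "a \<in> W" "b \<in> W" "a \<noteq> b" "f a = f b" by (auto simp: inj_on_def)
      then have "set_det W (\<lambda>i j. A j (f i)) = 0"
        by (intro set_det_equal_rows[OF W, of a b]) auto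
      then show "?g f = 0" by simp
    qed
  qed (use W Y in \<open>auto intro: finite_PiE\<close>)
  also have "\<dots> = (\<Sum>S\<in>?SS. \<Sum>f\<in>{f \<in> ?F. f ` W = S}. ?g f)"
    by (rule sum.group[symmetric]) (use W Y in \<open>auto intro: finite_PiE rev_finite_subset[of "PiE W (\<lambda>_. Y)"] finite_subset[of _ "Pow Y"] simp: card_image\<close>)
  also have "\<dots> = (\<Sum>S\<in>?SS. (set_det W (\<lambda>i j. A j (e S i)))\<^sup>2)"
  proof (rule sum.cong)
    fix S assume "S \<in> ?SS"
    then have S: "S \<subseteq> Y" and eS: "bij_betw (e S) W S" using e by auto
    let ?D = "set_det W (\<lambda>i j. A j (e S i))"
    have "(\<Sum>f\<in>{f \<in> ?F. f ` W = S}. ?g f) = (\<Sum>q | q permutes W. ?g (restrict (e S \<circ> q) W))"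
    proof (rule sum.reindex_bij_betw[symmetric], rule bij_betw_byWitness[where f' = "\<lambda>f i. if i \<in> W then inv_into W (e S) (f i) else i"])
      show "\<forall>q\<in>{q. q permutes W}. (\<lambda>i. if i \<in> W then inv_into W (e S) (restrict (e S \<circ> q) W i) else i) = q"
        using eS by (auto simp: fun_eq_iff bij_betw_def permutes_in_image permutes_not_in)
      show "\<forall>f\<in>{f \<in> ?F. f ` W = S}. restrict (e S \<circ> (\<lambda>i. if i \<in> W then inv_into W (e S) (f i) else i)) W = f"
        using eS by (auto simp: fun_eq_iff bij_betw_def f_inv_into_f PiE_def extensional_def)
      show "(\<lambda>q. restrict (e S \<circ> q) W) ` {q. q permutes W} \<subseteq> {f \<in> ?F. f ` W = S}"
      proof
        fix f assume "f \<in> (\<lambda>q. restrict (e S \<circ> q) W) ` {q. q permutes W}"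
        then obtain q where q: "q permutes W" "f = restrict (e S \<circ> q) W" by blast
        have "bij_betw (e S \<circ> q) W S" using q eS by (meson bij_betw_trans permutes_imp_bij)
        then have "bij_betw f W S" using q(2) by (simp cong: bij_betw_cong)
        then show "f \<in> {f \<in> ?F. f ` W = S}" using S q(2) by (auto simp: bij_betw_def)
      qed
      show "(\<lambda>f i. if i \<in> W then inv_into W (e S) (f i) else i) ` {f \<in> ?F. f ` W = S} \<subseteq> {q. q permutes W}"
      proof
        fix p assume "p \<in> (\<lambda>f i. if i \<in> W then inv_into W (e S) (f i) else i) ` {f \<in> ?F. f ` W = S}"
        then obtain f where f: "inj_on f W" "f ` W = S" and p: "p = (\<lambda>i. if i \<in> W then inv_into W (e S) (f i) else i)" by blast
        have "bij_betw (inv_into W (e S) \<circ> f) W W"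
          using f bij_betw_inv_into[OF eS] by (intro bij_betw_trans[of f W S]) (auto simp: bij_betw_def)
        then have "bij_betw p W W" by (subst bij_betw_cong[of W p "inv_into W (e S) \<circ> f"]) (auto simp: p)
        then show "p \<in> {q. q permutes W}" by (auto intro: bij_imp_permutes simp: p)
      qed
    qed
    also have "\<dots> = (\<Sum>q | q permutes W. (\<Prod>i\<in>W. A i (e S (q i))) * (of_int (sign q) * ?D))"
    proof (rule sum.cong)
      fix q assume "q \<in> {q. q permutes W}"
      then have q: "q permutes W" by simp
      have "set_det W (\<lambda>i j. A j (restrict (e S \<circ> q) W i)) = set_det W (\<lambda>i. (\<lambda>i j. A j (e S i)) (q i))"
        by (rule set_det_cong) simp
      also have "\<dots> = of_int (sign q) * ?D" by (rule set_det_permute_rows[OF W q])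
      finally show "?g (restrict (e S \<circ> q) W) = (\<Prod>i\<in>W. A i (e S (q i))) * (of_int (sign q) * ?D)" by simp
    qed simp
    also have "\<dots> = set_det W (\<lambda>i j. A i (e S j)) * ?D"
      by (simp add: set_det_def sum_distrib_right algebra_simps)
    also have "\<dots> = ?D\<^sup>2"
      using set_det_transpose[OF W, of "\<lambda>i j. A j (e S i)"] by (simp add: power2_eq_square)
    finally show "(\<Sum>f\<in>{f \<in> ?F. f ` W = S}. ?g f) = ?D\<^sup>2" .
  qed simp
  finally show ?thesis .
qed

lemma set_det_zero_iff:
  fixes M :: "'i \<Rightarrow> 'i \<Rightarrow> int"
  assumes "finite W"
  shows "set_det W M = 0 \<longleftrightarrow> (\<exists>x. (\<exists>i\<in>W. x i \<noteq> 0) \<and> (\<forall>j\<in>W. (\<Sum>i\<in>W. x i * M i j) = 0))"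
proof -
  obtain xs where xs: "distinct xs" "set xs = W" using finite_distinct_list[OF assms] by blast
  define n where "n = length xs"
  have b: "bij_betw ((!) xs) {0..<n} W" using xs by (auto intro: bij_betw_nth simp: n_def)
  let ?A = "Matrix.mat n n (\<lambda>(j, i). M (xs ! i) (xs ! j))"
  have A: "?A \<in> carrier_mat n n" by simp
  have "set_det W M = set_det {0..<n} (\<lambda>i j. M (xs ! i) (xs ! j))"
    by (rule set_det_reindex[OF b, symmetric]) simp
  also have "\<dots> = Determinant.det ?A"
    by (simp add: det_mat_eq_set_det set_det_transpose[of "{0..<n}" "\<lambda>i j. M (xs ! i) (xs ! j)"])
  finally have "set_det W M = 0 \<longleftrightarrow> (\<exists>v. v \<in> carrier_vec n \<and> v \<noteq> 0\<^sub>v n \<and> ?A *\<^sub>v v = 0\<^sub>v n)"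
    using det_0_iff_vec_prod_zero[OF A] by simp
  also have "\<dots> \<longleftrightarrow> (\<exists>x. (\<exists>i\<in>W. x i \<noteq> 0) \<and> (\<forall>j\<in>W. (\<Sum>i\<in>W. x i * M i j) = 0))"
  proof
    assume "\<exists>v. v \<in> carrier_vec n \<and> v \<noteq> 0\<^sub>v n \<and> ?A *\<^sub>v v = 0\<^sub>v n"
    then obtain v where v: "v \<in> carrier_vec n" "v \<noteq> 0\<^sub>v n" "?A *\<^sub>v v = 0\<^sub>v n" by blast
    define x where "x = (\<lambda>i. v $ inv_into {0..<n} ((!) xs) i)"
    have x: "x (xs ! i) = v $ i" if "i < n" for i
      using that b by (simp add: x_def bij_betw_def inv_into_f_f)
    obtain i where "i < n" "v $ i \<noteq> 0" using v by (auto simp: vec_eq_iff)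
    then have "x (xs ! i) \<noteq> 0" "xs ! i \<in> W" using x[of i] xs(2) by (simp_all add: n_def flip: xs(2))
    then have "\<exists>i\<in>W. x i \<noteq> 0" by blast
    moreover have "(\<Sum>i\<in>W. x i * M i j) = 0" if jW: "j \<in> W" for j
    proof -
      obtain k where k: "k < n" "j = xs ! k" using jW xs(2) in_set_conv_nth[of j xs] by (auto simp: n_def)
      have "(\<Sum>i\<in>W. x i * M i j) = (\<Sum>i=0..<n. x (xs ! i) * M (xs ! i) j)"
        by (rule sum.reindex_bij_betw[OF b, symmetric])
      also have "\<dots> = (?A *\<^sub>v v) $ k"
        using k v(1) by (simp add: scalar_prod_def x mult.commute)
      finally show ?thesis using v(3) k by (simp del: index_mult_mat_vec)
    qed
    ultimately show "\<exists>x. (\<exists>i\<in>W. x i \<noteq> 0) \<and> (\<forall>j\<in>W. (\<Sum>i\<in>W. x i * M i j) = 0)" by blast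
  next
    assume "\<exists>x. (\<exists>i\<in>W. x i \<noteq> 0) \<and> (\<forall>j\<in>W. (\<Sum>i\<in>W. x i * M i j) = 0)"
    then obtain x where x: "\<exists>i\<in>W. x i \<noteq> 0" "\<forall>j\<in>W. (\<Sum>i\<in>W. x i * M i j) = 0" by blast
    define v where "v = Matrix.vec n (\<lambda>i. x (xs ! i))"
    have "v \<noteq> 0\<^sub>v n"
    proof -
      obtain k where "k < n" "x (xs ! k) \<noteq> 0" using x xs n_def by (metis in_set_conv_nth)
      then show ?thesis by (auto simp: v_def vec_eq_iff)
    qed
    moreover have "?A *\<^sub>v v = 0\<^sub>v n"
    proof (rule eq_vecI)
      fix k assume k: "k < dim_vec (0\<^sub>v n :: int vec)"
      have "(?A *\<^sub>v v) $ k = (\<Sum>i=0..<n. x (xs ! i) * M (xs ! i) (xs ! k))"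
        using k by (simp add: v_def scalar_prod_def mult.commute)
      also have "\<dots> = (\<Sum>i\<in>W. x i * M i (xs ! k))"
        by (rule sum.reindex_bij_betw[OF b])
      also have "\<dots> = 0" using x(2) xs k by (metis index_zero_vec(2) n_def nth_mem)
      finally show "(?A *\<^sub>v v) $ k = 0\<^sub>v n $ k" using k by (simp del: index_mult_mat_vec)
    qed simp
    moreover have "v \<in> carrier_vec n" by (simp add: v_def)
    ultimately show "\<exists>v. v \<in> carrier_vec n \<and> v \<noteq> 0\<^sub>v n \<and> ?A *\<^sub>v v = 0\<^sub>v n" by blast
  qed
  finally show ?thesis .
qed


section \<open>Lattices in free abelian groups\<close>

abbreviation coef :: "('i \<Rightarrow>\<^sub>0 int) \<Rightarrow> 'i \<Rightarrow> int" where
  "coef \<equiv> Poly_Mapping.lookup"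

definition frag_chains :: "'i set \<Rightarrow> ('i \<Rightarrow>\<^sub>0 int) set" where
  "frag_chains S = {x. Poly_Mapping.keys x \<subseteq> S}"

lemma chains_iff: "x \<in> frag_chains S \<longleftrightarrow> (\<forall>j. j \<notin> S \<longrightarrow> coef x j = 0)"
  by (auto simp: frag_chains_def in_keys_iff)

lemma chains_lookup: "x \<in> frag_chains S \<Longrightarrow> j \<notin> S \<Longrightarrow> coef x j = 0"
  by (simp add: chains_iff)

lemma chains_mono: "S \<subseteq> T \<Longrightarrow> x \<in> frag_chains S \<Longrightarrow> x \<in> frag_chains T"
  by (auto simp: frag_chains_def)

lemma chains_add: "x \<in> frag_chains S \<Longrightarrow> y \<in> frag_chains S \<Longrightarrow> x + y \<in> frag_chains S"
  and chains_diff: "x \<in> frag_chains S \<Longrightarrow> y \<in> frag_chains S \<Longrightarrow> x - y \<in> frag_chains S"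
  and chains_zero: "0 \<in> frag_chains S"
  by (auto simp: chains_iff lookup_add lookup_minus)

lemma add_subgroup_chains: "add_subgroup (frag_chains S)"
  by (simp add: add_subgroup_def chains_diff chains_zero)

lemma frag_extend_chains:
  assumes "x \<in> frag_chains S" "\<And>i. i \<in> S \<Longrightarrow> v i \<in> frag_chains T"
  shows "frag_extend v x \<in> frag_chains T"
  using assms keys_frag_extend[of v x] unfolding frag_chains_def by blast

lemma lookup_frag_cmul [simp]: "coef (frag_cmul c x) i = c * coef x i"
  by (simp add: frag_cmul_def map.rep_eq when_def)

lemma chains_cmul: "x \<in> frag_chains S \<Longrightarrow> frag_cmul c x \<in> frag_chains S"
  by (auto simp: chains_iff)

lemma chains_frag_of: "i \<in> S \<Longrightarrow> frag_of i \<in> frag_chains S"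
  by (auto simp: frag_chains_def)

lemma chains_eq_0: "x \<in> frag_chains S \<Longrightarrow> (\<And>i. i \<in> S \<Longrightarrow> coef x i = 0) \<Longrightarrow> x = 0"
  by (rule poly_mapping_eqI) (metis chains_lookup lookup_zero)

lemma frag_extend_eq_sum:
  assumes "finite S" "x \<in> frag_chains S"
  shows "frag_extend v x = (\<Sum>i\<in>S. frag_cmul (coef x i) (v i))"
  unfolding frag_extend_def
  by (rule sum.mono_neutral_left) (use assms in \<open>auto simp: in_keys_iff frag_chains_def\<close>)

lemma lookup_sum_frag: "coef (\<Sum>i\<in>S. f i) j = (\<Sum>i\<in>S. coef (f i :: 'j \<Rightarrow>\<^sub>0 int) j)"
  by (induction S rule: infinite_finite_induct) (auto simp: lookup_add)

lemma lookup_frag_extend: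
  assumes "finite S" "x \<in> frag_chains S"
  shows "coef (frag_extend v x) j = (\<Sum>i\<in>S. coef x i * coef (v i) j)"
  by (simp add: frag_extend_eq_sum[OF assms] lookup_sum_frag)

definition chain_of :: "'i set \<Rightarrow> ('i \<Rightarrow> int) \<Rightarrow> 'i \<Rightarrow>\<^sub>0 int" where
  "chain_of S a = (\<Sum>i\<in>S. frag_cmul (a i) (frag_of i))"

lemma lookup_chain_of: "finite S \<Longrightarrow> coef (chain_of S a) j = (if j \<in> S then a j else 0)"
  by (simp add: chain_of_def lookup_sum_frag lookup_single when_def if_distrib[of "(*) _"] sum.delta cong: if_cong)

lemma chain_of_in_chains: "finite S \<Longrightarrow> chain_of S a \<in> frag_chains S"
  by (auto simp: chains_iff lookup_chain_of)

lemma chain_of_lookup: "finite S \<Longrightarrow> x \<in> frag_chains S \<Longrightarrow> chain_of S (coef x) = x"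
  by (rule poly_mapping_eqI) (auto simp: lookup_chain_of chains_lookup)

lemma frag_extend_chain_of:
  assumes "finite S"
  shows "frag_extend v (chain_of S a) = (\<Sum>i\<in>S. frag_cmul (a i) (v i))"
  using frag_extend_eq_sum[OF assms chain_of_in_chains[OF assms]] by (simp add: lookup_chain_of[OF assms])

text \<open>Independence of the family \<open>v\<close> on \<open>S\<close>. For the columns of a boundary matrix this says that
  there are no nonzero cycles supported on \<open>S\<close>.\<close>

definition lin_indep :: "'i set \<Rightarrow> ('i \<Rightarrow> 'j \<Rightarrow>\<^sub>0 int) \<Rightarrow> bool" where
  "lin_indep S v \<longleftrightarrow> (\<forall>x\<in>frag_chains S. frag_extend v x = 0 \<longrightarrow> x = 0)"

lemma lin_indepD: "lin_indep S v \<Longrightarrow> x \<in> frag_chains S \<Longrightarrow> frag_extend v x = 0 \<Longrightarrow> x = 0"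
  by (auto simp: lin_indep_def)

lemma lin_indep_iff_set_det:
  assumes W: "finite W" and v: "\<And>i. i \<in> W \<Longrightarrow> v i \<in> frag_chains W"
  shows "lin_indep W v \<longleftrightarrow> set_det W (\<lambda>i j. coef (v i) j) \<noteq> 0"
proof -
  have "\<not> lin_indep W v \<longleftrightarrow> (\<exists>a. (\<exists>i\<in>W. a i \<noteq> 0) \<and> (\<forall>j\<in>W. (\<Sum>i\<in>W. a i * coef (v i) j) = 0))"
  proof
    assume "\<not> lin_indep W v"
    then obtain x where x: "x \<in> frag_chains W" "frag_extend v x = 0" "x \<noteq> 0" by (auto simp: lin_indep_def)
    from x(1,3) have "\<exists>i\<in>W. coef x i \<noteq> 0"
      using chains_eq_0 by blast
    moreover have "(\<Sum>i\<in>W. coef x i * coef (v i) j) = 0" for j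
      using lookup_frag_extend[OF W x(1), of v j] x(2) by simp
    ultimately show "\<exists>a. (\<exists>i\<in>W. a i \<noteq> 0) \<and> (\<forall>j\<in>W. (\<Sum>i\<in>W. a i * coef (v i) j) = 0)" by blast
  next
    assume "\<exists>a. (\<exists>i\<in>W. a i \<noteq> 0) \<and> (\<forall>j\<in>W. (\<Sum>i\<in>W. a i * coef (v i) j) = 0)"
    then obtain a where a: "\<exists>i\<in>W. a i \<noteq> 0" "\<forall>j\<in>W. (\<Sum>i\<in>W. a i * coef (v i) j) = 0" by blast
    let ?x = "chain_of W a"
    have x: "?x \<in> frag_chains W" by (rule chain_of_in_chains[OF W])
    have "frag_extend v ?x = 0"
    proof (rule poly_mapping_eqI)
      fix j
      show "coef (frag_extend v ?x) j = coef 0 j"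
      proof (cases "j \<in> W")
        case True
        then show ?thesis using a(2) lookup_frag_extend[OF W x, of v j] by (simp add: lookup_chain_of W)
      next
        case False
        then show ?thesis using chains_lookup[OF frag_extend_chains[OF x v]] by simp
      qed
    qed
    moreover have "?x \<noteq> 0" using a(1) lookup_chain_of[OF W, of a] by (metis lookup_zero)
    ultimately show "\<not> lin_indep W v" using x by (auto simp: lin_indep_def)
  qed
  then show ?thesis using set_det_zero_iff[OF W, of "\<lambda>i j. coef (v i) j"] by blast
qed

lemma frag_extend_reindex:
  assumes "bij_betw e V W" "finite V"
  shows "frag_extend v ` frag_chains W = frag_extend (v \<circ> e) ` frag_chains V"
proof -
  have W: "finite W" using assms bij_betw_finite by blast
  have *: "frag_extend (v \<circ> e) (chain_of V (a \<circ> e)) = frag_extend v (chain_of W a)" for a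
    unfolding frag_extend_chain_of[OF W] frag_extend_chain_of[OF assms(2)] o_def
    by (rule sum.reindex_bij_betw[OF assms(1)])
  show ?thesis
  proof
    show "frag_extend v ` frag_chains W \<subseteq> frag_extend (v \<circ> e) ` frag_chains V"
    proof
      fix y assume "y \<in> frag_extend v ` frag_chains W"
      then obtain x where "x \<in> frag_chains W" "y = frag_extend v x" by blast
      then have "y = frag_extend (v \<circ> e) (chain_of V (coef x \<circ> e))"
        by (simp add: * chain_of_lookup W)
      then show "y \<in> frag_extend (v \<circ> e) ` frag_chains V" using chain_of_in_chains[OF assms(2)] by blast
    qed
    show "frag_extend (v \<circ> e) ` frag_chains V \<subseteq> frag_extend v ` frag_chains W"
    proof
      fix y assume "y \<in> frag_extend (v \<circ> e) ` frag_chains V"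
      then obtain x where x: "x \<in> frag_chains V" "y = frag_extend (v \<circ> e) x" by blast
      define a where "a = coef x \<circ> inv_into V e"
      have ae: "(a \<circ> e) i = coef x i" if "i \<in> V" for i
        using that assms(1) by (simp add: a_def bij_betw_inv_into_left)
      have "chain_of V (a \<circ> e) = chain_of V (coef x)"
        unfolding chain_of_def by (rule sum.cong) (use ae in auto)
      then have "y = frag_extend v (chain_of W a)" using *[of a] x chain_of_lookup[OF assms(2)] by simp
      then show "y \<in> frag_extend v ` frag_chains W" using chain_of_in_chains[OF W] by blast
    qed
  qed
qed

lemma frag_extend_row_op:
  assumes ij: "i \<in> W" "j \<in> W" "i \<noteq> j" and W: "finite W"
  shows "frag_extend (v(i := v i + frag_cmul c (v j))) ` frag_chains W \<subseteq> frag_extend v ` frag_chains W"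
proof
  fix y assume "y \<in> frag_extend (v(i := v i + frag_cmul c (v j))) ` frag_chains W"
  then obtain x where x: "x \<in> frag_chains W" "y = frag_extend (v(i := v i + frag_cmul c (v j))) x" by blast
  let ?z = "x + frag_cmul (c * coef x i) (frag_of j)"
  have "y = (\<Sum>k\<in>W. frag_cmul (coef x k) (v k + (if k = i then frag_cmul c (v j) else 0)))"
    unfolding x(2) frag_extend_eq_sum[OF W x(1)] by (rule sum.cong) auto
  also have "\<dots> = (\<Sum>k\<in>W. frag_cmul (coef x k) (v k)) 
      + (\<Sum>k\<in>W. if k = i then frag_cmul (coef x k * c) (v j) else 0)"
    by (simp add: frag_cmul_distrib2 sum.distrib if_distrib[of "frag_cmul _"] cong: if_cong)
  also have "\<dots> = frag_extend v ?z"
    using ij W x(1) by (simp add: frag_extend_add frag_extend_cmul frag_extend_eq_sum[OF W x(1)] mult.commute)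
  finally have "y = frag_extend v ?z" .
  moreover have "?z \<in> frag_chains W"
    using x(1) ij by (intro chains_add chains_cmul chains_frag_of)
  ultimately show "y \<in> frag_extend v ` frag_chains W" by blast
qed

text \<open>Row operations change neither the lattice nor the determinant. The Euclidean algorithm on the
  coordinate \<open>w\<close> leaves a single basis vector with a nonzero entry \<open>g\<close> there. Then the elements
  whose coordinate at \<open>w\<close> is divisible by \<open>g\<close> form a subgroup of index \<open>|g|\<close>, in which the
  lattice has the same index as its part with coordinate 0 at \<open>w\<close> has in the chains on \<open>W\<close>.\<close>

theorem index_lattice:
  assumes "finite W" "\<And>i. i \<in> W \<Longrightarrow> v i \<in> frag_chains W" "set_det W (\<lambda>i j. coef (v i) j) \<noteq> 0"
  shows "int (add_index (frag_chains W) (frag_extend v ` frag_chains W)) = \<bar>set_det W (\<lambda>i j. coef (v i) j)\<bar>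
     \<and> finite_index (frag_chains W) (frag_extend v ` frag_chains W)"
  using assms
proof (induction W arbitrary: v rule: finite_induct)
  case empty
  have "frag_chains ({} :: 'a set) = {0}" by (auto simp: frag_chains_def)
  then show ?case using index_self[OF add_subgroup_chains[of "{} :: 'a set"]] by simp
next
  case (insert w W)
  let ?W = "insert w W"
  let ?D = "\<lambda>v::'a \<Rightarrow> 'a \<Rightarrow>\<^sub>0 int. set_det ?W (\<lambda>i j. coef (v i) j)"
  let ?L = "\<lambda>v::'a \<Rightarrow> 'a \<Rightarrow>\<^sub>0 int. frag_extend v ` frag_chains ?W"
  let ?goal = "\<lambda>v. int (add_index (frag_chains ?W) (?L v)) = \<bar>?D v\<bar> \<and> finite_index (frag_chains ?W) (?L v)"
  have fW: "finite ?W" using insert.hyps by simp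
  have corner: "?goal v" if v: "\<And>i. i \<in> ?W \<Longrightarrow> v i \<in> frag_chains ?W" and D: "?D v \<noteq> 0"
    and 0: "\<And>i. i \<in> W \<Longrightarrow> coef (v i) w = 0" for v
  proof -
    let ?D' = "set_det W (\<lambda>i j. coef (v i) j)"
    define g where "g = coef (v w) w"
    have Dg: "?D v = g * ?D'"
      using set_det_corner[OF insert.hyps, of "\<lambda>i j. coef (v i) j"] 0 by (simp add: g_def)
    have vW: "v i \<in> frag_chains W" if "i \<in> W" for i
      using v[of i] 0[OF that] that unfolding chains_iff by (metis insertE insertI2)
    have IH: "int (add_index (frag_chains W) (frag_extend v ` frag_chains W)) = \<bar>?D'\<bar>"
       "finite_index (frag_chains W) (frag_extend v ` frag_chains W)"
      using insert.IH[OF vW] D Dg by auto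
    define K where "K = {x \<in> frag_chains ?W. g dvd coef x w}"
    have K: "add_subgroup K"
      by (auto simp: add_subgroup_def K_def lookup_minus chains_diff chains_zero)
    have L: "add_subgroup (?L v)"
      by (rule add_subgroup_image[OF add_subgroup_chains]) (simp add: frag_extend_diff)
    have LW: "?L v \<subseteq> frag_chains ?W" using frag_extend_chains[of _ ?W v ?W] v by blast
    have lw: "coef (frag_extend v x) w = g * coef x w" if "x \<in> frag_chains ?W" for x
      using lookup_frag_extend[OF fW that, of v w] insert.hyps 0 by (simp add: g_def mult.commute)
    have LK: "?L v \<subseteq> K" using LW lw by (auto simp: K_def)
    have cW: "frag_chains W \<subseteq> K"
    proof
      fix x assume x: "x \<in> frag_chains W"
      then have "coef x w = 0" using insert.hyps(2) by (rule chains_lookup)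
      then show "x \<in> K" using chains_mono[OF subset_insertI x] by (simp add: K_def)
    qed
    have g: "g \<noteq> 0" using D Dg by auto
    have i1: "add_index (frag_chains ?W) K = nat \<bar>g\<bar>" "finite_index (frag_chains ?W) K"
    proof -
      let ?f = "\<lambda>x::'a \<Rightarrow>\<^sub>0 int. coef x w"
      have fC: "?f ` frag_chains ?W = UNIV"
      proof -
        have "\<exists>x\<in>frag_chains ?W. ?f x = c" for c
          by (rule bexI[of _ "chain_of ?W (\<lambda>_. c)"]) (use fW in \<open>simp_all add: lookup_chain_of chain_of_in_chains\<close>)
        then show ?thesis by (metis UNIV_eq_I image_eqI)
      qed
      have fK: "?f ` K = range ((*) g)"
      proof
        show "?f ` K \<subseteq> range ((*) g)" by (auto simp: K_def dvd_def)
        have "\<exists>x\<in>K. ?f x = g * c" for c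
          by (rule bexI[of _ "chain_of ?W (\<lambda>_. g * c)"])
             (use chain_of_in_chains[OF fW, of "\<lambda>_. g * c"] in \<open>auto simp: lookup_chain_of[OF fW] K_def\<close>)
        then show "range ((*) g) \<subseteq> ?f ` K" by (auto simp: image_iff) metis
      qed
      have "add_index (?f ` frag_chains ?W) (?f ` K) = add_index (frag_chains ?W) K" 
        "finite_index (?f ` frag_chains ?W) (?f ` K) \<longleftrightarrow> finite_index (frag_chains ?W) K"
      proof -
        have sK: "add_subgroup (?f ` K)" by (rule add_subgroup_image[OF K]) (simp add: lookup_minus)
        have kerK: "x \<in> K" if "x \<in> frag_chains ?W" "?f x \<in> ?f ` K" for x using that by (auto simp: K_def)
        show "add_index (?f ` frag_chains ?W) (?f ` K) = add_index (frag_chains ?W) K" 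
          "finite_index (?f ` frag_chains ?W) (?f ` K) \<longleftrightarrow> finite_index (frag_chains ?W) K"
          by (rule index_image[OF K sK _ kerK add_subgroup_chains]; auto simp: lookup_minus K_def)+
      qed
      then show "add_index (frag_chains ?W) K = nat \<bar>g\<bar>" "finite_index (frag_chains ?W) K"
        using index_int_multiples[OF g] unfolding fC fK by auto
    qed
    have int: "frag_chains W \<inter> ?L v = frag_extend v ` frag_chains W"
    proof
      show "frag_extend v ` frag_chains W \<subseteq> frag_chains W \<inter> ?L v"
        using frag_extend_chains[of _ W v W] vW chains_mono[OF subset_insertI, of _ W w] by blast
      show "frag_chains W \<inter> ?L v \<subseteq> frag_extend v ` frag_chains W"
      proof
        fix y assume y: "y \<in> frag_chains W \<inter> ?L v"
        then obtain x where x: "x \<in> frag_chains ?W" "y = frag_extend v x" by blast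
        have "coef y w = 0" using chains_lookup[of y W w] y insert.hyps(2) by simp
        then have "coef x w = 0" using lw[OF x(1)] x(2) g by simp
        then have "x \<in> frag_chains W" using x(1) unfolding chains_iff by (metis insertE)
        then show "y \<in> frag_extend v ` frag_chains W" using x by blast
      qed
    qed
    have i2: "add_index K (?L v) = add_index (frag_chains W) (frag_chains W \<inter> ?L v)"
      "finite_index K (?L v) \<longleftrightarrow> finite_index (frag_chains W) (frag_chains W \<inter> ?L v)"
    proof -
      have ex: "\<exists>h\<in>frag_chains W. x - h \<in> ?L v" if x: "x \<in> K" for x
      proof -
        from x obtain c where c: "coef x w = g * c" by (auto simp: K_def)
        let ?h = "x - frag_cmul c (v w)"
        have "?h \<in> frag_chains ?W"
          using x v[of w] by (intro chains_diff chains_cmul) (auto simp: K_def)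
        moreover have "coef ?h w = 0" by (simp add: lookup_minus c g_def)
        ultimately have "?h \<in> frag_chains W" unfolding chains_iff by (metis insertE)
        moreover have "frag_extend v (frag_cmul c (frag_of w)) \<in> ?L v"
          by (intro imageI chains_cmul chains_frag_of) simp
        then have "x - ?h \<in> ?L v" by (simp add: frag_extend_cmul)
        ultimately show ?thesis by blast
      qed
      show "add_index K (?L v) = add_index (frag_chains W) (frag_chains W \<inter> ?L v)"
        "finite_index K (?L v) \<longleftrightarrow> finite_index (frag_chains W) (frag_chains W \<inter> ?L v)"
        by (rule index_Int[OF add_subgroup_chains L ex cW]; assumption)+
    qed
    have KC: "K \<subseteq> frag_chains ?W" by (auto simp: K_def)
    show ?thesis
      using index_tower[OF K L add_subgroup_chains LK KC] i1 i2 IH unfolding int Dg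
      by (simp add: abs_mult)
  qed
  have rowop: "?goal v" if g: "?goal (v(i := v i + frag_cmul c (v j)))" and ij: "i \<in> ?W" "j \<in> ?W" "i \<noteq> j" for v i j c
  proof -
    let ?v = "v(i := v i + frag_cmul c (v j))"
    have "?v(i := ?v i + frag_cmul (- c) (?v j)) = v"
      using ij by (auto simp: fun_eq_iff simp flip: frag_cmul_distrib)
    then have "?L v \<subseteq> ?L ?v" using frag_extend_row_op[OF ij fW, of ?v "- c"] by simp
    then have L: "?L ?v = ?L v" using frag_extend_row_op[OF ij fW, of v c] by blast
    have "(\<lambda>k l. coef (?v k) l) = (\<lambda>k l. coef (v k) l)(i := \<lambda>l. coef (v i) l + c * coef (v j) l)"
      by (auto simp: fun_eq_iff lookup_add)
    then have "?D ?v = ?D v"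
      using set_det_row_op[OF fW ij, of "\<lambda>k l. coef (v k) l" c] by simp
    then show ?thesis using g L by simp
  qed
  have "?goal v" if "\<And>i. i \<in> ?W \<Longrightarrow> v i \<in> frag_chains ?W" "?D v \<noteq> 0" for v
    using that
  proof (induction "\<Sum>i\<in>?W. nat \<bar>coef (v i) w\<bar>" arbitrary: v rule: less_induct)
    case less
    show ?case
    proof (cases "\<exists>i\<in>?W. \<exists>j\<in>?W. i \<noteq> j \<and> coef (v i) w \<noteq> 0 \<and> coef (v j) w \<noteq> 0")
      case True
      then obtain i j where ij: "i \<in> ?W" "j \<in> ?W" "i \<noteq> j"
        and nz: "coef (v j) w \<noteq> 0" "coef (v i) w \<noteq> 0" and le: "\<bar>coef (v j) w\<bar> \<le> \<bar>coef (v i) w\<bar>"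
        by (metis linear)
      \<comment> \<open>With this sign adding \<open>c\<close> times the smaller entry reduces the absolute value of the larger one.\<close>
      define c where "c = - (sgn (coef (v i) w) * sgn (coef (v j) w))"
      let ?v = "v(i := v i + frag_cmul c (v j))"
      have dec: "\<bar>coef (?v i) w\<bar> < \<bar>coef (v i) w\<bar>"
        using nz le by (auto simp: c_def lookup_add sgn_if abs_if)
      have "(\<Sum>i\<in>?W. nat \<bar>coef (?v i) w\<bar>) < (\<Sum>i\<in>?W. nat \<bar>coef (v i) w\<bar>)"
        by (rule sum_strict_mono_ex1[OF fW]) (use ij dec in \<open>auto intro!: bexI[of _ i]\<close>)
      moreover have "?v k \<in> frag_chains ?W" if "k \<in> ?W" for k
        using less.prems(1)[OF that] less.prems(1)[OF ij(1)] less.prems(1)[OF ij(2)] by (auto intro: chains_add chains_cmul)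
      moreover have "?D ?v \<noteq> 0"
      proof -
        have "(\<lambda>k l. coef (?v k) l) = (\<lambda>k l. coef (v k) l)(i := \<lambda>l. coef (v i) l + c * coef (v j) l)"
          by (auto simp: fun_eq_iff lookup_add)
        then show ?thesis
          using set_det_row_op[OF fW ij, of "\<lambda>k l. coef (v k) l" c] less.prems(2) by simp
      qed
      ultimately have "?goal ?v" by (rule less.hyps)
      then show ?thesis by (rule rowop) (use ij in auto)
    next
      case False
      have "\<exists>i\<in>?W. coef (v i) w \<noteq> 0"
        using set_det_zero_column[OF fW, of w "\<lambda>i j. coef (v i) j"] less.prems(2) by blast
      then obtain k where k: "k \<in> ?W" "coef (v k) w \<noteq> 0" by blast
      let ?t = "Transposition.transpose k w"
      have t: "?t permutes ?W" using k by (intro permutes_swap_id) auto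
      let ?u = "\<lambda>i. v (?t i)"
      have Du: "?D ?u = of_int (sign ?t) * ?D v"
        by (rule set_det_permute_rows[OF fW t])
      have "?goal ?u"
      proof (rule corner)
        show "?u i \<in> frag_chains ?W" if "i \<in> ?W" for i
          using less.prems(1) t that by (metis permutes_in_image)
        show "?D ?u \<noteq> 0" using Du less.prems(2) by (simp add: sign_def)
        show "coef (?u i) w = 0" if "i \<in> W" for i
        proof -
          have "?t i \<noteq> k" "?t i \<in> ?W" using that insert.hyps k by (auto simp: Transposition.transpose_def)
          then show ?thesis using False k by blast
        qed
      qed
      moreover have "?L ?u = ?L v"
        using frag_extend_reindex[OF permutes_imp_bij[OF t] fW, of v] by (simp add: o_def)
      moreover have "\<bar>?D ?u\<bar> = \<bar>?D v\<bar>" unfolding Du by (simp add: abs_mult sign_def)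
      ultimately show ?thesis by simp
    qed
  qed
  then show ?case using insert.prems by blast
qed


section \<open>Ranks\<close>

lemma frag_extend_sum_finite:
  "frag_extend f (\<Sum>i\<in>S. g i) = (\<Sum>i\<in>S. frag_extend f (g i))"
  by (induction S rule: infinite_finite_induct) (auto simp: frag_extend_add)

lemma frag_extend_frag_extend:
  "frag_extend f (frag_extend v x) = frag_extend (\<lambda>i. frag_extend f (v i)) x"
proof -
  have x: "x \<in> frag_chains (Poly_Mapping.keys x)" by (simp add: frag_chains_def)
  show ?thesis
    unfolding frag_extend_eq_sum[OF finite_keys x] by (simp add: frag_extend_sum_finite frag_extend_cmul)
qed

text \<open>If there were more vectors than coordinates, the coordinates could be embedded as a proper
  subset of the index set; the resulting square matrix has a zero column and hence
  determinant 0, contrary to independence.\<close>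

lemma lin_indep_card_le:
  assumes I: "finite I" and N: "finite N" and v: "\<And>i. i \<in> I \<Longrightarrow> v i \<in> frag_chains N" and "lin_indep I v"
  shows "card I \<le> card N"
proof (rule ccontr)
  assume "\<not> card I \<le> card N"
  then obtain e where e: "inj_on e N" "e ` N \<subseteq> I" and ne: "e ` N \<noteq> I"
    using card_le_inj[OF N I] by (metis card_image linear)
  then obtain i0 where i0: "i0 \<in> I" "i0 \<notin> e ` N" by blast
  let ?u = "\<lambda>i. frag_extend (\<lambda>k. frag_of (e k)) (v i)"
  have u: "?u i \<in> frag_chains I" if "i \<in> I" for i
    by (rule frag_extend_chains[OF v[OF that]]) (use e in \<open>auto intro: chains_frag_of\<close>)
  have "lin_indep I ?u"
    unfolding lin_indep_def
  proof (intro ballI impI)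
    fix x assume x: "x \<in> frag_chains I" "frag_extend ?u x = 0"
    have "frag_extend ?u x = frag_extend (\<lambda>k. frag_of (e k)) (frag_extend v x)"
      by (simp add: frag_extend_frag_extend)
    then have 0: "frag_extend (\<lambda>k. frag_of (e k)) (frag_extend v x) = 0" using x(2) by simp
    have vx: "frag_extend v x \<in> frag_chains N" by (rule frag_extend_chains[OF x(1) v])
    have "coef (frag_extend v x) k = 0" if k: "k \<in> N" for k
    proof -
      have "coef (frag_extend (\<lambda>k. frag_of (e k)) (frag_extend v x)) (e k)
        = (\<Sum>l\<in>N. coef (frag_extend v x) l * coef (frag_of (e l)) (e k))"
        by (rule lookup_frag_extend[OF N vx])
      also have "\<dots> = (\<Sum>l\<in>N. if l = k then coef (frag_extend v x) l else 0)"
        by (rule sum.cong) (use k e in \<open>auto simp: lookup_single when_def inj_on_def\<close>)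
      also have "\<dots> = coef (frag_extend v x) k" using k N by simp
      finally show ?thesis using 0 by simp
    qed
    then have "frag_extend v x = 0" using vx chains_eq_0 by blast
    then show "x = 0" using assms(4) x(1) lin_indepD by blast
  qed
  then have "set_det I (\<lambda>i j. coef (?u i) j) \<noteq> 0"
    using lin_indep_iff_set_det[OF I, of ?u] u by blast
  moreover have "coef (?u i) i0 = 0" if "i \<in> I" for i
  proof -
    have "?u i \<in> frag_chains (e ` N)"
      by (rule frag_extend_chains[OF v[OF that]]) (auto intro: chains_frag_of)
    then show ?thesis using i0(2) by (rule chains_lookup)
  qed
  then have "set_det I (\<lambda>i j. coef (?u i) j) = 0"
    by (rule set_det_zero_column[OF I i0(1)])
  ultimately show False by contradiction
qed

lemma lin_indep_family:
  assumes "finite I"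
  shows "lin_indep I v \<longleftrightarrow> (\<forall>a. (\<Sum>i\<in>I. frag_cmul (a i) (v i)) = 0 \<longrightarrow> (\<forall>i\<in>I. a i = 0))"
proof
  assume L: "lin_indep I v"
  show "\<forall>a. (\<Sum>i\<in>I. frag_cmul (a i) (v i)) = 0 \<longrightarrow> (\<forall>i\<in>I. a i = 0)"
  proof (intro allI impI ballI)
    fix a i assume "(\<Sum>i\<in>I. frag_cmul (a i) (v i)) = 0" and i: "i \<in> I"
    then have "chain_of I a = 0"
      using lin_indepD[OF L chain_of_in_chains[OF assms]] frag_extend_chain_of[OF assms] by metis
    then show "a i = 0" using lookup_chain_of[OF assms, of a i] i by simp
  qed
next
  assume R: "\<forall>a. (\<Sum>i\<in>I. frag_cmul (a i) (v i)) = 0 \<longrightarrow> (\<forall>i\<in>I. a i = 0)"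
  show "lin_indep I v"
    unfolding lin_indep_def
  proof (intro ballI impI)
    fix x assume x: "x \<in> frag_chains I" "frag_extend v x = 0"
    then have "\<forall>i\<in>I. coef x i = 0" using R frag_extend_eq_sum[OF assms x(1)] by metis
    then show "x = 0" using x(1) chains_eq_0 by blast
  qed
qed

text \<open>If \<open>U\<close> is maximal independent then each further column \<open>w\<close> depends on \<open>U\<close>; the relation is a
  cycle \<open>z w\<close> that is nonzero at \<open>w\<close>, since otherwise it would be supported on \<open>U\<close>. For graphs
  these are the fundamental cycles of a spanning tree.\<close>

lemma maximal_lin_indep:
  assumes N: "finite N"
  obtains U z where "U \<subseteq> N" "lin_indep U v"
    "\<And>w. w \<in> N - U \<Longrightarrow> z w \<in> frag_chains (insert w U)"
    "\<And>w. w \<in> N - U \<Longrightarrow> frag_extend v (z w) = 0"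
    "\<And>w. w \<in> N - U \<Longrightarrow> coef (z w) w \<noteq> 0"
proof -
  have "lin_indep {} v" by (auto simp: lin_indep_def frag_chains_def)
  then have mem: "{} \<in> {U. U \<subseteq> N \<and> lin_indep U v}" by simp
  have fin: "finite {U. U \<subseteq> N \<and> lin_indep U v}" using N by (auto intro: finite_subset[of _ "Pow N"])
  from finite_has_maximal2[OF fin mem] obtain U where U: "U \<subseteq> N" "lin_indep U v" 
    and max: "\<forall>V\<in>{U. U \<subseteq> N \<and> lin_indep U v}. U \<subseteq> V \<longrightarrow> U = V"
    by auto
  have "\<exists>z. z \<in> frag_chains (insert w U) \<and> frag_extend v z = 0 \<and> coef z w \<noteq> 0" if w: "w \<in> N - U" for w
  proof -
    have "\<not> lin_indep (insert w U) v" using max[THEN bspec, of "insert w U"] w U(1) by blast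
    then obtain z where z: "z \<in> frag_chains (insert w U)" "frag_extend v z = 0" "z \<noteq> 0" by (auto simp: lin_indep_def)
    have "coef z w \<noteq> 0"
    proof
      assume "coef z w = 0"
      then have "z \<in> frag_chains U" using z(1) unfolding chains_iff by (metis insertE)
      then show False using U(2) z lin_indepD by blast
    qed
    then show ?thesis using z by blast
  qed
  then obtain z where "\<And>w. w \<in> N - U \<Longrightarrow> z w \<in> frag_chains (insert w U) \<and> frag_extend v (z w) = 0 \<and> coef (z w) w \<noteq> 0"
    by metis
  then show ?thesis using that U by blast
qed

definition proj :: "'i set \<Rightarrow> ('i \<Rightarrow>\<^sub>0 int) \<Rightarrow> 'i \<Rightarrow>\<^sub>0 int" where
  "proj W = frag_extend (\<lambda>i. if i \<in> W then frag_of i else 0)"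

lemma lookup_proj: "coef (proj W x) j = (if j \<in> W then coef x j else 0)"
proof -
  have x: "x \<in> frag_chains (Poly_Mapping.keys x)" by (simp add: frag_chains_def)
  have "coef (proj W x) j = (\<Sum>i\<in>Poly_Mapping.keys x. if i = j \<and> j \<in> W then coef x i else 0)"
    unfolding proj_def lookup_frag_extend[OF finite_keys x]
    by (rule sum.cong) (auto simp: lookup_single when_def)
  also have "\<dots> = (if j \<in> W then coef x j else 0)"
    by (auto simp: in_keys_iff sum.delta)
  finally show ?thesis .
qed

lemma proj_diff: "proj W (x - y) = proj W x - proj W y"
  by (simp add: proj_def frag_extend_diff)

lemma proj_chains: "proj W x \<in> frag_chains W"
  by (simp add: chains_iff lookup_proj)

lemma proj_eq_0_iff:
  assumes "x \<in> frag_chains N"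
  shows "proj W x = 0 \<longleftrightarrow> x \<in> frag_chains (N - W)"
proof
  assume 0: "proj W x = 0"
  show "x \<in> frag_chains (N - W)"
    unfolding chains_iff using assms 0 lookup_proj[of W x] by (metis Diff_iff chains_lookup lookup_zero)
next
  assume "x \<in> frag_chains (N - W)"
  then show "proj W x = 0" by (intro poly_mapping_eqI) (auto simp: lookup_proj chains_lookup)
qed

text \<open>Induction on the coordinates. The subgroup of those elements of \<open>K\<close> whose last coordinate also
  occurs in \<open>H\<close> has finite index since a nonzero subgroup of the integers has finite index; inside
  it, the quotient by \<open>H\<close> is represented by elements with last coordinate 0.\<close>

lemma torsion_finite_index:
  assumes "finite N" "add_subgroup K" "add_subgroup H" "H \<subseteq> K" "K \<subseteq> frag_chains N"
    and "\<And>x. x \<in> K \<Longrightarrow> \<exists>m. m \<noteq> 0 \<and> frag_cmul m x \<in> H"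
  shows "finite_index K H"
  using assms
proof (induction N arbitrary: K H rule: finite_induct)
  case empty
  then have "K = H" using add_subgroupD(1)[of H] by (auto simp: frag_chains_def)
  then show ?case using index_self(2) empty by simp
next
  case (insert w N)
  let ?f = "\<lambda>x. coef x w"
  let ?K = "K \<inter> frag_chains N"
  have sK: "add_subgroup ?K" using insert.prems(1) add_subgroup_chains[of N] by (auto simp: add_subgroup_def)
  have sH: "add_subgroup (?K \<inter> H)" using sK insert.prems(2) by (auto simp: add_subgroup_def)
  have fin1: "finite_index ?K (?K \<inter> H)"
  proof (rule insert.IH[OF sK sH])
    fix x assume x: "x \<in> ?K"
    then obtain m where m: "m \<noteq> 0" "frag_cmul m x \<in> H" using insert.prems(5) by blast
    then have "frag_cmul m x \<in> ?K \<inter> H" using x insert.prems(3) chains_cmul by blast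
    then show "\<exists>m. m \<noteq> 0 \<and> frag_cmul m x \<in> ?K \<inter> H" using m by blast
  qed auto
  define G where "G = {x \<in> K. ?f x \<in> ?f ` H}"
  have sG: "add_subgroup G"
    unfolding add_subgroup_def G_def
  proof (intro conjI ballI)
    show "0 \<in> {x \<in> K. ?f x \<in> ?f ` H}"
      using add_subgroupD(1)[OF insert.prems(1)] add_subgroupD(1)[OF insert.prems(2)] by blast
    fix x y assume "x \<in> {x \<in> K. ?f x \<in> ?f ` H}" "y \<in> {x \<in> K. ?f x \<in> ?f ` H}"
    then obtain h k where "x \<in> K" "y \<in> K" "h \<in> H" "k \<in> H" "?f x = ?f h" "?f y = ?f k" by auto
    then show "x - y \<in> {x \<in> K. ?f x \<in> ?f ` H}"
      using add_subgroupD(2)[OF insert.prems(1)] add_subgroupD(2)[OF insert.prems(2), of h k]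
      by (auto simp: lookup_minus intro!: image_eqI[of _ _ "h - k"])
  qed
  have HG: "H \<subseteq> G" using insert.prems(3) by (auto simp: G_def)
  have KG: "?K \<subseteq> G"
  proof
    fix x assume x: "x \<in> ?K"
    then have "?f x = ?f 0" using chains_lookup[of x N w] insert.hyps(2) by simp
    then show "x \<in> G" using x add_subgroupD(1)[OF insert.prems(2)] unfolding G_def by blast
  qed
  have fin2: "finite_index G H"
  proof -
    have "\<exists>h\<in>?K. x - h \<in> H" if "x \<in> G" for x
    proof -
      from that obtain h where h: "x \<in> K" "h \<in> H" "?f x = ?f h" by (auto simp: G_def)
      have K: "x - h \<in> K" using h insert.prems(3) add_subgroupD(2)[OF insert.prems(1)] by blast
      moreover have "x - h \<in> frag_chains N"
        using K insert.prems(4) h(3) unfolding chains_iff by (metis (no_types, lifting) chains_iff diff_self insertE lookup_minus subsetD)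
      ultimately show ?thesis using h by (intro bexI[of _ "x - h"]) auto
    qed
    then show ?thesis using index_Int(2)[OF sK insert.prems(2) _ KG] fin1 by blast
  qed
  have fin3: "finite_index K G"
  proof -
    have Geq: "x \<in> G" if "x \<in> K" "?f x \<in> ?f ` G" for x using that by (auto simp: G_def)
    have fGH: "?f ` G = ?f ` H" using HG by (auto simp: G_def)
    have sfG: "add_subgroup (?f ` G)" by (rule add_subgroup_image[OF sG]) (simp add: lookup_minus)
    have "finite (add_coset (?f ` G) ` ?f ` K)"
    proof (cases "\<forall>x\<in>K. ?f x = 0")
      case True
      then have "?f ` K \<subseteq> {0}" by auto
      then show ?thesis by (meson finite.emptyI finite_imageI finite_insert finite_subset)
    next
      case False
      then obtain x where x: "x \<in> K" "?f x \<noteq> 0" by blast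
      then obtain m where m: "m \<noteq> 0" "frag_cmul m x \<in> H" using insert.prems(5) by blast
      define g where "g = m * ?f x"
      have g: "g \<noteq> 0" "g \<in> ?f ` G" using x m by (auto simp: g_def fGH intro!: image_eqI[of _ _ "frag_cmul m x"])
      have mult: "range ((*) g) \<subseteq> ?f ` G"
      proof
        fix c assume "c \<in> range ((*) g)"
        then obtain k where k: "c = g * k" by auto
        have "g * k \<in> ?f ` G"
        proof (induction k rule: int_induct[where k = 0])
          case base then show ?case using add_subgroupD(1)[OF sfG] by simp
        next
          case (step1 i) then show ?case using add_subgroupD(4)[OF sfG _ g(2), of "g * i"] by (simp add: distrib_left)
        next
          case (step2 i) then show ?case using add_subgroupD(2)[OF sfG _ g(2), of "g * i"] by (simp add: right_diff_distrib)
        qed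
        then show "c \<in> ?f ` G" using k by simp
      qed
      have sg: "add_subgroup (range ((*) g))"
        unfolding add_subgroup_def by (auto simp: image_iff simp flip: right_diff_distrib)
      have "finite_index UNIV (?f ` G)"
        using index_tower(2)[OF sfG sg, of UNIV] mult index_int_multiples(2)[OF g(1)] by (auto simp: add_subgroup_def)
      then have "finite (add_coset (?f ` G) ` UNIV)" by (simp add: finite_index_def)
      then show ?thesis by (rule rev_finite_subset) auto
    qed
    then have "finite_index (?f ` K) (?f ` G)" by (simp add: finite_index_def)
    then show ?thesis
      using index_image(2)[OF sG sfG _ Geq insert.prems(1)] by (auto simp: lookup_minus G_def)
  qed
  show ?case using index_tower(2)[OF sG insert.prems(2) insert.prems(1) HG] fin2 fin3 by (auto simp: G_def)
qed


text \<open>Two different multiples of \<open>x\<close> lie in the same coset, by the pigeonhole principle.\<close>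

lemma finite_index_torsion:
  assumes "finite_index K H" "add_subgroup K" "add_subgroup H" "x \<in> K"
  shows "\<exists>m. m \<noteq> 0 \<and> frag_cmul m x \<in> H"
proof -
  have Kx: "frag_cmul (int k) x \<in> K" for k
    using add_subgroupD[OF assms(2)] assms(4) by (induction k) (auto simp: frag_cmul_distrib)
  have "\<not> inj (\<lambda>k. add_coset H (frag_cmul (int k) x))"
  proof
    assume "inj (\<lambda>k. add_coset H (frag_cmul (int k) x))"
    then have "infinite (range (\<lambda>k. add_coset H (frag_cmul (int k) x)))"
      using finite_imageD by blast
    moreover have "range (\<lambda>k. add_coset H (frag_cmul (int k) x)) \<subseteq> add_coset H ` K" using Kx by auto
    ultimately show False using assms(1) finite_subset unfolding finite_index_def by blast
  qed
  then obtain k l where kl: "k \<noteq> l" "add_coset H (frag_cmul (int k) x) = add_coset H (frag_cmul (int l) x)"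
    by (auto simp: inj_def)
  then have "frag_cmul (int k - int l) x \<in> H"
    using add_coset_eq_iff[OF assms(3)] by (simp add: frag_cmul_diff_distrib)
  then show ?thesis using kl(1) by (intro exI[of _ "int k - int l"]) auto
qed

lemma lin_indep_reindex:
  assumes e: "bij_betw e W S" and W: "finite W"
  shows "lin_indep W (u \<circ> e) \<longleftrightarrow> lin_indep S u"
proof -
  have S: "finite S" using assms bij_betw_finite by blast
  have eq: "(\<Sum>i\<in>W. frag_cmul (c (e i)) ((u \<circ> e) i)) = (\<Sum>s\<in>S. frag_cmul (c s) (u s))" for c
    using sum.reindex_bij_betw[OF e, of "\<lambda>s. frag_cmul (c s) (u s)"] by simp
  have im: "e ` W = S" using e by (simp add: bij_betw_def)
  show ?thesis
    unfolding lin_indep_family[OF W] lin_indep_family[OF S]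
  proof (intro iffI allI impI ballI)
    fix c s assume P: "\<forall>a. (\<Sum>i\<in>W. frag_cmul (a i) ((u \<circ> e) i)) = 0 \<longrightarrow> (\<forall>i\<in>W. a i = 0)"
      and "(\<Sum>s\<in>S. frag_cmul (c s) (u s)) = 0" and "s \<in> S"
    then have "\<forall>i\<in>W. c (e i) = 0" using eq[of c] P[THEN spec, of "\<lambda>i. c (e i)"] by simp
    then show "c s = 0" using im \<open>s \<in> S\<close> by blast
  next
    fix c i assume R: "\<forall>a. (\<Sum>s\<in>S. frag_cmul (a s) (u s)) = 0 \<longrightarrow> (\<forall>s\<in>S. a s = 0)"
      and "(\<Sum>i\<in>W. frag_cmul (c i) ((u \<circ> e) i)) = 0" and i: "i \<in> W"
    define c' where "c' = (\<lambda>s. c (inv_into W e s))"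
    have c': "c' (e i) = c i" if "i \<in> W" for i using that e by (simp add: c'_def bij_betw_inv_into_left)
    have "(\<Sum>i\<in>W. frag_cmul (c' (e i)) ((u \<circ> e) i)) = (\<Sum>i\<in>W. frag_cmul (c i) ((u \<circ> e) i))"
      by (rule sum.cong) (simp_all add: c')
    then have "(\<Sum>s\<in>S. frag_cmul (c' s) (u s)) = 0"
      using eq[of c'] \<open>(\<Sum>i\<in>W. frag_cmul (c i) ((u \<circ> e) i)) = 0\<close> by simp
    then show "c i = 0" using R i im c' by (metis imageI)
  qed
qed

section \<open>Two consecutive boundary maps\<close>

definition cycles :: "'i set \<Rightarrow> ('i \<Rightarrow> 'j \<Rightarrow>\<^sub>0 int) \<Rightarrow> ('i \<Rightarrow>\<^sub>0 int) set" where
  "cycles N b = {x \<in> frag_chains N. frag_extend b x = 0}"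

definition frag_span :: "'i set \<Rightarrow> ('i \<Rightarrow> 'j \<Rightarrow>\<^sub>0 int) \<Rightarrow> ('j \<Rightarrow>\<^sub>0 int) set" where
  "frag_span S a = frag_extend a ` frag_chains S"

lemma add_subgroup_cycles: "add_subgroup (cycles N b)"
  by (auto simp: add_subgroup_def cycles_def chains_diff chains_zero frag_extend_diff)

lemma add_subgroup_span: "add_subgroup (frag_span S a)"
  unfolding frag_span_def by (rule add_subgroup_image[OF add_subgroup_chains]) (simp add: frag_extend_diff)

lemma span_mono: "S \<subseteq> T \<Longrightarrow> frag_span S a \<subseteq> frag_span T a"
  using chains_mono unfolding frag_span_def by blast

lemma lin_indep_iff_cycles: "lin_indep U b \<longleftrightarrow> cycles U b = {0}"
  using chains_zero[of U] by (auto simp: lin_indep_def cycles_def)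

text \<open>The choice also demands the fundamental cycles of \<open>maximal_lin_indep\<close>, which show that the
  number of the remaining columns is the rank of the group of cycles.\<close>

definition max_indep :: "'i set \<Rightarrow> ('i \<Rightarrow> 'j \<Rightarrow>\<^sub>0 int) \<Rightarrow> 'i set" where
  "max_indep N v = (SOME U. U \<subseteq> N \<and> lin_indep U v \<and> (\<exists>z. \<forall>w\<in>N - U. z w \<in> frag_chains (insert w U)
      \<and> frag_extend v (z w) = 0 \<and> coef (z w) w \<noteq> 0))"

definition cycle_rank :: "'i set \<Rightarrow> ('i \<Rightarrow> 'j \<Rightarrow>\<^sub>0 int) \<Rightarrow> nat" where
  "cycle_rank N v = card (N - max_indep N v)"

lemma max_indep:
  assumes "finite N"
  shows "max_indep N v \<subseteq> N" and "lin_indep (max_indep N v) v"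
    and "\<exists>z. \<forall>w\<in>N - max_indep N v. z w \<in> frag_chains (insert w (max_indep N v))
      \<and> frag_extend v (z w) = 0 \<and> coef (z w) w \<noteq> 0"
proof -
  let ?P = "\<lambda>U. U \<subseteq> N \<and> lin_indep U v \<and> (\<exists>z. \<forall>w\<in>N - U. z w \<in> frag_chains (insert w U)
      \<and> frag_extend v (z w) = 0 \<and> coef (z w) w \<noteq> 0)"
  obtain U z where "U \<subseteq> N" "lin_indep U v" 
    "\<And>w. w \<in> N - U \<Longrightarrow> z w \<in> frag_chains (insert w U)"
    "\<And>w. w \<in> N - U \<Longrightarrow> frag_extend v (z w) = 0"
    "\<And>w. w \<in> N - U \<Longrightarrow> coef (z w) w \<noteq> 0"
    by (rule maximal_lin_indep[OF assms, of v]) blast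
  then have "?P U" by (intro conjI exI[of _ z]) auto
  then have P: "?P (max_indep N v)" unfolding max_indep_def by (rule someI[of ?P])
  show "max_indep N v \<subseteq> N" "lin_indep (max_indep N v) v"
    "\<exists>z. \<forall>w\<in>N - max_indep N v. z w \<in> frag_chains (insert w (max_indep N v))
      \<and> frag_extend v (z w) = 0 \<and> coef (z w) w \<noteq> 0"
    using P by blast+
qed

text \<open>Deleting the coordinates in a maximal independent set of columns is injective on cycles, and it
  leaves only \<open>cycle_rank N v\<close> coordinates.\<close>

lemma card_le_cycle_rank:
  assumes "finite N" "finite I" and u: "\<And>i. i \<in> I \<Longrightarrow> u i \<in> cycles N v" and L: "lin_indep I u"
  shows "card I \<le> cycle_rank N v"
proof -
  let ?W = "N - max_indep N v"
  have NW: "N - ?W = max_indep N v" using max_indep(1)[OF assms(1), of v] by blast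
  have "lin_indep I (proj ?W \<circ> u)"
    unfolding lin_indep_def
  proof (intro ballI impI)
    fix x assume x: "x \<in> frag_chains I" "frag_extend (proj ?W \<circ> u) x = 0"
    let ?y = "frag_extend u x"
    have pe: "frag_extend (proj ?W \<circ> u) x = proj ?W ?y"
      by (simp add: proj_def frag_extend_frag_extend o_def)
    have y: "?y \<in> frag_chains N"
      by (rule frag_extend_chains[OF x(1)]) (use u in \<open>auto simp: cycles_def\<close>)
    have "frag_extend v ?y = (\<Sum>i\<in>I. frag_cmul (coef x i) (frag_extend v (u i)))"
      unfolding frag_extend_frag_extend by (rule frag_extend_eq_sum[OF assms(2) x(1)])
    also have "\<dots> = 0" using u by (intro sum.neutral) (simp add: cycles_def)
    finally have vy: "frag_extend v ?y = 0" .
    have "?y \<in> frag_chains (N - ?W)" using x(2) pe proj_eq_0_iff[OF y] by simp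
    then have "?y = 0" using lin_indepD[OF max_indep(2)[OF assms(1)]] vy unfolding NW by blast
    then show "x = 0" using L x(1) lin_indepD by blast
  qed
  then show ?thesis
    unfolding cycle_rank_def
    using lin_indep_card_le[OF assms(2), of ?W "proj ?W \<circ> u"] assms(1) by (simp add: proj_chains)
qed

text \<open>The fundamental cycle of \<open>w\<close> is the only one with a nonzero coefficient at \<open>w\<close>. The nonzero
  factors \<open>c\<close> allow the cycles to be replaced by multiples that are boundaries.\<close>

lemma independent_cycles:
  assumes N: "finite N"
  obtains z where "\<And>w. w \<in> N - max_indep N v \<Longrightarrow> z w \<in> cycles N v"
    "\<And>c. (\<And>w. w \<in> N - max_indep N v \<Longrightarrow> c w \<noteq> 0) \<Longrightarrow> lin_indep (N - max_indep N v) (\<lambda>w. frag_cmul (c w) (z w))"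
proof -
  let ?U = "max_indep N v" let ?W = "N - ?U"
  obtain z where z: "\<And>w. w \<in> ?W \<Longrightarrow> z w \<in> frag_chains (insert w ?U)" "\<And>w. w \<in> ?W \<Longrightarrow> frag_extend v (z w) = 0"
    "\<And>w. w \<in> ?W \<Longrightarrow> coef (z w) w \<noteq> 0"
    using max_indep(3)[OF N, of v] by blast
  show ?thesis
  proof (rule that)
    show "z w \<in> cycles N v" if "w \<in> ?W" for w
    proof -
      have "insert w ?U \<subseteq> N" using that max_indep(1)[OF N] by blast
      then show ?thesis using chains_mono[OF _ z(1)[OF that]] z(2)[OF that] by (simp add: cycles_def)
    qed
    show "lin_indep ?W (\<lambda>w. frag_cmul (c w) (z w))" if c: "\<And>w. w \<in> ?W \<Longrightarrow> c w \<noteq> 0" for c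
    proof -
      have W: "finite ?W" using N by simp
      show ?thesis
        unfolding lin_indep_family[OF W]
      proof (intro allI impI ballI)
        fix a w assume 0: "(\<Sum>i\<in>?W. frag_cmul (a i) (frag_cmul (c i) (z i))) = 0" and w: "w \<in> ?W"
        have "(\<Sum>i\<in>?W. a i * (c i * coef (z i) w)) = 0"
          using arg_cong[OF 0, of "\<lambda>x. coef x w"] by (simp add: lookup_sum_frag mult.assoc)
        moreover have "coef (z i) w = 0" if "i \<in> ?W" "i \<noteq> w" for i
          using chains_lookup[OF z(1)[OF that(1)], of w] that w by auto
        then have "(\<Sum>i\<in>?W. a i * (c i * coef (z i) w)) = (\<Sum>i\<in>?W. if i = w then a w * (c w * coef (z w) w) else 0)"
          by (intro sum.cong) auto
        ultimately have "a w * (c w * coef (z w) w) = 0" using w W by simp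
        then show "a w = 0" using c[OF w] z(3)[OF w] by simp
      qed
    qed
  qed
qed

lemma add_subgroup_torsion:
  assumes "add_subgroup H"
  shows "add_subgroup {x. \<exists>m. m \<noteq> 0 \<and> frag_cmul m x \<in> H}"
proof -
  have Hm: "frag_cmul k x \<in> H" if "x \<in> H" for k x
  proof (induction k rule: int_induct[where k = 0])
    case base then show ?case using add_subgroupD(1)[OF assms] by simp
  next
    case (step1 i) then show ?case using add_subgroupD(4)[OF assms _ that] by (simp add: frag_cmul_distrib)
  next
    case (step2 i) then show ?case using add_subgroupD(2)[OF assms _ that] by (simp add: frag_cmul_diff_distrib)
  qed
  show ?thesis
    unfolding add_subgroup_def
  proof (intro conjI ballI)
    show "0 \<in> {x. \<exists>m. m \<noteq> 0 \<and> frag_cmul m x \<in> H}"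
      using add_subgroupD(1)[OF assms] by (auto intro: exI[of _ 1])
    fix x y assume "x \<in> {x. \<exists>m. m \<noteq> 0 \<and> frag_cmul m x \<in> H}" "y \<in> {x. \<exists>m. m \<noteq> 0 \<and> frag_cmul m x \<in> H}"
    then obtain m k where mk: "m \<noteq> 0" "frag_cmul m x \<in> H" "k \<noteq> 0" "frag_cmul k y \<in> H" by blast
    have "frag_cmul (m * k) (x - y) = frag_cmul k (frag_cmul m x) - frag_cmul m (frag_cmul k y)"
      by (rule poly_mapping_eqI) (simp add: lookup_minus algebra_simps)
    also have "\<dots> \<in> H" using mk Hm add_subgroupD(2)[OF assms] by blast
    finally show "x - y \<in> {x. \<exists>m. m \<noteq> 0 \<and> frag_cmul m x \<in> H}" using mk by (auto intro!: exI[of _ "m * k"])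
  qed
qed

text \<open>The vectors with a nonzero multiple in the span of the maximal independent columns form a
  subgroup; by the fundamental cycles it contains every column.\<close>

lemma span_max_indep_torsion:
  assumes M: "finite M" and y: "y \<in> frag_span M a"
  shows "\<exists>m. m \<noteq> 0 \<and> frag_cmul m y \<in> frag_span (max_indep M a) a"
proof -
  let ?S = "max_indep M a"
  let ?T = "{x. \<exists>m. m \<noteq> 0 \<and> frag_cmul m x \<in> frag_span ?S a}"
  have T: "add_subgroup ?T" by (rule add_subgroup_torsion[OF add_subgroup_span])
  obtain z where z: "\<And>w. w \<in> M - ?S \<Longrightarrow> z w \<in> frag_chains (insert w ?S)" "\<And>w. w \<in> M - ?S \<Longrightarrow> frag_extend a (z w) = 0"
    "\<And>w. w \<in> M - ?S \<Longrightarrow> coef (z w) w \<noteq> 0"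
    using max_indep(3)[OF M, of a] by blast
  have "a \<sigma> \<in> ?T" if "\<sigma> \<in> M" for \<sigma>
  proof (cases "\<sigma> \<in> ?S")
    case True
    then have "frag_extend a (frag_of \<sigma>) \<in> frag_span ?S a" unfolding frag_span_def by (intro imageI chains_frag_of)
    then show ?thesis by (auto intro!: exI[of _ 1])
  next
    case False
    then have \<sigma>: "\<sigma> \<in> M - ?S" using that by blast
    define m where "m = coef (z \<sigma>) \<sigma>"
    let ?x = "frag_cmul m (frag_of \<sigma>) - z \<sigma>"
    have "?x \<in> frag_chains ?S"
      unfolding chains_iff using chains_lookup[OF z(1)[OF \<sigma>]]
      by (auto simp: lookup_minus m_def lookup_single when_def)
    moreover have "frag_extend a ?x = frag_cmul m (a \<sigma>)"
      by (simp add: frag_extend_diff frag_extend_cmul z(2)[OF \<sigma>])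
    ultimately have "frag_cmul m (a \<sigma>) \<in> frag_span ?S a" unfolding frag_span_def by (metis imageI)
    then show ?thesis using z(3)[OF \<sigma>] m_def by blast
  qed
  moreover have "frag_cmul k x \<in> ?T" if "x \<in> ?T" for k x
  proof (induction k rule: int_induct[where k = 0])
    case base then show ?case using add_subgroupD(1)[OF T] by simp
  next
    case (step1 i) then show ?case using add_subgroupD(4)[OF T _ that, of "frag_cmul i x"] by (simp add: frag_cmul_distrib)
  next
    case (step2 i) then show ?case using add_subgroupD(2)[OF T _ that, of "frag_cmul i x"] by (simp add: frag_cmul_diff_distrib)
  qed
  moreover have "(\<Sum>i\<in>F. g i) \<in> ?T" if "finite F" "\<And>i. i \<in> F \<Longrightarrow> g i \<in> ?T" for F and g :: "'a \<Rightarrow> 'b \<Rightarrow>\<^sub>0 int"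
    using that
  proof (induction F rule: finite_induct)
    case empty then show ?case using add_subgroupD(1)[OF T] by simp
  next
    case (insert x F) then show ?case using add_subgroupD(4)[OF T, of "g x" "sum g F"] by simp
  qed
  moreover obtain x where x: "x \<in> frag_chains M" "y = frag_extend a x" using y by (auto simp: frag_span_def)
  ultimately have "y \<in> ?T" unfolding x(2) frag_extend_eq_sum[OF M x(1)] using M by simp
  then show ?thesis by blast
qed

text \<open>Here \<open>a\<close> and \<open>b\<close> are the columns of the boundary matrices in degrees \<open>d\<close> and \<open>d - 1\<close>, and \<open>M\<close> and
  \<open>N\<close> are the sets of cells of these dimensions.\<close>

locale lattice_complex =
  fixes M :: "'m set" and N :: "'n set" and a :: "'m \<Rightarrow> 'n \<Rightarrow>\<^sub>0 int" and b :: "'n \<Rightarrow> 'p \<Rightarrow>\<^sub>0 int"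
  assumes fM: "finite M" and fN: "finite N"
    and a_cycles: "\<And>\<sigma>. \<sigma> \<in> M \<Longrightarrow> a \<sigma> \<in> cycles N b"
begin

lemma a_chains: "\<sigma> \<in> M \<Longrightarrow> a \<sigma> \<in> frag_chains N"
  using a_cycles by (simp add: cycles_def)

lemma frag_extend_a_cycles:
  assumes "x \<in> frag_chains M"
  shows "frag_extend a x \<in> cycles N b"
proof -
  have "frag_extend b (frag_extend a x) = (\<Sum>\<sigma>\<in>M. frag_cmul (coef x \<sigma>) (frag_extend b (a \<sigma>)))"
    unfolding frag_extend_frag_extend by (rule frag_extend_eq_sum[OF fM assms])
  also have "\<dots> = 0" using a_cycles by (intro sum.neutral) (simp add: cycles_def)
  finally show ?thesis using frag_extend_chains[OF assms a_chains] by (simp add: cycles_def)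
qed

lemma span_a_cycles: "S \<subseteq> M \<Longrightarrow> frag_span S a \<subseteq> cycles N b"
  using frag_extend_a_cycles chains_mono unfolding frag_span_def by blast

lemma proj_cycles_inj:
  assumes "lin_indep (N - W) b" "x \<in> cycles N b" "proj W x = 0"
  shows "x = 0"
  using assms proj_eq_0_iff[of x N W] lin_indepD[OF assms(1)] by (auto simp: cycles_def)

abbreviation gram :: "'n \<Rightarrow> 'n \<Rightarrow> int" where
  "gram \<equiv> \<lambda>i j. \<Sum>\<sigma>\<in>M. coef (a \<sigma>) i * coef (a \<sigma>) j"

text \<open>The bijection \<open>e\<close> from the rows \<open>W\<close> to a set of columns makes the submatrix square. It is
  transposed, so that generators of the lattice are rows.\<close>

definition minor :: "'n set \<Rightarrow> ('n \<Rightarrow> 'm) \<Rightarrow> int" where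
  "minor W e = set_det W (\<lambda>i j. coef (a (e i)) j)"

context
  fixes W :: "'n set" and S :: "'m set" and e :: "'n \<Rightarrow> 'm"
  assumes W: "W \<subseteq> N" and S: "S \<subseteq> M" and e: "bij_betw e W S"
begin

lemma fW: "finite W"
  using W fN finite_subset by blast

lemma lin_indep_minor: "minor W e \<noteq> 0 \<longleftrightarrow> lin_indep S (proj W \<circ> a)"
proof -
  have "minor W e = set_det W (\<lambda>i j. coef ((proj W \<circ> a \<circ> e) i) j)"
    unfolding minor_def by (rule set_det_cong) (simp add: lookup_proj)
  then show ?thesis
    using lin_indep_iff_set_det[OF fW, of "proj W \<circ> a \<circ> e"] lin_indep_reindex[OF e fW, of "proj W \<circ> a"]
    by (simp add: proj_chains)
qed

lemma frag_extend_proj_a: "frag_extend (proj W \<circ> a) x = proj W (frag_extend a x)"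
  by (simp add: proj_def frag_extend_frag_extend o_def)

lemma minor_imp_lin_indep: "minor W e \<noteq> 0 \<Longrightarrow> lin_indep S a"
  unfolding lin_indep_minor lin_indep_def frag_extend_proj_a by (auto simp: proj_def)

text \<open>A cycle that vanishes on \<open>W\<close> is supported on the complement, where there are no nonzero cycles.
  So no independence is lost by keeping only the coordinates in \<open>W\<close>.\<close>

lemma minor_nonzero_iff:
  assumes "lin_indep (N - W) b"
  shows "minor W e \<noteq> 0 \<longleftrightarrow> lin_indep S a"
proof
  assume L: "lin_indep S a"
  show "minor W e \<noteq> 0"
    unfolding lin_indep_minor lin_indep_def frag_extend_proj_a
    using proj_cycles_inj[OF assms] frag_extend_a_cycles chains_mono[OF S] lin_indepD[OF L] by blast
qed (rule minor_imp_lin_indep)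

text \<open>The minor is the index in the chains on \<open>W\<close> of the projected boundaries of \<open>S\<close>. The projected
  cycles lie in between. Their index is that of the sum of the cycles and the chains on \<open>N - W\<close> in
  the group of all chains, and applying \<open>b\<close> to this sum leaves the boundaries of \<open>N - W\<close>.\<close>

lemma minor_index:
  assumes U: "lin_indep (N - W) b" and nz: "minor W e \<noteq> 0"
  shows "\<bar>minor W e\<bar> = int (add_index (frag_span N b) (frag_span (N - W) b) * add_index (cycles N b) (frag_span S a))"
    and "finite_index (cycles N b) (frag_span S a)" and "finite_index (frag_span N b) (frag_span (N - W) b)"
proof -
  let ?Z = "cycles N b" and ?U = "N - W"
  let ?v = "proj W \<circ> a \<circ> e"
  have "minor W e = set_det W (\<lambda>i j. coef (?v i) j)"
    unfolding minor_def by (rule set_det_cong) (simp add: lookup_proj)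
  then have idx: "int (add_index (frag_chains W) (frag_extend ?v ` frag_chains W)) = \<bar>minor W e\<bar>"
    "finite_index (frag_chains W) (frag_extend ?v ` frag_chains W)"
    using index_lattice[OF fW, of ?v] nz by (auto simp: proj_chains)
  have "frag_extend ?v ` frag_chains W = proj W ` frag_span S a"
    using frag_extend_reindex[OF e fW, of "proj W \<circ> a"] by (simp add: frag_span_def image_image frag_extend_proj_a)
  note idx = idx[unfolded this]
  have sZ: "add_subgroup ?Z" and sS: "add_subgroup (frag_span S a)" 
    by (rule add_subgroup_cycles, rule add_subgroup_span)
  have SZ: "frag_span S a \<subseteq> ?Z" by (rule span_a_cycles[OF S])
  have psub: "add_subgroup (proj W ` H)" if "add_subgroup H" for H
    using that proj_diff by (rule add_subgroup_image)
  have i1: "add_index (proj W ` ?Z) (proj W ` frag_span S a) = add_index ?Z (frag_span S a)"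
    "finite_index (proj W ` ?Z) (proj W ` frag_span S a) \<longleftrightarrow> finite_index ?Z (frag_span S a)"
  proof -
    have ker: "x \<in> frag_span S a" if x: "x \<in> ?Z" "proj W x \<in> proj W ` frag_span S a" for x
    proof -
      obtain y where y: "y \<in> frag_span S a" "proj W x = proj W y" using x by blast
      then have "x - y = 0"
        using proj_cycles_inj[OF U, of "x - y"] x SZ add_subgroupD(2)[OF sZ] by (auto simp: proj_diff)
      then show ?thesis using y by simp
    qed
    show "add_index (proj W ` ?Z) (proj W ` frag_span S a) = add_index ?Z (frag_span S a)"
      "finite_index (proj W ` ?Z) (proj W ` frag_span S a) \<longleftrightarrow> finite_index ?Z (frag_span S a)"
      by (rule index_image[OF sS psub[OF sS] proj_diff ker sZ SZ]; assumption)+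
  qed
  have t1: "add_index (frag_chains W) (proj W ` frag_span S a) 
      = add_index (frag_chains W) (proj W ` ?Z) * add_index (proj W ` ?Z) (proj W ` frag_span S a)"
    "finite_index (frag_chains W) (proj W ` frag_span S a) 
      \<longleftrightarrow> finite_index (frag_chains W) (proj W ` ?Z) \<and> finite_index (proj W ` ?Z) (proj W ` frag_span S a)"
    using index_tower[OF psub[OF sZ] psub[OF sS] add_subgroup_chains image_mono[OF SZ]] proj_chains by auto
  \<comment> \<open>The sum of the cycles and the chains on the complement of \<open>W\<close>: it is the full preimage both of
    the projected cycles under the projection and of the boundaries of the complement under \<open>b\<close>.\<close>
  define G where "G = {x \<in> frag_chains N. \<exists>z\<in>?Z. x - z \<in> frag_chains ?U}"
  have sG: "add_subgroup G"
    unfolding add_subgroup_def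
  proof (intro conjI ballI)
    show "0 \<in> G"
      unfolding G_def using add_subgroupD(1)[OF sZ] chains_zero by (auto intro!: bexI[of _ 0])
    fix x y assume "x \<in> G" "y \<in> G"
    then obtain z z' where *: "x \<in> frag_chains N" "y \<in> frag_chains N" "z \<in> ?Z" "z' \<in> ?Z" 
      "x - z \<in> frag_chains ?U" "y - z' \<in> frag_chains ?U" by (auto simp: G_def)
    have "x - y - (z - z') = (x - z) - (y - z')" by simp
    also have "\<dots> \<in> frag_chains ?U" using *(5,6) by (rule chains_diff)
    finally show "x - y \<in> G"
      unfolding G_def using * chains_diff add_subgroupD(2)[OF sZ, of z z'] by blast
  qed
  have GN: "G \<subseteq> frag_chains N" by (auto simp: G_def)
  have ZN: "?Z \<subseteq> frag_chains N" by (auto simp: cycles_def)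
  have UN: "frag_chains ?U \<subseteq> frag_chains N" by (auto intro: chains_mono[of ?U N])
  have pN: "proj W ` frag_chains N = frag_chains W"
  proof
    have "x = proj W x" if "x \<in> frag_chains W" for x
      using that by (intro poly_mapping_eqI) (simp add: lookup_proj chains_lookup)
    then show "frag_chains W \<subseteq> proj W ` frag_chains N" using chains_mono[OF W] by blast
  qed (use proj_chains in blast)
  have pG: "proj W ` G = proj W ` ?Z"
  proof
    show "proj W ` ?Z \<subseteq> proj W ` G"
      unfolding G_def using ZN chains_zero by (intro image_mono) force
    show "proj W ` G \<subseteq> proj W ` ?Z"
    proof
      fix y assume "y \<in> proj W ` G"
      then obtain x z where x: "x \<in> frag_chains N" "y = proj W x" "z \<in> ?Z" "x - z \<in> frag_chains ?U" by (auto simp: G_def)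
      then have "proj W (x - z) = 0" using proj_eq_0_iff[of "x - z" N W] UN by blast
      then have "y = proj W z" using x by (simp add: proj_diff)
      then show "y \<in> proj W ` ?Z" using x by blast
    qed
  qed
  have kerp: "x \<in> G" if x: "x \<in> frag_chains N" "proj W x \<in> proj W ` G" for x
  proof -
    obtain z where z: "z \<in> ?Z" "proj W x = proj W z" using x(2) pG by auto
    then have "proj W (x - z) = 0" by (simp add: proj_diff)
    then have "x - z \<in> frag_chains ?U" using proj_eq_0_iff[of "x - z" N W] x(1) z ZN chains_diff by blast
    then show ?thesis using x z by (auto simp: G_def)
  qed
  have i2: "add_index (frag_chains W) (proj W ` ?Z) = add_index (frag_chains N) G"
    "finite_index (frag_chains W) (proj W ` ?Z) \<longleftrightarrow> finite_index (frag_chains N) G"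
    using index_image[OF sG psub[OF sG] proj_diff kerp add_subgroup_chains GN] by (simp_all add: pG pN)
  have bG: "frag_extend b ` G = frag_span ?U b"
  proof
    show "frag_extend b ` G \<subseteq> frag_span ?U b"
    proof
      fix y assume "y \<in> frag_extend b ` G"
      then obtain x z where x: "y = frag_extend b x" "z \<in> ?Z" "x - z \<in> frag_chains ?U" by (auto simp: G_def)
      then have "y = frag_extend b (x - z)" by (simp add: frag_extend_diff cycles_def)
      then show "y \<in> frag_span ?U b" using x by (simp add: frag_span_def)
    qed
    have "frag_chains ?U \<subseteq> G"
      unfolding G_def using UN add_subgroupD(1)[OF sZ] by force
    then show "frag_span ?U b \<subseteq> frag_extend b ` G" by (auto simp: frag_span_def)
  qed
  have kerb: "x \<in> G" if x: "x \<in> frag_chains N" "frag_extend b x \<in> frag_extend b ` G" for x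
  proof -
    obtain u where u: "u \<in> frag_chains ?U" "frag_extend b x = frag_extend b u" using x(2) bG by (auto simp: frag_span_def)
    then have "x - u \<in> ?Z" using x UN by (auto simp: cycles_def frag_extend_diff chains_diff)
    then show ?thesis using x u by (auto simp: G_def intro!: bexI[of _ "x - u"])
  qed
  have sbG: "add_subgroup (frag_extend b ` G)"
    unfolding bG by (rule add_subgroup_span)
  have i3: "add_index (frag_span N b) (frag_span ?U b) = add_index (frag_chains N) G"
    "finite_index (frag_span N b) (frag_span ?U b) \<longleftrightarrow> finite_index (frag_chains N) G"
    using index_image[OF sG sbG _ kerb add_subgroup_chains GN] bG by (simp_all add: frag_span_def frag_extend_diff)
  show "\<bar>minor W e\<bar> = int (add_index (frag_span N b) (frag_span ?U b) * add_index ?Z (frag_span S a))"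
    "finite_index ?Z (frag_span S a)" "finite_index (frag_span N b) (frag_span ?U b)"
    using idx t1 i1 i2 i3 by simp_all
qed

text \<open>If the minor were nonzero, the boundaries of \<open>S\<close> would be independent and thus of finite index in
  the cycles. Then a nonzero cycle supported off \<open>W\<close> has a nonzero multiple among them, and the
  projection of this multiple to \<open>W\<close> is zero, which is a relation between the rows of the minor.\<close>

lemma minor_dependent:
  assumes U: "\<not> lin_indep (N - W) b" and fin: "lin_indep S a \<Longrightarrow> finite_index (cycles N b) (frag_span S a)"
  shows "minor W e = 0"
proof (rule ccontr)
  assume nz: "minor W e \<noteq> 0"
  obtain z where z: "z \<in> frag_chains (N - W)" "frag_extend b z = 0" "z \<noteq> 0" using U by (auto simp: lin_indep_def)
  have zN: "z \<in> frag_chains N" using chains_mono[OF _ z(1), of N] by blast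
  then have "z \<in> cycles N b" using z by (simp add: cycles_def)
  then obtain m where m: "m \<noteq> 0" "frag_cmul m z \<in> frag_span S a"
    using finite_index_torsion[OF fin[OF minor_imp_lin_indep[OF nz]] add_subgroup_cycles add_subgroup_span] by blast
  then obtain x where x: "x \<in> frag_chains S" "frag_cmul m z = frag_extend a x" by (auto simp: frag_span_def)
  have "proj W (frag_cmul m z) = 0"
    using proj_eq_0_iff[OF chains_cmul[OF zN]] chains_cmul[OF z(1)] by blast
  then have "frag_extend (proj W \<circ> a) x = 0" using x(2) by (simp add: frag_extend_proj_a)
  then have "x = 0" using nz x(1) lin_indepD unfolding lin_indep_minor by blast
  then show False using x m z by simp
qed

end

end


text \<open>The lattice \<open>Z\<close> plays the part of the cycles in degree \<open>d - 2\<close>. So the hypotheses say that the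
  homology in the degrees \<open>d - 2\<close> and \<open>d - 1\<close> is finite and a torsion group, respectively.\<close>

locale finite_homology_complex = lattice_complex M N a b
  for M :: "'m set" and N :: "'n set" and a :: "'m \<Rightarrow> 'n \<Rightarrow>\<^sub>0 int" and b :: "'n \<Rightarrow> 'p \<Rightarrow>\<^sub>0 int" +
  fixes Z :: "('p \<Rightarrow>\<^sub>0 int) set"
  assumes Z: "add_subgroup Z" and span_b: "frag_span N b \<subseteq> Z" and finite_Z: "finite_index Z (frag_span N b)"
    and torsion: "\<And>x. x \<in> cycles N b \<Longrightarrow> \<exists>m. m \<noteq> 0 \<and> frag_cmul m x \<in> frag_span M a"
begin

abbreviation r :: nat where "r \<equiv> cycle_rank N b"

text \<open>Rank plus nullity for \<open>a\<close>: its independent columns are independent cycles, so there are at most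
  \<open>r\<close> of them. Conversely \<open>r\<close> independent cycles have nonzero multiples which are boundaries of
  chains on the maximal independent set.\<close>

lemma card_max_indep: "card (max_indep M a) = r"
proof (rule antisym)
  let ?S = "max_indep M a"
  have SM: "?S \<subseteq> M" by (rule max_indep(1)[OF fM])
  then show "card ?S \<le> r"
    using card_le_cycle_rank[OF fN finite_subset[OF SM fM], of a b] a_cycles max_indep(2)[OF fM] by blast
  let ?W = "N - max_indep N b"
  obtain z where z: "\<And>w. w \<in> ?W \<Longrightarrow> z w \<in> cycles N b"
    "\<And>c. (\<And>w. w \<in> ?W \<Longrightarrow> c w \<noteq> 0) \<Longrightarrow> lin_indep ?W (\<lambda>w. frag_cmul (c w) (z w))"
    using independent_cycles[OF fN, of b] by blast
  have "\<exists>m y. m \<noteq> 0 \<and> y \<in> frag_chains ?S \<and> frag_cmul m (z w) = frag_extend a y" if w: "w \<in> ?W" for w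
  proof -
    obtain m where m: "m \<noteq> 0" "frag_cmul m (z w) \<in> frag_span M a" using torsion[OF z(1)[OF w]] by blast
    obtain k where k: "k \<noteq> 0" "frag_cmul k (frag_cmul m (z w)) \<in> frag_span ?S a"
      using span_max_indep_torsion[OF fM m(2)] by blast
    then obtain y where "y \<in> frag_chains ?S" "frag_cmul (k * m) (z w) = frag_extend a y" by (auto simp: frag_span_def)
    then show ?thesis using m k by (intro exI[of _ "k * m"] exI[of _ y]) auto
  qed
  then obtain m y where my: "\<And>w. w \<in> ?W \<Longrightarrow> m w \<noteq> 0 \<and> y w \<in> frag_chains ?S \<and> frag_cmul (m w) (z w) = frag_extend a (y w)"
    by metis
  have W: "finite ?W" using fN by simp
  have "lin_indep ?W y"
    unfolding lin_indep_def
  proof (intro ballI impI)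
    fix x assume x: "x \<in> frag_chains ?W" "frag_extend y x = 0"
    have "frag_extend (\<lambda>w. frag_cmul (m w) (z w)) x = frag_extend (\<lambda>w. frag_extend a (y w)) x"
      unfolding frag_extend_eq_sum[OF W x(1)] by (rule sum.cong) (use my in auto)
    also have "\<dots> = 0" using x(2) by (simp flip: frag_extend_frag_extend)
    finally show "x = 0" using lin_indepD[OF z(2)] my x(1) by blast
  qed
  then show "r \<le> card ?S"
    unfolding cycle_rank_def using my lin_indep_card_le[OF W finite_subset[OF SM fM], of y] by blast
qed

lemma card_lin_indep_le: "S \<subseteq> M \<Longrightarrow> lin_indep S a \<Longrightarrow> card S \<le> r"
  using card_le_cycle_rank[OF fN finite_subset[OF _ fM], of S a b] a_cycles by blast

lemma obtain_bij:
  assumes "W \<subseteq> N" "S \<subseteq> M" "card S = card W"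
  shows "\<exists>e. bij_betw e W S"
  using assms fM fN by (intro finite_same_card_bij) (auto intro: finite_subset)

text \<open>Against the complement of a maximal independent set of columns of \<open>b\<close>, the minor of \<open>S\<close> is
  nonzero.\<close>

lemma finite_index_tree:
  assumes "S \<subseteq> M" "card S = r" "lin_indep S a"
  shows "finite_index (cycles N b) (frag_span S a)"
proof -
  let ?W = "N - max_indep N b"
  have NW: "N - ?W = max_indep N b" using max_indep(1)[OF fN] by blast
  obtain e where e: "bij_betw e ?W S"
    using obtain_bij[of ?W S] assms by (auto simp: cycle_rank_def)
  have "minor ?W e \<noteq> 0"
    using minor_nonzero_iff[OF _ assms(1) e] assms(3) max_indep(2)[OF fN, of b] NW by simp
  then show ?thesis using minor_index(2)[OF _ assms(1) e] max_indep(2)[OF fN, of b] NW by simp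
qed

text \<open>For the boundary maps of a cell complex this is the tree number in degree \<open>d\<close>.\<close>

definition top_weight :: nat where
  "top_weight = (\<Sum>S | S \<subseteq> M \<and> card S = r \<and> lin_indep S a. (add_index (cycles N b) (frag_span S a))\<^sup>2)"

lemma det_gram:
  assumes W: "W \<subseteq> N"
  shows "\<exists>e. (\<forall>S. S \<subseteq> M \<longrightarrow> card S = card W \<longrightarrow> bij_betw (e S) W S) \<and>
    set_det W gram
    = (\<Sum>S | S \<subseteq> M \<and> card S = card W. (minor W (e S))\<^sup>2)"
proof -
  have "\<exists>e. \<forall>S. S \<subseteq> M \<longrightarrow> card S = card W \<longrightarrow> bij_betw (e S) W S"
    using obtain_bij[OF W] by metis
  then obtain e where e: "\<And>S. S \<subseteq> M \<Longrightarrow> card S = card W \<Longrightarrow> bij_betw (e S) W S" by blast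
  show ?thesis
    using Cauchy_Binet_gram[of W M e "\<lambda>i \<sigma>. coef (a \<sigma>) i"] e W fM fN finite_subset
    by (intro exI[of _ e]) (auto simp: minor_def)
qed

text \<open>In the Cauchy--Binet expansion the factor that belongs to the complement of \<open>W\<close> is common to all
  nonzero minors.\<close>

theorem det_reduced:
  assumes W: "W \<subseteq> N" "card W = r" and U: "lin_indep (N - W) b"
  shows "set_det W gram
      * (int (add_index Z (frag_span N b)))\<^sup>2
    = (int (add_index Z (frag_span (N - W) b)))\<^sup>2 * int top_weight"
    and "finite_index Z (frag_span (N - W) b)"
proof -
  let ?h = "int (add_index Z (frag_span N b))" and ?k = "int (add_index (frag_span N b) (frag_span (N - W) b))"
  obtain e where e: "\<And>S. S \<subseteq> M \<Longrightarrow> card S = card W \<Longrightarrow> bij_betw (e S) W S"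
    and det: "set_det W gram
      = (\<Sum>S | S \<subseteq> M \<and> card S = card W. (minor W (e S))\<^sup>2)"
    using det_gram[OF W(1)] by blast
  have sub: "frag_span (N - W) b \<subseteq> frag_span N b" by (rule span_mono) auto
  have tower: "add_index Z (frag_span (N - W) b) = add_index Z (frag_span N b) * add_index (frag_span N b) (frag_span (N - W) b)"
    "finite_index Z (frag_span (N - W) b) \<longleftrightarrow> finite_index Z (frag_span N b) \<and> finite_index (frag_span N b) (frag_span (N - W) b)"
    using index_tower[OF add_subgroup_span add_subgroup_span Z sub span_b] by blast+
  have minor: "(minor W (e S))\<^sup>2 = (if lin_indep S a then (?k * int (add_index (cycles N b) (frag_span S a)))\<^sup>2 else 0)"
    if S: "S \<subseteq> M" "card S = card W" for S
  proof (cases "lin_indep S a")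
    case True
    then have "minor W (e S) \<noteq> 0" using minor_nonzero_iff[OF W(1) S(1) e[OF S] U] by simp
    then have "\<bar>minor W (e S)\<bar> = ?k * int (add_index (cycles N b) (frag_span S a))"
      using minor_index(1)[OF W(1) S(1) e[OF S] U] by simp
    then show ?thesis using True by (metis power2_abs)
  next
    case False
    then show ?thesis using minor_nonzero_iff[OF W(1) S(1) e[OF S] U] by simp
  qed
  have "(\<Sum>S | S \<subseteq> M \<and> card S = card W. (minor W (e S))\<^sup>2)
     = (\<Sum>S | S \<subseteq> M \<and> card S = card W. (if lin_indep S a then (?k * int (add_index (cycles N b) (frag_span S a)))\<^sup>2 else 0))"
    by (rule sum.cong) (use minor in auto)
  also have "\<dots> = (\<Sum>S | S \<subseteq> M \<and> card S = r \<and> lin_indep S a. (?k * int (add_index (cycles N b) (frag_span S a)))\<^sup>2)"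
    by (rule sum.mono_neutral_cong_right) (use fM W(2) in \<open>auto intro: finite_subset[of _ "Pow M"]\<close>)
  also have "\<dots> = ?k\<^sup>2 * int top_weight"
    by (simp add: top_weight_def sum_distrib_left power_mult_distrib)
  finally show "set_det W gram * ?h\<^sup>2
    = (int (add_index Z (frag_span (N - W) b)))\<^sup>2 * int top_weight"
    using det tower(1) by (simp add: power_mult_distrib)
  let ?S = "max_indep M a"
  have S: "?S \<subseteq> M" "card ?S = card W" "lin_indep ?S a"
    using max_indep[OF fM, of a] card_max_indep W(2) by auto
  then have "minor W (e ?S) \<noteq> 0" using minor_nonzero_iff[OF W(1) S(1) e[OF S(1,2)] U] by simp
  then show "finite_index Z (frag_span (N - W) b)"
    using minor_index(3)[OF W(1) S(1) e[OF S(1,2)] U] tower(2) finite_Z by blast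
qed

lemma det_gram_dependent:
  assumes W: "W \<subseteq> N" "card W = r" and U: "\<not> lin_indep (N - W) b"
  shows "set_det W gram = 0"
proof -
  obtain e where e: "\<And>S. S \<subseteq> M \<Longrightarrow> card S = card W \<Longrightarrow> bij_betw (e S) W S"
    and det: "set_det W gram
      = (\<Sum>S | S \<subseteq> M \<and> card S = card W. (minor W (e S))\<^sup>2)"
    using det_gram[OF W(1)] by blast
  show ?thesis
    unfolding det
  proof (rule sum.neutral, intro ballI)
    fix S assume "S \<in> {S. S \<subseteq> M \<and> card S = card W}"
    then have S: "S \<subseteq> M" "card S = card W" by auto
    show "(minor W (e S))\<^sup>2 = 0"
      using minor_dependent[OF W(1) S(1) e[OF S] U] finite_index_tree[OF S(1)] S(2) W(2) by simp
  qed
qed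

lemma det_gram_large:
  assumes W: "W \<subseteq> N" "card W > r"
  shows "set_det W gram = 0"
proof -
  obtain e where e: "\<And>S. S \<subseteq> M \<Longrightarrow> card S = card W \<Longrightarrow> bij_betw (e S) W S"
    and det: "set_det W gram
      = (\<Sum>S | S \<subseteq> M \<and> card S = card W. (minor W (e S))\<^sup>2)"
    using det_gram[OF W(1)] by blast
  show ?thesis
    unfolding det
  proof (rule sum.neutral, intro ballI)
    fix S assume "S \<in> {S. S \<subseteq> M \<and> card S = card W}"
    then have S: "S \<subseteq> M" "card S = card W" by auto
    then show "(minor W (e S))\<^sup>2 = 0"
      using minor_imp_lin_indep[OF W(1) S(1) e[OF S]] card_lin_indep_le[OF S(1)] W(2) by fastforce
  qed
qed

text \<open>Likewise, the tree number in degree \<open>d - 1\<close>.\<close>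

definition low_weight :: nat where
  "low_weight = (\<Sum>U | U \<subseteq> N \<and> card (N - U) = r \<and> lin_indep U b. (add_index Z (frag_span U b))\<^sup>2)"

definition minor_sum :: int where
  "minor_sum = (\<Sum>W | W \<subseteq> N \<and> card W = r.
     set_det W gram)"

text \<open>Only principal minors whose complementary set of columns of \<open>b\<close> is independent contribute, and
  for these \<open>det_reduced\<close> applies.\<close>

theorem minor_sum_eq: "minor_sum * (int (add_index Z (frag_span N b)))\<^sup>2 = int top_weight * int low_weight"
proof -
  let ?d = "\<lambda>W. set_det W gram"
  let ?h = "int (add_index Z (frag_span N b))"
  have "minor_sum = (\<Sum>W | W \<subseteq> N \<and> card W = r \<and> lin_indep (N - W) b. ?d W)"
    unfolding minor_sum_def
    by (rule sum.mono_neutral_right) (use fN det_gram_dependent in \<open>auto intro: finite_subset[of _ "Pow N"]\<close>)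
  also have "\<dots> = (\<Sum>U | U \<subseteq> N \<and> card (N - U) = r \<and> lin_indep U b. ?d (N - U))"
    by (rule sum.reindex_bij_witness[where i = "\<lambda>U. N - U" and j = "\<lambda>W. N - W"]) (auto simp: double_diff)
  finally have "minor_sum * ?h\<^sup>2 = (\<Sum>U | U \<subseteq> N \<and> card (N - U) = r \<and> lin_indep U b. ?d (N - U) * ?h\<^sup>2)"
    by (simp add: sum_distrib_right)
  also have "\<dots> = (\<Sum>U | U \<subseteq> N \<and> card (N - U) = r \<and> lin_indep U b. (int (add_index Z (frag_span U b)))\<^sup>2 * int top_weight)"
  proof (rule sum.cong)
    fix U assume "U \<in> {U. U \<subseteq> N \<and> card (N - U) = r \<and> lin_indep U b}"
    then have U: "U \<subseteq> N" "card (N - U) = r" "lin_indep U b" by auto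
    then have "N - (N - U) = U" by blast
    then show "?d (N - U) * ?h\<^sup>2 = (int (add_index Z (frag_span U b)))\<^sup>2 * int top_weight"
      using det_reduced(1)[of "N - U"] U by simp
  qed simp
  also have "\<dots> = int top_weight * int low_weight"
    by (simp add: low_weight_def sum_distrib_left mult.commute)
  finally show ?thesis .
qed

lemma top_weight_pos: "top_weight > 0"
proof -
  let ?S = "max_indep M a"
  have S: "?S \<in> {S. S \<subseteq> M \<and> card S = r \<and> lin_indep S a}"
    using max_indep[OF fM, of a] card_max_indep by auto
  have "0 < (add_index (cycles N b) (frag_span ?S a))\<^sup>2"
    using add_index_pos[OF finite_index_tree[of ?S]] S add_subgroupD(1)[OF add_subgroup_cycles[of N b]] by force
  also have "\<dots> \<le> top_weight"
    unfolding top_weight_def using S fM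
    by (intro member_le_sum[where f = "\<lambda>S. (add_index (cycles N b) (frag_span S a))\<^sup>2"]) (auto intro: finite_subset[of _ "Pow M"])
  finally show ?thesis .
qed

lemma low_weight_pos: "low_weight > 0"
proof -
  let ?U = "max_indep N b"
  have U: "?U \<in> {U. U \<subseteq> N \<and> card (N - U) = r \<and> lin_indep U b}"
    using max_indep[OF fN, of b] by (auto simp: cycle_rank_def)
  have NU: "N - (N - ?U) = ?U" using U by blast
  have "finite_index Z (frag_span ?U b)"
    using det_reduced(2)[of "N - ?U"] U unfolding NU by simp
  then have "0 < (add_index Z (frag_span ?U b))\<^sup>2"
    using add_index_pos add_subgroupD(1)[OF Z] by fastforce
  also have "\<dots> \<le> low_weight"
    unfolding low_weight_def using U fN
    by (intro member_le_sum[where f = "\<lambda>U. (add_index Z (frag_span U b))\<^sup>2"]) (auto intro: finite_subset[of _ "Pow N"])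
  finally show ?thesis .
qed

lemma homology_pos: "add_index Z (frag_span N b) > 0"
  using add_index_pos[OF finite_Z] add_subgroupD(1)[OF Z] by blast

lemma minor_sum_nonzero: "minor_sum \<noteq> 0"
  using minor_sum_eq top_weight_pos low_weight_pos by (metis mult_eq_0_iff mult_zero_left of_nat_0_eq_iff less_irrefl)

end

section \<open>The product of the nonzero eigenvalues\<close>

lemma prod_mset_uminus: "(\<Prod>x\<in>#A. - x) = (-1) ^ size A * prod_mset (A :: 'a::comm_ring_1 multiset)"
  by (induction A) auto

lemma prod_nonzero_proots:
  fixes q :: "complex poly"
  assumes "poly q 0 \<noteq> 0" "lead_coeff q = 1"
  shows "prod_mset {#l \<in># proots (monom 1 k * q). l \<noteq> 0#} = (-1) ^ degree q * coeff q 0"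
proof -
  have q0: "q \<noteq> 0" using assms(1) by auto
  have roots: "proots (monom 1 k * q) = replicate_mset k 0 + proots q"
  proof -
    have "proots (monom 1 k * q) = proots (monom 1 k) + proots q"
      using q0 by (intro proots_mult) (auto simp: monom_eq_0_iff)
    moreover have "proots (monom (1::complex) k) = replicate_mset k 0"
      using proots_power[of "[:0, 1:]" k] by (simp add: monom_altdef)
    ultimately show ?thesis by simp
  qed
  have filt: "{#l \<in># proots (monom 1 k * q). l \<noteq> 0#} = proots q"
  proof -
    have "{#l \<in># proots q. l \<noteq> 0#} = {#l \<in># proots q. True#}"
      using assms(1) q0 by (intro filter_mset_cong) auto
    moreover have "{#l \<in># replicate_mset k (0::complex). l \<noteq> 0#} = {#}"
      by (induction k) auto
    ultimately show ?thesis unfolding roots by simp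
  qed
  have "q = (\<Prod>x\<in>#proots q. [:-x, 1:])"
    using complex_poly_decompose_multiset[of q] assms(2) by simp
  then have "poly q 0 = poly (\<Prod>x\<in>#proots q. [:-x, 1:]) 0" by simp
  then have "poly q 0 = (\<Prod>x\<in>#proots q. - x)"
    by (simp add: poly_prod_mset)
  also have "\<dots> = (-1) ^ size (proots q) * prod_mset (proots q)"
    by (rule prod_mset_uminus)
  finally have "poly q 0 = (-1) ^ degree q * prod_mset (proots q)"
    by (simp add: size_proots_complex)
  then show ?thesis unfolding filt by (simp add: poly_0_coeff_0 flip: power_mult_distrib mult.assoc)
qed

lemma char_poly_indexed_mat:
  fixes L :: "'c \<Rightarrow> 'c \<Rightarrow> int"
  assumes "finite N"
  shows "char_poly (indexed_mat N (\<lambda>i j. complex_of_int (L i j)))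
    = (\<Sum>W\<in>Pow N. monom (of_int ((-1) ^ card W * set_det W L)) (card N - card W))"
proof -
  let ?P = "\<lambda>i j. (if i = j then [:0, 1:] else 0) + [:- complex_of_int (L i j):]"
  define xs where "xs = (SOME xs. distinct xs \<and> set xs = N)"
  have xs: "distinct xs \<and> set xs = N" 
    unfolding xs_def by (rule someI_ex) (use finite_distinct_list[OF assms] in blast)
  define n where "n = length xs"
  have b: "bij_betw ((!) xs) {0..<n} N" using xs by (auto intro: bij_betw_nth simp: n_def)
  have "char_poly_matrix (indexed_mat N (\<lambda>i j. complex_of_int (L i j)))
      = Matrix.mat n n (\<lambda>(i, j). ?P (xs ! i) (xs ! j))"
    by (rule eq_matI) (use xs in \<open>auto simp: char_poly_matrix_def indexed_mat_def Let_def n_def nth_eq_iff_index_eq simp flip: xs_def\<close>)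
  then have "char_poly (indexed_mat N (\<lambda>i j. complex_of_int (L i j))) = set_det {0..<n} (\<lambda>i j. ?P (xs ! i) (xs ! j))"
    by (simp add: char_poly_def det_mat_eq_set_det)
  also have "\<dots> = set_det N ?P" by (rule set_det_reindex[OF b]) simp
  also have "\<dots> = (\<Sum>W\<in>Pow N. [:0, 1:] ^ card (N - W) * set_det W (\<lambda>i j. [:- complex_of_int (L i j):]))"
    by (rule set_det_add_diagonal[OF assms])
  also have "\<dots> = (\<Sum>W\<in>Pow N. monom (of_int ((-1) ^ card W * set_det W L)) (card N - card W))"
  proof (rule sum.cong)
    fix W assume "W \<in> Pow N"
    then have W: "W \<subseteq> N" "finite W" using assms finite_subset by auto
    have "set_det W (\<lambda>i j. [:- complex_of_int (L i j):]) = set_det W (\<lambda>i j. of_int (- L i j) :: complex poly)"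
      by (rule set_det_cong) (simp add: of_int_poly)
    also have "\<dots> = of_int (set_det W (\<lambda>i j. - L i j))" by (simp add: set_det_def)
    also have "set_det W (\<lambda>i j. - L i j) = (-1) ^ card W * set_det W L"
      by (simp add: set_det_def sum_distrib_left prod_uminus algebra_simps)
    finally have "set_det W (\<lambda>i j. [:- complex_of_int (L i j):]) = [:of_int ((-1) ^ card W * set_det W L):]"
      by (simp add: of_int_poly)
    then show "[:0, 1:] ^ card (N - W) * set_det W (\<lambda>i j. [:- complex_of_int (L i j):])
        = monom (of_int ((-1) ^ card W * set_det W L)) (card N - card W)"
      using W by (simp add: card_Diff_subset monom_altdef mult.commute)
  qed simp
  finally show ?thesis .
qed

text \<open>Since all larger principal minors vanish, the characteristic polynomial is a power of the
  variable times a polynomial of degree \<open>k\<close> whose constant coefficient is, up to sign, the sum of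
  the principal \<open>k\<close>-minors. This coefficient is nonzero, so no further factor of the variable
  splits off.\<close>

lemma prod_nonzero_eigenvalues:
  fixes L :: "'c \<Rightarrow> 'c \<Rightarrow> int"
  assumes N: "finite N" and large: "\<And>W. W \<subseteq> N \<Longrightarrow> card W > k \<Longrightarrow> set_det W L = 0"
    and k: "k \<le> card N" and nz: "(\<Sum>W | W \<subseteq> N \<and> card W = k. set_det W L) \<noteq> 0"
  shows "prod_mset {#l \<in># proots (char_poly (indexed_mat N (\<lambda>i j. complex_of_int (L i j)))). l \<noteq> 0#}
    = of_int (\<Sum>W | W \<subseteq> N \<and> card W = k. set_det W L)"
proof -
  let ?c = "\<lambda>W. of_int ((-1) ^ card W * set_det W L) :: complex"
  define q where "q = (\<Sum>W | W \<subseteq> N \<and> card W \<le> k. monom (?c W) (k - card W))"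
  have fin: "finite {W. W \<subseteq> N \<and> card W \<le> k}" using N by (auto intro: finite_subset[of _ "Pow N"])
  have "char_poly (indexed_mat N (\<lambda>i j. complex_of_int (L i j)))
      = (\<Sum>W | W \<subseteq> N \<and> card W \<le> k. monom (?c W) (card N - card W))"
    unfolding char_poly_indexed_mat[OF N]
    by (rule sum.mono_neutral_right) (use N large in \<open>auto simp: not_le\<close>)
  also have "\<dots> = monom 1 (card N - k) * q"
    unfolding q_def sum_distrib_left by (rule sum.cong) (use k in \<open>auto simp: mult_monom\<close>)
  finally have cp: "char_poly (indexed_mat N (\<lambda>i j. complex_of_int (L i j))) = monom 1 (card N - k) * q" .
  have coeff: "coeff q j = (\<Sum>W | W \<subseteq> N \<and> card W \<le> k. if k - card W = j then ?c W else 0)" for j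
    by (simp only: q_def coeff_sum coeff_monom)
  have q0: "coeff q 0 = (-1) ^ k * of_int (\<Sum>W | W \<subseteq> N \<and> card W = k. set_det W L)"
  proof -
    have "coeff q 0 = (\<Sum>W | W \<subseteq> N \<and> card W = k. ?c W)"
      unfolding coeff by (rule sum.mono_neutral_cong_right) (use fin in auto)
    then show ?thesis by (simp add: sum_distrib_left)
  qed
  have qk: "coeff q k = 1"
  proof -
    have "coeff q k = (\<Sum>W \<in> {{}}. ?c W)"
      unfolding coeff
    proof (rule sum.mono_neutral_cong_right[OF fin])
      show "\<forall>W\<in>{W. W \<subseteq> N \<and> card W \<le> k} - {{}}. (if k - card W = k then ?c W else 0) = 0"
      proof
        fix W assume W: "W \<in> {W. W \<subseteq> N \<and> card W \<le> k} - {{}}"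
        then have "card W > 0" using N finite_subset card_gt_0_iff by blast
        then show "(if k - card W = k then ?c W else 0) = 0" using W by auto
      qed
    qed auto
    then show ?thesis by simp
  qed
  have "degree q \<le> k"
    unfolding q_def by (rule degree_sum_le[OF fin]) (rule order_trans[OF degree_monom_le], simp)
  then have deg: "degree q = k" using qk by (simp add: le_antisym le_degree)
  have "poly q 0 \<noteq> 0" using q0 nz by (simp add: poly_0_coeff_0 flip: of_int_sum)
  then show ?thesis
    unfolding cp using prod_nonzero_proots[of q "card N - k"] qk deg q0
    by (simp flip: power_mult_distrib mult.assoc)
qed

section \<open>Reduced homology as a quotient of lattices\<close>

text \<open>The form of the quotient groups that define reduced homology. Here they are reduced to sets of
  chains, so that orders become indices and finiteness, triviality and rank become statements about
  lattices.\<close>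

locale lattice_quotient =
  fixes S :: "'i set" and Z B :: "('i \<Rightarrow>\<^sub>0 int) set"
  assumes Z: "add_subgroup Z" and B: "add_subgroup B" and BZ: "B \<subseteq> Z" and ZS: "Z \<subseteq> frag_chains S"
begin

abbreviation "F \<equiv> subgroup_generated (free_Abelian_group S) Z"
abbreviation "Q \<equiv> F Mod B"

lemma keys_Z: "x \<in> Z \<Longrightarrow> Poly_Mapping.keys x \<subseteq> S"
  using ZS by (auto simp: frag_chains_def)

lemma carrier_F [simp]: "carrier F = Z"
proof -
  have "subgroup Z (free_Abelian_group S)"
    using add_subgroupD[OF Z] keys_Z by unfold_locales auto
  then show ?thesis by (rule subgroup.carrier_subgroup_generated_subgroup)
qed

lemma comm_group_F: "comm_group F"
proof (rule group.group_comm_groupI)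
  show "Group.group F" by (simp add: group.group_subgroup_generated)
qed (simp add: add.commute)

lemma subgroup_B: "subgroup B F"
proof -
  interpret F: comm_group F by (rule comm_group_F)
  show ?thesis
  proof (rule F.subgroupI)
    show "B \<subseteq> carrier F" using BZ by simp
    show "B \<noteq> {}" using add_subgroupD(1)[OF B] by blast
    show "inv\<^bsub>F\<^esub> x \<in> B" if "x \<in> B" for x
    proof -
      have "inv\<^bsub>F\<^esub> x = - x"
        using that BZ add_subgroupD(3)[OF Z] by (intro F.inv_equality) auto
      then show ?thesis using add_subgroupD(3)[OF B that] by simp
    qed
    show "x \<otimes>\<^bsub>F\<^esub> y \<in> B" if "x \<in> B" "y \<in> B" for x y using add_subgroupD(4)[OF B that] by simp
  qed
qed

lemma comm_group_Q: "comm_group Q"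
  using comm_group.abelian_FactGroup[OF comm_group_F subgroup_B] .

lemma r_coset_F: "r_coset F B x = add_coset B x"
  by (auto simp: r_coset_def add_coset_def add.commute)

lemma carrier_Q: "carrier Q = add_coset B ` Z"
  by (auto simp: FactGroup_def RCOSETS_def r_coset_F)

lemma order_Q: "Coset.order Q = add_index Z B"
  by (simp add: Coset.order_def carrier_Q add_index_def)

lemma finite_Q: "finite (carrier Q) \<longleftrightarrow> finite_index Z B"
  by (simp add: carrier_Q finite_index_def)

lemma add_coset_eq_B: "add_coset B x = B \<longleftrightarrow> x \<in> B"
  using add_coset_eq_iff[OF B, of x 0] by (simp add: add_coset_def)

lemma trivial_Q: "trivial_group Q \<longleftrightarrow> Z \<subseteq> B"
proof -
  interpret Q: comm_group Q by (rule comm_group_Q)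
  have "trivial_group Q \<longleftrightarrow> add_coset B ` Z = {B}"
    by (simp add: trivial_group_def Q.is_group carrier_Q)
  also have "\<dots> \<longleftrightarrow> Z \<subseteq> B"
  proof
    assume "add_coset B ` Z = {B}"
    then show "Z \<subseteq> B" using add_coset_eq_B by blast
  next
    assume "Z \<subseteq> B"
    then have "add_coset B x = B" if "x \<in> Z" for x using that add_coset_eq_B by blast
    then show "add_coset B ` Z = {B}" using add_subgroupD(1)[OF Z] by (metis empty_iff image_constant_conv image_cong)
  qed
  finally show ?thesis .
qed

lemma int_pow_F: "x \<in> Z \<Longrightarrow> x [^]\<^bsub>F\<^esub> (k::int) = frag_cmul k x"
proof -
  interpret F: comm_group F by (rule comm_group_F)
  assume x: "x \<in> Z"
  show ?thesis
  proof (induction k rule: int_induct[where k = 0])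
    case (step1 i) then show ?case using x by (simp add: F.int_pow_mult frag_cmul_distrib)
  next
    case (step2 i)
    have "x [^]\<^bsub>F\<^esub> (i - 1) + x = frag_cmul (i - 1) x + x"
      using F.int_pow_mult[of x "i - 1" 1] x step2 by (simp add: frag_cmul_diff_distrib)
    then show ?case by simp
  qed simp
qed

lemma finprod_cosets:
  assumes "finite I" "\<And>i. i \<in> I \<Longrightarrow> u i \<in> Z"
  shows "finprod Q (\<lambda>i. add_coset B (u i) [^]\<^bsub>Q\<^esub> (c i :: int)) I = add_coset B (\<Sum>i\<in>I. frag_cmul (c i) (u i))"
proof -
  interpret F: comm_group F by (rule comm_group_F)
  have "B \<lhd> F" using F.normal_iff_subgroup subgroup_B by blast
  then have hom: "add_coset B \<in> hom F Q"
    using normal.r_coset_hom_Mod[of B F] by (simp add: r_coset_F)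
  have "finprod F (\<lambda>i. u i [^]\<^bsub>F\<^esub> c i) I = (\<Sum>i\<in>I. frag_cmul (c i) (u i))"
    using assms
  proof (induction I rule: finite_induct)
    case (insert i I)
    then have "(\<lambda>i. u i [^]\<^bsub>F\<^esub> c i) \<in> I \<rightarrow> carrier F" "u i [^]\<^bsub>F\<^esub> c i \<in> carrier F"
      by (auto simp del: carrier_F intro!: F.int_pow_closed) (auto)
    then show ?case using insert by (simp add: int_pow_F)
  qed simp
  then show ?thesis
    using hom_finprod_int_pow[OF comm_group_F comm_group_Q hom assms(1), of u c] assms(2) by (simp add: Pi_iff)
qed

lemma int_independent_Q:
  assumes "\<And>t. t \<in> T \<Longrightarrow> u t \<in> Z \<and> add_coset B (u t) = t"
  shows "int_independent Q T \<longleftrightarrow> finite T \<and> (\<forall>c. (\<Sum>t\<in>T. frag_cmul (c t) (u t)) \<in> B \<longrightarrow> (\<forall>t\<in>T. c t = 0))"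
proof -
  interpret Q: comm_group Q by (rule comm_group_Q)
  have "finprod Q (\<lambda>t. t [^]\<^bsub>Q\<^esub> c t) T = \<one>\<^bsub>Q\<^esub> \<longleftrightarrow> (\<Sum>t\<in>T. frag_cmul (c t) (u t)) \<in> B" if "finite T" for c :: "_ \<Rightarrow> int"
  proof -
    have "finprod Q (\<lambda>t. t [^]\<^bsub>Q\<^esub> c t) T = finprod Q (\<lambda>t. add_coset B (u t) [^]\<^bsub>Q\<^esub> c t) T"
    proof (rule Q.finprod_cong')
      have "add_coset B (u t) \<in> carrier Q" if "t \<in> T" for t using assms[OF that] unfolding carrier_Q by blast
      then show "(\<lambda>t. add_coset B (u t) [^]\<^bsub>Q\<^esub> c t) \<in> T \<rightarrow> carrier Q" by (auto intro!: Q.int_pow_closed)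
    qed (use assms in simp_all)
    also have "\<dots> = add_coset B (\<Sum>t\<in>T. frag_cmul (c t) (u t))"
      by (rule finprod_cosets[OF that]) (use assms in blast)
    finally show ?thesis by (simp add: add_coset_eq_B)
  qed
  moreover have "T \<subseteq> carrier Q" using assms unfolding carrier_Q by blast
  ultimately show ?thesis unfolding int_independent_def by blast
qed

lemma int_independent_lin_indep:
  assumes "int_independent Q T"
  obtains u where "finite T" "\<And>t. t \<in> T \<Longrightarrow> u t \<in> Z" "lin_indep T u"
proof -
  have T: "finite T" "T \<subseteq> add_coset B ` Z" using assms by (auto simp: int_independent_def carrier_Q)
  then have "\<forall>t\<in>T. \<exists>z. z \<in> Z \<and> add_coset B z = t" by blast
  then obtain u where u: "\<And>t. t \<in> T \<Longrightarrow> u t \<in> Z \<and> add_coset B (u t) = t" by metis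
  then have "lin_indep T u"
    using int_independent_Q[of T u] assms add_subgroupD(1)[OF B] by (auto simp: lin_indep_family[OF T(1)])
  then show ?thesis using that T u by blast
qed

text \<open>An element of infinite order modulo \<open>B\<close> would form an independent set. The supremum in the
  definition of the rank is at least its size, as independent sets are bounded by the number of
  cells.\<close>

lemma rank_zero_torsion:
  assumes "finite S" "abelian_rank Q = 0" "z \<in> Z"
  shows "\<exists>m. m \<noteq> 0 \<and> frag_cmul m z \<in> B"
proof (rule ccontr)
  assume neg: "\<not> (\<exists>m. m \<noteq> 0 \<and> frag_cmul m z \<in> B)"
  have "int_independent Q {add_coset B z}"
  proof (subst int_independent_Q[where u = "\<lambda>_. z"])
    show "finite {add_coset B z} \<and> (\<forall>c. (\<Sum>t\<in>{add_coset B z}. frag_cmul (c t) z) \<in> B \<longrightarrow> (\<forall>t\<in>{add_coset B z}. c t = 0))"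
      using neg by auto
  qed (use assms in auto)
  then have "1 \<in> card ` {T. int_independent Q T}" by (intro image_eqI[of _ _ "{add_coset B z}"]) auto
  moreover have "bdd_above (card ` {T. int_independent Q T})"
  proof (rule bdd_aboveI)
    fix n assume "n \<in> card ` {T. int_independent Q T}"
    then obtain T where T: "int_independent Q T" "n = card T" by blast
    obtain u where "finite T" "\<And>t. t \<in> T \<Longrightarrow> u t \<in> Z" "lin_indep T u"
      by (rule int_independent_lin_indep[OF T(1)]) blast
    then show "n \<le> card S" using lin_indep_card_le[of T S u] assms(1) ZS T(2) by blast
  qed
  ultimately have "1 \<le> abelian_rank Q" unfolding abelian_rank_def by (rule cSup_upper)
  then show False using assms(2) by simp
qed

text \<open>Distinct fundamental cycles give distinct cosets of the trivial subgroup, and they attain the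
  bound of \<open>card_le_cycle_rank\<close>.\<close>

lemma rank_cycles:
  assumes "finite S" and ZB: "Z = cycles S v" "B = {0}"
  shows "abelian_rank Q = cycle_rank S v"
proof -
  have le: "n \<le> cycle_rank S v" if n: "n \<in> card ` {T. int_independent Q T}" for n
  proof -
    obtain T where T: "int_independent Q T" "n = card T" using n by blast
    obtain u where "finite T" "\<And>t. t \<in> T \<Longrightarrow> u t \<in> Z" "lin_indep T u"
      by (rule int_independent_lin_indep[OF T(1)]) blast
    then show ?thesis using card_le_cycle_rank[of S T u v] assms(1) ZB T(2) by blast
  qed
  let ?W = "S - max_indep S v"
  have W: "finite ?W" using assms(1) by simp
  obtain z where z: "\<And>w. w \<in> ?W \<Longrightarrow> z w \<in> cycles S v"
    and zi: "\<And>c. (\<And>w. w \<in> ?W \<Longrightarrow> c w \<noteq> 0) \<Longrightarrow> lin_indep ?W (\<lambda>w. frag_cmul (c w) (z w))"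
    using independent_cycles[OF assms(1), of v] by blast
  have L: "lin_indep ?W z" using zi[of "\<lambda>_. 1"] by simp
  have L': "(\<Sum>w\<in>?W. frag_cmul (a w) (z w)) = 0 \<Longrightarrow> w \<in> ?W \<Longrightarrow> a w = 0" for a w
    using L unfolding lin_indep_family[OF W] by blast
  have inj: "inj_on z ?W"
  proof (rule inj_onI, rule ccontr)
    fix w w' assume w: "w \<in> ?W" "w' \<in> ?W" "z w = z w'" "w \<noteq> w'"
    let ?a = "\<lambda>i. if i = w then 1 else if i = w' then - 1 else (0::int)"
    have "(\<Sum>i\<in>?W. frag_cmul (?a i) (z i)) = (\<Sum>i\<in>{w, w'}. frag_cmul (?a i) (z i))"
      by (rule sum.mono_neutral_right) (use w W in auto)
    also have "\<dots> = 0" using w by simp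
    finally show False using L'[of ?a w] w by simp
  qed
  let ?f = "\<lambda>w. add_coset B (z w)"
  have c0: "add_coset B x = {x}" for x by (simp add: add_coset_def ZB)
  have injf: "inj_on ?f ?W" using inj by (auto simp: c0 inj_on_def)
  define u where "u = (\<lambda>t. z (inv_into ?W ?f t))"
  have uf: "u (?f w) = z w" if "w \<in> ?W" for w
    unfolding u_def by (simp only: inv_into_f_f[OF injf that])
  have "int_independent Q (?f ` ?W)"
  proof (subst int_independent_Q[where u = u])
    show "u t \<in> Z \<and> add_coset B (u t) = t" if "t \<in> ?f ` ?W" for t
      using that uf z ZB by auto
    show "finite (?f ` ?W) \<and> (\<forall>c. (\<Sum>t\<in>?f ` ?W. frag_cmul (c t) (u t)) \<in> B \<longrightarrow> (\<forall>t\<in>?f ` ?W. c t = 0))"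
    proof (intro conjI allI impI ballI)
      fix c t assume c: "(\<Sum>t\<in>?f ` ?W. frag_cmul (c t) (u t)) \<in> B" and t: "t \<in> ?f ` ?W"
      have "(\<Sum>t\<in>?f ` ?W. frag_cmul (c t) (u t)) = (\<Sum>w\<in>?W. frag_cmul (c (?f w)) (z w))"
        by (subst sum.reindex[OF injf]) (auto intro!: sum.cong simp: uf)
      then have "(\<Sum>w\<in>?W. frag_cmul (c (?f w)) (z w)) = 0" using c ZB by simp
      then show "c t = 0" using L'[of "\<lambda>w. c (?f w)"] t by blast
    qed (use W in simp)
  qed
  moreover have "card (?f ` ?W) = cycle_rank S v" using card_image[OF injf] by (simp add: cycle_rank_def)
  ultimately have "cycle_rank S v \<in> card ` {T. int_independent Q T}" by (metis (mono_tags, lifting) CollectI image_eqI)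
  then show ?thesis unfolding abelian_rank_def using le by (intro cSup_eq_maximum) auto
qed

end

section \<open>The augmented cellular chain complex\<close>

abbreviation aug_boundary :: "('a, 'c) cw_complex \<Rightarrow> 'c option \<Rightarrow> 'c option \<Rightarrow>\<^sub>0 int" where
  "aug_boundary \<equiv> augmented_cell_boundary"

lemma carrier_free_Abelian_group_eq: "carrier (free_Abelian_group A) = frag_chains A"
  by (auto simp: frag_chains_def)

lemma red_homology_eq:
  "red_homology i Y = subgroup_generated (free_Abelian_group (augmented_cells Y i)) (cycles (augmented_cells Y i) (aug_boundary Y))
     Mod frag_span (augmented_cells Y (i + 1)) (aug_boundary Y)"
proof -
  have "kernel (red_chains i Y) (red_chains (i - 1) Y) (red_boundary Y) = cycles (augmented_cells Y i) (aug_boundary Y)"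
    by (auto simp: kernel_def red_chains_def cycles_def frag_chains_def red_boundary_def)
  moreover have "red_boundary Y ` carrier (red_chains (i + 1) Y) = frag_span (augmented_cells Y (i + 1)) (aug_boundary Y)"
    by (simp add: red_chains_def frag_span_def red_boundary_def carrier_free_Abelian_group_eq)
  ultimately show ?thesis by (simp add: red_homology_def red_chains_def)
qed

lemma cycles_subset: "cycles S v \<subseteq> frag_chains S"
  by (auto simp: cycles_def)

lemma frag_span_cong: "(\<And>x. x \<in> S \<Longrightarrow> v x = w x) \<Longrightarrow> frag_span S v = frag_span S w"
  and cycles_cong: "(\<And>x. x \<in> S \<Longrightarrow> v x = w x) \<Longrightarrow> cycles S v = cycles S w"
proof -
  assume *: "\<And>x. x \<in> S \<Longrightarrow> v x = w x"
  have "frag_extend v x = frag_extend w x" if "x \<in> frag_chains S" for x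
    by (rule frag_extend_eq) (use that * in \<open>auto simp: frag_chains_def\<close>)
  then show "frag_span S v = frag_span S w" "cycles S v = cycles S w"
    by (auto simp: frag_span_def cycles_def)
qed

context finite_cw
begin

abbreviation "aug \<equiv> augmented_cells X"
abbreviation "bd \<equiv> aug_boundary X"

lemma finite_augmented_cells: "finite (aug i)"
  by (simp add: augmented_cells_def finite_cells_of_dim)

lemma augmented_cells_nonneg: "0 \<le> i \<Longrightarrow> aug i = Some ` cells_of_dim X i"
  by (auto simp: augmented_cells_def)

lemma aug_boundary_Some:
  assumes "\<sigma> \<in> cells_of_dim X (int (Suc n))"
  shows "bd (Some \<sigma>) = (\<Sum>\<rho>\<in>cells_of_dim X (int n). frag_cmul (incidence X \<rho> \<sigma>) (frag_of (Some \<rho>)))"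
  using assms by (simp add: cells_of_dim_def)

lemma lookup_aug_boundary:
  assumes "\<sigma> \<in> cells_of_dim X (int (Suc n))" "\<rho> \<in> cells_of_dim X (int n)"
  shows "coef (bd (Some \<sigma>)) (Some \<rho>) = incidence X \<rho> \<sigma>"
proof -
  have "coef (bd (Some \<sigma>)) (Some \<rho>)
    = (\<Sum>\<tau>\<in>cells_of_dim X (int n). if \<tau> = \<rho> then incidence X \<rho> \<sigma> else 0)"
    unfolding aug_boundary_Some[OF assms(1)] lookup_sum_frag
    by (rule sum.cong) (auto simp: lookup_single when_def)
  also have "\<dots> = incidence X \<rho> \<sigma>" using assms(2) finite_cells_of_dim[of "int n"] by simp
  finally show ?thesis .
qed

text \<open>A vertex is sent to the empty cell, which has no boundary. For edges this is the augmentation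
  identity, and in higher dimensions it is \<open>incidence_incidence\<close>.\<close>

theorem aug_boundary_cycle:
  assumes "\<sigma> \<in> aug i"
  shows "bd \<sigma> \<in> cycles (aug (i - 1)) bd"
proof -
  consider "\<sigma> = None" | s where "\<sigma> = Some s" "s \<in> cells_of_dim X i" "i = 0"
    | s where "\<sigma> = Some s" "s \<in> cells_of_dim X i" "i = 1"
    | s n where "\<sigma> = Some s" "s \<in> cells_of_dim X i" "i = int (Suc (Suc n))"
  proof -
    have "\<exists>n. i = int (Suc (Suc n))" if "i \<noteq> 0" "i \<noteq> 1" "s \<in> cells_of_dim X i" for s
    proof -
      have "i \<ge> 0" using that by (auto simp: cells_of_dim_def)
      then have "i = int (Suc (Suc (nat (i - 2))))" using that by simp
      then show ?thesis by blast
    qed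
    moreover have "\<sigma> = None \<or> (\<exists>s. \<sigma> = Some s \<and> s \<in> cells_of_dim X i)"
      using assms by (auto simp: augmented_cells_def split: if_splits)
    ultimately show ?thesis using that by blast
  qed
  then show ?thesis
  proof cases
    case 1
    then show ?thesis using add_subgroupD(1)[OF add_subgroup_cycles] by simp
  next
    case 2
    then have "bd \<sigma> = frag_of None" by (auto simp: cells_of_dim_def)
    moreover have "None \<in> aug (i - 1)" using 2 by (simp add: augmented_cells_def)
    ultimately show ?thesis by (simp add: cycles_def chains_frag_of)
  next
    case 3
    have s: "s \<in> cells_of_dim X (int (Suc 0))" using 3 by simp
    have eq: "bd \<sigma> = (\<Sum>\<rho>\<in>cells_of_dim X 0. frag_cmul (incidence X \<rho> s) (frag_of (Some \<rho>)))"
      using aug_boundary_Some[OF s] 3 by simp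
    have "frag_extend bd (bd \<sigma>)
       = (\<Sum>\<rho>\<in>cells_of_dim X 0. frag_cmul (incidence X \<rho> s) (frag_of None))"
      unfolding eq frag_extend_sum_finite by (rule sum.cong) (auto simp: frag_extend_cmul cells_of_dim_def)
    also have "\<dots> = frag_cmul (\<Sum>\<rho>\<in>cells_of_dim X 0. incidence X \<rho> s) (frag_of None)"
      by (rule poly_mapping_eqI) (simp add: lookup_sum_frag sum_distrib_right)
    also have "\<dots> = 0" using incidence_augmentation[of s] 3 by simp
    finally have "frag_extend bd (bd \<sigma>) = 0" .
    moreover have "bd \<sigma> \<in> frag_chains (aug (i - 1))"
      unfolding chains_iff eq lookup_sum_frag using 3
      by (auto simp: augmented_cells_def lookup_single when_def intro!: sum.neutral)
    ultimately show ?thesis by (simp add: cycles_def)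
  next
    case 4
    have s: "s \<in> cells_of_dim X (int (Suc (Suc n)))" using 4 by simp
    let ?C = "cells_of_dim X (int (Suc n))" and ?C' = "cells_of_dim X (int n)"
    have eq: "bd \<sigma> = (\<Sum>\<rho>\<in>?C. frag_cmul (incidence X \<rho> s) (frag_of (Some \<rho>)))"
      using aug_boundary_Some[OF s] 4 by simp
    have "frag_extend bd (bd \<sigma>)
       = (\<Sum>\<rho>\<in>?C. frag_cmul (incidence X \<rho> s) (bd (Some \<rho>)))"
      unfolding eq frag_extend_sum_finite by (rule sum.cong) (auto simp: frag_extend_cmul)
    also have "\<dots> = (\<Sum>\<rho>\<in>?C. \<Sum>\<tau>\<in>?C'. frag_cmul (incidence X \<tau> \<rho> * incidence X \<rho> s) (frag_of (Some \<tau>)))"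
    proof (rule sum.cong)
      fix \<rho> assume "\<rho> \<in> ?C"
      then show "frag_cmul (incidence X \<rho> s) (bd (Some \<rho>)) 
        = (\<Sum>\<tau>\<in>?C'. frag_cmul (incidence X \<tau> \<rho> * incidence X \<rho> s) (frag_of (Some \<tau>)))"
        by (simp only: aug_boundary_Some frag_cmul_sum frag_cmul_cmul mult.commute)
    qed simp
    also have "\<dots> = (\<Sum>\<tau>\<in>?C'. frag_cmul (\<Sum>\<rho>\<in>?C. incidence X \<tau> \<rho> * incidence X \<rho> s) (frag_of (Some \<tau>)))"
      by (subst sum.swap) (auto intro!: sum.cong poly_mapping_eqI simp: lookup_sum_frag sum_distrib_right)
    also have "\<dots> = 0"
      by (rule sum.neutral) (use incidence_incidence[OF s] in auto)
    finally have "frag_extend bd (bd \<sigma>) = 0" .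
    moreover have "bd \<sigma> \<in> frag_chains (aug (i - 1))"
      unfolding chains_iff eq lookup_sum_frag using 4
      by (auto simp: augmented_cells_def lookup_single when_def intro!: sum.neutral)
    ultimately show ?thesis by (simp add: cycles_def)
  qed
qed

lemma frag_span_subset_cycles:
  assumes "S \<subseteq> aug i"
  shows "frag_span S bd \<subseteq> cycles (aug (i - 1)) bd"
proof -
  interpret lattice_complex S "aug (i - 1)" "bd" "bd"
    using assms aug_boundary_cycle finite_augmented_cells finite_subset by unfold_locales blast+
  show ?thesis by (rule span_a_cycles) simp
qed


lemma aug_boundary_restrict:
  assumes "T \<subseteq> cw_cells X" "\<sigma> \<in> T" "cells_upto X (int (cw_celldim X \<sigma>) - 1) \<subseteq> T"
  shows "aug_boundary (cw_restrict X T) (Some \<sigma>) = bd (Some \<sigma>)"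
proof (cases "cw_celldim X \<sigma>")
  case (Suc n)
  have "cells_of_dim (cw_restrict X T) (int n) = cells_of_dim X (int n)"
    using assms Suc by (auto simp: cells_of_dim_restrict cells_of_dim_def cells_upto_def)
  moreover have "incidence (cw_restrict X T) \<rho> \<sigma> = incidence X \<rho> \<sigma>" for \<rho>
    using incidence_restrict[OF assms(1) _ assms(2) Suc] assms(3) Suc by simp
  ultimately show ?thesis using Suc by simp
qed simp

section \<open>Spanning trees as bases\<close>

definition with_skeleton :: "int \<Rightarrow> 'c set \<Rightarrow> ('a, 'c) cw_complex" where
  "with_skeleton k S = cw_restrict X (cells_upto X (k - 1) \<union> S)"

context
  fixes k :: int and S :: "'c set"
  assumes k: "0 \<le> k" and S: "S \<subseteq> cells_of_dim X k"
begin

lemma with_skeleton_cells: "cells_upto X (k - 1) \<union> S \<subseteq> cw_cells X"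
  using S cells_upto_subset cells_of_dim_subset by blast

lemma augmented_cells_with_skeleton:
  shows "augmented_cells (with_skeleton k S) k = Some ` S"
    and "augmented_cells (with_skeleton k S) (k + 1) = {}"
    and "j < k \<Longrightarrow> augmented_cells (with_skeleton k S) j = aug j"
  using S k by (auto simp: augmented_cells_def with_skeleton_def cells_of_dim_restrict[OF with_skeleton_cells]
      cells_of_dim_def cells_upto_def)

lemma aug_boundary_with_skeleton:
  assumes "x \<in> Some ` S \<or> (\<exists>j<k. x \<in> aug j)"
  shows "aug_boundary (with_skeleton k S) x = bd x"
proof (cases x)
  case (Some \<sigma>)
  then have "\<sigma> \<in> cells_upto X (k - 1) \<union> S" "int (cw_celldim X \<sigma>) \<le> k"
    using assms S by (auto simp: augmented_cells_def cells_of_dim_def cells_upto_def split: if_splits)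
  then show ?thesis
    unfolding with_skeleton_def Some
    by (intro aug_boundary_restrict[OF with_skeleton_cells]) (auto simp: cells_upto_def)
qed simp

lemma red_homology_top:
  "red_homology k (with_skeleton k S) = subgroup_generated (free_Abelian_group (Some ` S)) (cycles (Some ` S) bd) Mod {0}"
proof -
  have "frag_span {} v = {0}" for v :: "'c option \<Rightarrow> 'c option \<Rightarrow>\<^sub>0 int"
    by (auto simp: frag_span_def frag_chains_def)
  moreover have "cycles (Some ` S) (aug_boundary (with_skeleton k S)) = cycles (Some ` S) bd"
    by (rule cycles_cong) (simp add: aug_boundary_with_skeleton)
  ultimately show ?thesis by (simp add: red_homology_eq augmented_cells_with_skeleton)
qed

lemma red_homology_below:
  "red_homology (k - 1) (with_skeleton k S)
    = subgroup_generated (free_Abelian_group (aug (k - 1))) (cycles (aug (k - 1)) bd)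
      Mod frag_span (Some ` S) bd"
proof -
  have "frag_span (Some ` S) (aug_boundary (with_skeleton k S)) = frag_span (Some ` S) bd"
    by (rule frag_span_cong) (simp add: aug_boundary_with_skeleton)
  moreover have "cycles (aug (k - 1)) (aug_boundary (with_skeleton k S)) = cycles (aug (k - 1)) bd"
    by (rule cycles_cong) (rule aug_boundary_with_skeleton, auto intro: exI[of _ "k - 1"])
  ultimately show ?thesis by (simp add: red_homology_eq augmented_cells_with_skeleton)
qed

lemma lattice_quotient_top:
  "lattice_quotient (Some ` S) (cycles (Some ` S) bd) {0}"
  by unfold_locales (auto simp: add_subgroup_cycles add_subgroup_def cycles_def chains_zero chains_diff frag_extend_diff)

lemma Some_S_subset: "Some ` S \<subseteq> aug k"
  using S k by (auto simp: augmented_cells_def)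

lemma lattice_quotient_below:
  "lattice_quotient (aug (k - 1)) (cycles (aug (k - 1)) bd)
     (frag_span (Some ` S) bd)"
  using frag_span_subset_cycles[OF Some_S_subset]
  by unfold_locales (simp_all add: add_subgroup_cycles add_subgroup_span cycles_subset)

lemma trivial_top_iff: "trivial_group (red_homology k (with_skeleton k S)) \<longleftrightarrow> lin_indep (Some ` S) bd"
  unfolding red_homology_top lattice_quotient.trivial_Q[OF lattice_quotient_top] lin_indep_iff_cycles
  using add_subgroupD(1)[OF add_subgroup_cycles] by blast

lemma order_below:
  "Coset.order (red_homology (k - 1) (with_skeleton k S))
     = add_index (cycles (aug (k - 1)) bd) (frag_span (Some ` S) bd)"
  "finite (carrier (red_homology (k - 1) (with_skeleton k S)))
     \<longleftrightarrow> finite_index (cycles (aug (k - 1)) bd) (frag_span (Some ` S) bd)"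
  unfolding red_homology_below
  by (rule lattice_quotient.order_Q[OF lattice_quotient_below], rule lattice_quotient.finite_Q[OF lattice_quotient_below])

lemma subcomplex_with_skeleton: "subcomplex X (cells_upto X (k - 1) \<union> S)"
  unfolding subcomplex_def
proof (intro conjI ballI with_skeleton_cells)
  fix \<sigma> assume \<sigma>: "\<sigma> \<in> cells_upto X (k - 1) \<union> S"
  let ?T = "cells_upto X (k - 1) \<union> S"
  have "\<sigma> \<in> cells_of_dim X (int (cw_celldim X \<sigma>))" using \<sigma> with_skeleton_cells by (auto simp: cells_of_dim_def)
  moreover have "cells_upto X (int (cw_celldim X \<sigma>) - 1) \<subseteq> ?T"
    using \<sigma> S by (auto simp: cells_upto_def cells_of_dim_def)
  ultimately have "cw_char X \<sigma> ` ndisk_sphere (cw_celldim X \<sigma>) \<subseteq> cell_union X ?T" by (rule sphere_in_skeleton)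
  then show "closed_cell X \<sigma> \<subseteq> (\<Union>\<tau>\<in>?T. open_cell X \<tau>)"
    using \<sigma> unfolding closed_cell_eq cell_union_def by blast
qed

end

lemma skeleton_eq: "skeleton X k = with_skeleton k (cells_of_dim X k)"
  by (simp add: skeleton_def with_skeleton_def cells_upto_Un[symmetric])

lemma red_betti_top_skeleton:
  assumes "0 \<le> k"
  shows "red_betti k (skeleton X k) = cycle_rank (aug k) bd"
  unfolding red_betti_def skeleton_eq red_homology_top[OF assms order_refl] augmented_cells_nonneg[OF assms]
  by (rule lattice_quotient.rank_cycles[OF lattice_quotient_top[OF assms order_refl]]) (simp_all add: finite_cells_of_dim)

lemma red_betti_below_skeleton:
  assumes "0 \<le> k"
  shows "red_betti (k - 1) (skeleton X k) = red_betti (k - 1) X"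
  unfolding red_betti_def skeleton_eq red_homology_below[OF assms order_refl] red_homology_eq[of "k - 1" X]
  by (simp add: augmented_cells_nonneg[OF assms])

text \<open>A spanning tree contains the whole skeleton below dimension \<open>k\<close> and is thus determined by its
  \<open>k\<close>-cells \<open>S\<close>. As there are no higher cells, its top homology group consists of the cycles on \<open>S\<close>
  and vanishes exactly when the boundaries of \<open>S\<close> are independent. The skeleton and \<open>X\<close> have the
  same Betti number in degree \<open>k - 1\<close>, so by the second hypothesis this number drops out of the
  condition on the size of \<open>S\<close>.\<close>

lemma spanning_trees_eq:
  assumes k: "0 \<le> k" and b: "red_betti (k - 1) X = 0"
  shows "spanning_trees k X = (\<lambda>S. cells_upto X (k - 1) \<union> S) ` {S. S \<subseteq> cells_of_dim X k \<and> lin_indep (Some ` S) bd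
     \<and> finite_index (cycles (aug (k - 1)) bd) (frag_span (Some ` S) bd)
     \<and> card S + cycle_rank (aug k) bd = card (cells_of_dim X k)}"
proof -
  have iff: "cells_upto X (k - 1) \<union> S \<in> spanning_trees k X \<longleftrightarrow> lin_indep (Some ` S) bd
     \<and> finite_index (cycles (aug (k - 1)) bd) (frag_span (Some ` S) bd)
     \<and> card S + cycle_rank (aug k) bd = card (cells_of_dim X k)"
    if S: "S \<subseteq> cells_of_dim X k" for S
  proof -
    let ?T = "cells_upto X (k - 1) \<union> S"
    have "?T \<subseteq> cells_upto X k" using S by (auto simp: cells_upto_def cells_of_dim_def)
    moreover have "cells_upto (cw_restrict X ?T) (k - 1) = cells_upto X (k - 1)"
      using S by (auto simp: cells_upto_restrict[OF with_skeleton_cells[OF k S]] cells_upto_def cells_of_dim_def)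
    moreover have "cells_of_dim (cw_restrict X ?T) k = S"
      using S by (auto simp: cells_of_dim_restrict[OF with_skeleton_cells[OF k S]] cells_upto_def cells_of_dim_def)
    ultimately show ?thesis
      unfolding spanning_trees_def
      using subcomplex_with_skeleton[OF k S] trivial_top_iff[OF k S] order_below(2)[OF k S]
      by (auto simp: with_skeleton_def red_betti_top_skeleton[OF k] red_betti_below_skeleton[OF k] b)
  qed
  show ?thesis
  proof (intro equalityI subsetI)
    fix T assume T: "T \<in> spanning_trees k X"
    then have sub: "T \<subseteq> cells_upto X k" and up: "cells_upto (cw_restrict X T) (k - 1) = cells_upto X (k - 1)"
      by (auto simp: spanning_trees_def)
    let ?S = "T \<inter> cells_of_dim X k"
    have TX: "T \<subseteq> cw_cells X" using sub cells_upto_subset by blast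
    have eq: "T = cells_upto X (k - 1) \<union> ?S"
      using sub up unfolding cells_upto_restrict[OF TX] by (auto simp: cells_upto_def cells_of_dim_def)
    have "cells_upto X (k - 1) \<union> ?S \<in> spanning_trees k X" using T eq by simp
    then show "T \<in> (\<lambda>S. cells_upto X (k - 1) \<union> S) ` {S. S \<subseteq> cells_of_dim X k \<and> lin_indep (Some ` S) bd
     \<and> finite_index (cycles (aug (k - 1)) bd) (frag_span (Some ` S) bd)
     \<and> card S + cycle_rank (aug k) bd = card (cells_of_dim X k)}"
      using iff[of ?S] eq by (intro image_eqI[of _ _ ?S]) auto
  qed (use iff in auto)
qed

lemma tree_number_eq:
  assumes k: "0 \<le> k" and b: "red_betti (k - 1) X = 0"
  shows "tree_number k X = (\<Sum>S | S \<subseteq> aug k \<and> lin_indep S bd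
     \<and> finite_index (cycles (aug (k - 1)) bd) (frag_span S bd)
     \<and> card S + cycle_rank (aug k) bd = card (aug k).
     (add_index (cycles (aug (k - 1)) bd) (frag_span S bd))\<^sup>2)"
proof -
  let ?C = "cells_of_dim X k" and ?A = "cells_upto X (k - 1)"
  let ?P = "\<lambda>S. lin_indep S bd
     \<and> finite_index (cycles (aug (k - 1)) bd) (frag_span S bd)
     \<and> card S + cycle_rank (aug k) bd = card (aug k)"
  let ?g = "\<lambda>S. (add_index (cycles (aug (k - 1)) bd) (frag_span S bd))\<^sup>2"
  have aug: "aug k = Some ` ?C" by (rule augmented_cells_nonneg[OF k])
  have cardS: "card (Some ` S) = card S" for S :: "'c set" by (rule card_image) simp
  have trees: "spanning_trees k X = (\<lambda>S. ?A \<union> S) ` {S. S \<subseteq> ?C \<and> ?P (Some ` S)}"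
    unfolding spanning_trees_eq[OF k b] by (simp add: aug cardS)
  have inj: "inj_on (\<lambda>S. ?A \<union> S) {S. S \<subseteq> ?C \<and> ?P (Some ` S)}"
    by (rule inj_on_inverseI[where g = "\<lambda>T. T \<inter> ?C"]) (auto simp: cells_upto_def cells_of_dim_def)
  have "tree_number k X = (\<Sum>S | S \<subseteq> ?C \<and> ?P (Some ` S). (Coset.order (red_homology (k - 1) (cw_restrict X (?A \<union> S))))\<^sup>2)"
    unfolding tree_number_def trees by (simp add: sum.reindex[OF inj])
  also have "\<dots> = (\<Sum>S | S \<subseteq> ?C \<and> ?P (Some ` S). ?g (Some ` S))"
    by (rule sum.cong) (use order_below(1)[OF k] in \<open>auto simp: with_skeleton_def\<close>)
  also have "\<dots> = (\<Sum>S | S \<subseteq> aug k \<and> ?P S. ?g S)"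
    by (rule sum.reindex_bij_witness[where i = "\<lambda>S. the ` S" and j = "\<lambda>S. Some ` S"])
       (auto simp: aug image_image subset_image_iff)
  finally show ?thesis .
qed

section \<open>The cellular matrix-tree theorem\<close>

context
  fixes d :: int
  assumes dim: "cw_dim X = d" and d: "1 \<le> d" and APC: "APC X"
begin

lemma betti_zero: "j < d \<Longrightarrow> red_betti j X = 0"
  using APC dim by (simp add: APC_def)

lemma lattice_quotient_X:
  "lattice_quotient (aug i) (cycles (aug i) bd)
     (frag_span (aug (i + 1)) bd)"
  using frag_span_subset_cycles[OF order_refl, of "i + 1"]
  by unfold_locales (simp_all add: add_subgroup_cycles add_subgroup_span cycles_subset)

lemma homology_torsion:
  assumes "i < d" "x \<in> cycles (aug i) bd"
  shows "\<exists>m. m \<noteq> 0 \<and> frag_cmul m x \<in> frag_span (aug (i + 1)) bd"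
proof (rule lattice_quotient.rank_zero_torsion[OF lattice_quotient_X finite_augmented_cells _ assms(2)])
  show "abelian_rank (subgroup_generated (free_Abelian_group (aug i)) (cycles (aug i) bd)
     Mod frag_span (aug (i + 1)) bd) = 0"
    using betti_zero[OF assms(1)] by (simp add: red_betti_def red_homology_eq)
qed

abbreviation "low_cycles \<equiv> cycles (aug (d - 2)) bd"

interpretation LC: finite_homology_complex "aug d" "aug (d - 1)"
  "bd" "bd" low_cycles
proof
  show "frag_span (aug (d - 1)) bd \<subseteq> low_cycles"
    using frag_span_subset_cycles[OF order_refl, of "d - 1"] by simp
  then show "finite_index low_cycles (frag_span (aug (d - 1)) bd)"
    using homology_torsion[of "d - 2"]
    by (intro torsion_finite_index[OF finite_augmented_cells[of "d - 2"] add_subgroup_cycles add_subgroup_span])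
       (auto simp: cycles_def)
  show "bd \<sigma> \<in> cycles (aug (d - 1)) bd" if "\<sigma> \<in> aug d" for \<sigma>
    using aug_boundary_cycle[OF that] .
  show "\<exists>m. m \<noteq> 0 \<and> frag_cmul m x \<in> frag_span (aug d) bd"
    if "x \<in> cycles (aug (d - 1)) bd" for x
    using homology_torsion[of "d - 1" x] that by simp
qed (simp_all add: finite_augmented_cells add_subgroup_cycles)

lemma order_X: "Coset.order (red_homology (d - 2) X)
    = add_index low_cycles (frag_span (aug (d - 1)) bd)"
  unfolding red_homology_eq lattice_quotient.order_Q[OF lattice_quotient_X] by simp

text \<open>By rank plus nullity for the top boundary matrix the prescribed number of cells of a tree is \<open>r\<close>.\<close>

lemma tree_number_top: "tree_number d X = LC.top_weight"
proof -
  have "card (max_indep (aug d) bd) \<le> card (aug d)"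
    using max_indep(1)[OF finite_augmented_cells] finite_augmented_cells card_mono by blast
  moreover have "cycle_rank (aug d) bd
      = card (aug d) - card (max_indep (aug d) bd)"
    unfolding cycle_rank_def
    by (intro card_Diff_subset finite_subset[OF max_indep(1)] max_indep(1) finite_augmented_cells)
  ultimately have "card S + cycle_rank (aug d) bd = card (aug d) \<longleftrightarrow> card S = LC.r" for S :: "'c option set"
    using LC.card_max_indep by linarith
  then show ?thesis
    using tree_number_eq[of d] d betti_zero[of "d - 1"] LC.finite_index_tree
    unfolding LC.top_weight_def by (auto intro!: sum.cong)
qed

lemma low_tree_iff:
  assumes "U \<subseteq> aug (d - 1)"
  shows "card U + LC.r = card (aug (d - 1)) \<longleftrightarrow> card (aug (d - 1) - U) = LC.r"
proof -
  have "card (aug (d - 1) - U) = card (aug (d - 1)) - card U" 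
    "card U \<le> card (aug (d - 1))"
    using assms finite_augmented_cells by (auto intro: card_Diff_subset card_mono finite_subset)
  then show ?thesis by linarith
qed

lemma low_tree_finite:
  assumes "U \<subseteq> aug (d - 1)" "card (aug (d - 1) - U) = LC.r" "lin_indep U bd"
  shows "finite_index low_cycles (frag_span U bd)"
proof -
  have "aug (d - 1) - (aug (d - 1) - U) = U" using assms(1) by blast
  then show ?thesis using LC.det_reduced(2)[of "aug (d - 1) - U"] assms by simp
qed

lemma tree_number_low: "tree_number (d - 1) X = LC.low_weight"
  using tree_number_eq[of "d - 1"] d betti_zero[of "d - 2"] low_tree_iff low_tree_finite
  unfolding LC.low_weight_def by (auto intro!: sum.cong)

lemma laplacian_eq:
  assumes "\<rho> \<in> cells_of_dim X (d - 1)" "\<tau> \<in> cells_of_dim X (d - 1)"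
  shows "laplacian_ud (d - 1) X \<rho> \<tau> = (\<Sum>\<sigma>\<in>aug d.
    coef (bd \<sigma>) (Some \<rho>) * coef (bd \<sigma>) (Some \<tau>))"
proof -
  define n where "n = nat (d - 1)"
  have n: "d = int (Suc n)" "d - 1 = int n" using d by (simp_all add: n_def)
  have "(\<Sum>\<sigma>\<in>aug d.
    coef (bd \<sigma>) (Some \<rho>) * coef (bd \<sigma>) (Some \<tau>))
    = (\<Sum>s\<in>cells_of_dim X d. coef (bd (Some s)) (Some \<rho>) * coef (bd (Some s)) (Some \<tau>))"
    using d by (simp add: augmented_cells_nonneg sum.reindex del: augmented_cell_boundary.simps)
  also have "\<dots> = laplacian_ud (d - 1) X \<rho> \<tau>"
    unfolding laplacian_ud_def diff_add_cancel
  proof (rule sum.cong)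
    fix s assume "s \<in> cells_of_dim X d"
    then have "s \<in> cells_of_dim X (int (Suc n))" by (simp only: n(1))
    moreover have "\<rho> \<in> cells_of_dim X (int n)" "\<tau> \<in> cells_of_dim X (int n)" using assms by (simp_all only: n(2))
    ultimately show "coef (bd (Some s)) (Some \<rho>) * coef (bd (Some s)) (Some \<tau>)
      = incidence X \<rho> s * incidence X \<tau> s"
      by (simp only: lookup_aug_boundary)
  qed simp
  finally show ?thesis ..
qed

lemma set_det_laplacian:
  assumes "W \<subseteq> cells_of_dim X (d - 1)"
  shows "set_det W (laplacian_ud (d - 1) X) = set_det (Some ` W) LC.gram"
proof -
  have "finite W" using assms finite_cells_of_dim finite_subset by blast
  moreover have "bij_betw Some W (Some ` W)" by (simp add: bij_betw_def)
  ultimately have "set_det (Some ` W) LC.gram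
    = set_det W (\<lambda>i j. \<Sum>\<sigma>\<in>aug d.
      coef (bd \<sigma>) (Some i) * coef (bd \<sigma>) (Some j))"
    by (intro set_det_reindex[symmetric])
  also have "\<dots> = set_det W (laplacian_ud (d - 1) X)"
    by (rule set_det_cong) (rule laplacian_eq[symmetric]; rule subsetD[OF assms])
  finally show ?thesis ..
qed

lemma aug_codim1: "aug (d - 1) = Some ` cells_of_dim X (d - 1)"
  using d by (intro augmented_cells_nonneg) simp

lemma card_Some [simp]: "card (Some ` S) = card S"
  by (rule card_image) simp

lemma pdet_eq_minor_sum: "pdet_ud d X = of_int LC.minor_sum"
proof -
  let ?N = "cells_of_dim X (d - 1)" and ?L = "laplacian_ud (d - 1) X"
  have sum: "(\<Sum>W | W \<subseteq> ?N \<and> card W = LC.r. set_det W ?L) = LC.minor_sum"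
    unfolding LC.minor_sum_def
    by (rule sum.reindex_bij_witness[where i = "\<lambda>S. the ` S" and j = "\<lambda>S. Some ` S"])
       (auto simp: aug_codim1 image_image subset_image_iff set_det_laplacian)
  have "prod_mset {#l \<in># proots (char_poly (indexed_mat ?N (\<lambda>i j. complex_of_int (?L i j)))). l \<noteq> 0#}
    = of_int (\<Sum>W | W \<subseteq> ?N \<and> card W = LC.r. set_det W ?L)"
  proof (rule prod_nonzero_eigenvalues[OF finite_cells_of_dim])
    show "set_det W ?L = 0" if "W \<subseteq> ?N" "LC.r < card W" for W
      using LC.det_gram_large[of "Some ` W"] that by (simp add: set_det_laplacian aug_codim1 image_mono)
    have "LC.r \<le> card (aug (d - 1))"
      unfolding cycle_rank_def using finite_augmented_cells by (intro card_mono) auto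
    then show "LC.r \<le> card ?N" by (simp add: aug_codim1)
    show "(\<Sum>W | W \<subseteq> ?N \<and> card W = LC.r. set_det W ?L) \<noteq> 0"
      unfolding sum by (rule LC.minor_sum_nonzero)
  qed
  then show ?thesis unfolding pdet_ud_def ud_spectrum_def sum .
qed

theorem pdet_formula:
  "pdet_ud d X = of_nat (tree_number d X) * of_nat (tree_number (d - 1) X) / (of_nat (Coset.order (red_homology (d - 2) X)))\<^sup>2"
proof -
  let ?h = "add_index low_cycles (frag_span (aug (d - 1)) bd)"
  have "of_int (LC.minor_sum * (int ?h)\<^sup>2) = (of_int (int LC.top_weight * int LC.low_weight) :: complex)"
    by (simp only: LC.minor_sum_eq)
  then show ?thesis
    using LC.homology_pos by (simp add: pdet_eq_minor_sum order_X tree_number_top tree_number_low field_simps)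
qed

theorem reduced_laplacian_formula:
  assumes T: "T \<in> spanning_trees (d - 1) X" and U: "U = cells_of_dim (cw_restrict X T) (d - 1)"
    and XU: "XU = cw_restrict X (U \<union> cells_upto X (d - 2))"
  shows "real (tree_number d X) = (real (Coset.order (red_homology (d - 2) X)))\<^sup>2
     / (real (Coset.order (red_homology (d - 2) XU)))\<^sup>2 * real_of_int (det_reduced_laplacian (d - 1) X U)"
proof -
  let ?N = "cells_of_dim X (d - 1)"
  have d1: "0 \<le> d - 1" using d by simp
  have b: "red_betti (d - 1 - 1) X = 0" by (rule betti_zero) simp
  obtain S where S: "T = cells_upto X (d - 2) \<union> S" "S \<subseteq> ?N" "lin_indep (Some ` S) bd"
    "card S + LC.r = card ?N"
    using T unfolding spanning_trees_eq[OF d1 b] by auto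
  have "U = S"
    using S(1,2) with_skeleton_cells[OF d1 S(2)] unfolding U
    by (auto simp: cells_of_dim_restrict cells_upto_def cells_of_dim_def)
  have UN: "Some ` U \<subseteq> aug (d - 1)" using S(2) \<open>U = S\<close> by (auto simp: aug_codim1)
  have XU': "XU = with_skeleton (d - 1) U" unfolding XU with_skeleton_def by (simp add: Un_commute)
  have hU: "Coset.order (red_homology (d - 2) XU) = add_index low_cycles (frag_span (Some ` U) bd)"
    using order_below(1)[OF d1, of U] S(2) \<open>U = S\<close> unfolding XU' by simp
  let ?W = "?N - U"
  have W: "Some ` ?W = aug (d - 1) - Some ` U" by (auto simp: aug_codim1)
  have NW: "aug (d - 1) - Some ` ?W = Some ` U" using UN W by blast
  have cW: "card (Some ` ?W) = LC.r"
    using low_tree_iff[OF UN] S(4) \<open>U = S\<close> unfolding W by (simp add: aug_codim1)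
  have "det_reduced_laplacian (d - 1) X U = set_det ?W (laplacian_ud (d - 1) X)"
    unfolding det_reduced_laplacian_def by (rule det_indexed_mat) (simp add: finite_cells_of_dim)
  also have "\<dots> = set_det (Some ` ?W) LC.gram"
    by (rule set_det_laplacian) auto
  finally have det: "det_reduced_laplacian (d - 1) X U = \<dots>" .
  let ?h = "add_index low_cycles (frag_span (aug (d - 1)) bd)"
  let ?hU = "add_index low_cycles (frag_span (Some ` U) bd)"
  have main: "det_reduced_laplacian (d - 1) X U * (int ?h)\<^sup>2 = (int ?hU)\<^sup>2 * int LC.top_weight"
    using LC.det_reduced(1)[of "Some ` ?W"] W cW S(3) \<open>U = S\<close> unfolding NW det by blast
  have "?hU > 0"
    using low_tree_finite[OF UN] cW S(3) \<open>U = S\<close> W add_index_pos add_subgroupD(1)[OF add_subgroup_cycles] by fastforce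
  moreover have "real_of_int (det_reduced_laplacian (d - 1) X U * (int ?h)\<^sup>2) = real_of_int ((int ?hU)\<^sup>2 * int LC.top_weight)"
    by (simp only: main)
  ultimately show ?thesis
    by (simp add: hU order_X tree_number_top field_simps)
qed

end

end

theorem theorem2p8:
  fixes X :: "('a, 'c) cw_complex" and d :: int
  assumes "finite_cw_complex X" and "cw_dim X = d" and "1 \<le> d" and "APC X"
  shows "pdet_ud d X =
           of_nat (tree_number d X) * of_nat (tree_number (d - 1) X)
             / (of_nat (Coset.order (red_homology (d - 2) X)))\<^sup>2
       \<and> (\<forall>T \<in> spanning_trees (d - 1) X. \<forall>U XU.
            U = cells_of_dim (cw_restrict X T) (d - 1) \<longrightarrow>
            XU = cw_restrict X (U \<union> cells_upto X (d - 2)) \<longrightarrow>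
            real (tree_number d X) =
              (real (Coset.order (red_homology (d - 2) X)))\<^sup>2
                / (real (Coset.order (red_homology (d - 2) XU)))\<^sup>2
                * real_of_int (det_reduced_laplacian (d - 1) X U))"
proof -
  interpret finite_cw X by (rule finite_cw.intro) (fact assms(1))
  show ?thesis
    using pdet_formula[OF assms(2-4)] reduced_laplacian_formula[OF assms(2-4)] by blast
qed

end
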